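(* In the setting described in the context (block Bernoulli vectors $\mathbf{X}_n,\mathbf{Y}_n$ with success probabilities $0<p_i\le q_i<1$, conditioned to have at least $k_n$ successes, giving $\tilde{\mathbf{X}}_n,\tilde{\mathbf{Y}}_n$): If all $\beta_i$ ($i\in\{1,\dots,M\}$) are equal, then $\sup \mathbb{P}(\tilde{\mathbf{X}}_n\le\tilde{\mathbf{Y}}_n)=1$ for every $n\ge 1$. Otherwise, the following holds: (i) If $(k_n-\hat k_n)/\sqrt n\to-\infty$, then $\sup\mathbb{P}(\tilde{\mathbf{X}}_n\le\tilde{\mathbf{Y}}_n)\to 1$ as $n\to\infty$. (ii) If $(k_n-\hat k_n)/\sqrt n\to K$ for some $K\in\mathbb{R}$, then $\sup\mathbb{P}(\tilde{\mathbf{X}}_n\le\tilde{\mathbf{Y}}_n)\to P_K$ as $n\to\infty$. (iii) If $(k_n-\hat k_n)/\sqrt n\to\infty$, then $\sup\mathbb{P}(\tilde{\mathbf{X}}_n\le\tilde{\mathbf{Y}}_n)\to 0$ as $n\to\infty$.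
   Context: Setting. Fix an integer $M\ge1$, numbers $\alpha_1,\dots,\alpha_M\in(0,1)$ with $\sum_{i=1}^M\alpha_i=1$, a number $\alpha\in(0,1)$, and probabilities $0<p_i\le q_i<1$ for $i\in\{1,\dots,M\}$. For every $n\ge1$ the index set $\{1,\dots,n\}$ is partitioned into $M$ blocks, block $i$ having $m_{in}$ elements, so $\sum_{i=1}^M m_{in}=n$, and $m_{in}/n\to\alpha_i$ as $n\to\infty$. A fixed sequence of integers $k_n$ is given with $0\le k_n\le n$ and $k_n/n\to\alpha$. $\mathbf{X}_n$ is a vector of $n$ independent Bernoulli random variables, those with index in block $i$ having success probability $p_i$; $\mathbf{Y}_n$ is a vector of $n$ independent Bernoulli random variables with the same block structure, those in block $i$ having success probability $q_i$. $\tilde{\mathbf{X}}_n$ (resp. $\tilde{\mathbf{Y}}_n$) denotes a random vector having the conditional law of $\mathbf{X}_n$ (resp. $\mathbf{Y}_n$), conditioned on its total number of successes being at least $k_n$. $\sup\mathbb{P}(\tilde{\mathbf{X}}_n\le\tilde{\mathbf{Y}}_n)$ denotes the supremum of $\mathbb{P}(\mathbf{U}\le\mathbf{V})$ over all couplings $(\mathbf{U},\mathbf{V})$ of $\tilde{\mathbf{X}}_n$ and $\tilde{\mathbf{Y}}_n$ (pairs defined on a common probability space with these marginal laws), where $\le$ is the componentwise order. Define $\beta_i:=\frac{p_i}{1-p_i}\,\frac{1-q_i}{q_i}$, $\beta_{\max}:=\max\{\beta_1,\dots,\beta_M\}$, $I:=\{i:\beta_i=\beta_{\max}\}$, and $$\hat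 k_n:=\sum_{i=1}^M\frac{p_i m_{in}}{p_i+\beta_{\max}(1-p_i)}.$$ Define nonnegative numbers $a,b,c$ (all positive when the $\beta_i$ are not all equal) by $$a^2=\sum_{i\in I}\frac{\beta_{\max}p_i(1-p_i)\alpha_i}{(p_i+\beta_{\max}(1-p_i))^2}=\sum_{i\in I}q_i(1-q_i)\alpha_i,\quad b^2=\sum_{i\notin I}\frac{\beta_{\max}p_i(1-p_i)\alpha_i}{(p_i+\beta_{\max}(1-p_i))^2},\quad c^2=a^2+b^2.$$ Let $\Phi$ be the standard normal distribution function. When the $\beta_i$ are not all equal, for $K\in\mathbb{R}$ put $R_K=\sqrt{K^2+c^2\log(c^2/b^2)}$ and $$P_K=1-\int_{-\infty}^{\frac{c-b}{ac}K}\frac{e^{-z^2/2}}{\sqrt{2\pi}}\,\frac{\Phi\bigl(\frac{K-az}{b}\bigr)-\Phi\bigl(\frac Kc\bigr)}{1-\Phi\bigl(\frac Kc\bigr)}\,dz\quad\text{if }\alpha=\sum_{i=1}^M p_i\alpha_i,$$ $$P_K=\Phi\Bigl(\frac{bK}{ac}-\frac1a R_K\Bigr)+\Phi\Bigl(-\frac Ka+\frac{b}{ac}R_K\Bigr)\quad\text{if }\alpha>\sum_{i=1}^M p_i\alpha_i.$$ (In case (ii), $\alpha=\lim_n\hat k_n/n\ge\sum_i p_i\alpha_i$, so one of the two cases applies.) *)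

theory Defs
  imports "HOL-Probability.Probability"
begin

text \<open>
  A vector of \<open>n\<close> Bernoulli variables is a function \<open>nat \<Rightarrow> bool\<close> (\<open>True\<close> is a success) that is
  \<open>False\<close> off the index set \<open>{1..n}\<close>, so the library order on functions is the componentwise order
  on \<open>{1..n}\<close>. The partition of \<open>{1..n}\<close> into \<open>M\<close> labelled, possibly empty, blocks is given by the
  label function \<open>blk n\<close>, mapping \<open>{1..n}\<close> into \<open>{1..M}\<close>.
\<close>

definition block_size :: "(nat \<Rightarrow> nat \<Rightarrow> nat) \<Rightarrow> nat \<Rightarrow> nat \<Rightarrow> nat" where
  "block_size blk i n = card {j \<in> {1..n}. blk n j = i}"

definition bernoulli_vec :: "(nat \<Rightarrow> nat \<Rightarrow> nat) \<Rightarrow> (nat \<Rightarrow> real) \<Rightarrow> nat \<Rightarrow> (nat \<Rightarrow> bool) pmf" where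
  "bernoulli_vec blk p n = Pi_pmf {1..n} False (\<lambda>j. bernoulli_pmf (p (blk n j)))"

definition successes :: "nat \<Rightarrow> (nat \<Rightarrow> bool) \<Rightarrow> nat" where
  "successes n x = card {j \<in> {1..n}. x j}"

text \<open>
  For success probabilities in \<open>(0, 1)\<close> and \<open>k \<le> n\<close> the conditioning event has positive
  probability, which is what \<^const>\<open>cond_pmf\<close> requires.
\<close>

definition cond_bernoulli_vec ::
    "(nat \<Rightarrow> nat \<Rightarrow> nat) \<Rightarrow> (nat \<Rightarrow> real) \<Rightarrow> nat \<Rightarrow> nat \<Rightarrow> (nat \<Rightarrow> bool) pmf" where
  "cond_bernoulli_vec blk p k n = cond_pmf (bernoulli_vec blk p n) {x. k \<le> successes n x}"

text \<open>
  A coupling is represented by its joint law. The marginals used below have finite support, so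
  every joint law is discrete and ranging over \<open>pmf\<close>s loses no coupling.
\<close>

definition couplings :: "'a pmf \<Rightarrow> 'b pmf \<Rightarrow> ('a \<times> 'b) pmf set" where
  "couplings \<mu> \<nu> = {w. map_pmf fst w = \<mu> \<and> map_pmf snd w = \<nu>}"

definition sup_prob_le :: "('a :: order) pmf \<Rightarrow> 'a pmf \<Rightarrow> real" where
  "sup_prob_le \<mu> \<nu> = (SUP w \<in> couplings \<mu> \<nu>. measure_pmf.prob w {(u, v). u \<le> v})"

definition odds_ratio :: "(nat \<Rightarrow> real) \<Rightarrow> (nat \<Rightarrow> real) \<Rightarrow> nat \<Rightarrow> real" where
  "odds_ratio p q i = p i / (1 - p i) * ((1 - q i) / q i)"

definition beta_max :: "nat \<Rightarrow> (nat \<Rightarrow> real) \<Rightarrow> (nat \<Rightarrow> real) \<Rightarrow> real" where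
  "beta_max M p q = Max (odds_ratio p q ` {1..M})"

definition max_blocks :: "nat \<Rightarrow> (nat \<Rightarrow> real) \<Rightarrow> (nat \<Rightarrow> real) \<Rightarrow> nat set" where
  "max_blocks M p q = {i \<in> {1..M}. odds_ratio p q i = beta_max M p q}"

definition k_hat ::
    "nat \<Rightarrow> (nat \<Rightarrow> nat \<Rightarrow> nat) \<Rightarrow> (nat \<Rightarrow> real) \<Rightarrow> (nat \<Rightarrow> real) \<Rightarrow> nat \<Rightarrow> real" where
  "k_hat M blk p q n =
     (\<Sum>i = 1..M. p i * real (block_size blk i n) / (p i + beta_max M p q * (1 - p i)))"

definition var_term ::
    "nat \<Rightarrow> (nat \<Rightarrow> real) \<Rightarrow> (nat \<Rightarrow> real) \<Rightarrow> (nat \<Rightarrow> real) \<Rightarrow> nat \<Rightarrow> real" where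
  "var_term M \<alpha>s p q i =
     beta_max M p q * p i * (1 - p i) * \<alpha>s i / (p i + beta_max M p q * (1 - p i))\<^sup>2"

definition coef_a :: "nat \<Rightarrow> (nat \<Rightarrow> real) \<Rightarrow> (nat \<Rightarrow> real) \<Rightarrow> (nat \<Rightarrow> real) \<Rightarrow> real" where
  "coef_a M \<alpha>s p q = sqrt (\<Sum>i \<in> max_blocks M p q. var_term M \<alpha>s p q i)"

definition coef_b :: "nat \<Rightarrow> (nat \<Rightarrow> real) \<Rightarrow> (nat \<Rightarrow> real) \<Rightarrow> (nat \<Rightarrow> real) \<Rightarrow> real" where
  "coef_b M \<alpha>s p q = sqrt (\<Sum>i \<in> {1..M} - max_blocks M p q. var_term M \<alpha>s p q i)"

definition coef_c :: "nat \<Rightarrow> (nat \<Rightarrow> real) \<Rightarrow> (nat \<Rightarrow> real) \<Rightarrow> (nat \<Rightarrow> real) \<Rightarrow> real" where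
  "coef_c M \<alpha>s p q = sqrt ((coef_a M \<alpha>s p q)\<^sup>2 + (coef_b M \<alpha>s p q)\<^sup>2)"

abbreviation Phi :: "real \<Rightarrow> real" where
  "Phi \<equiv> cdf std_normal_distribution"

text \<open>
  The two branches of \<open>limit_prob\<close> are the cases \<open>\<alpha> = (\<Sum>i = 1..M. p i * \<alpha>s i)\<close> and
  \<open>\<alpha> > (\<Sum>i = 1..M. p i * \<alpha>s i)\<close>. The value for smaller \<open>\<alpha>\<close> is never used: if
  \<open>(k n - k_hat M blk p q n) / sqrt n\<close> converges, then \<open>\<alpha>\<close> is the limit of \<open>k_hat M blk p q n / n\<close>,
  which is at least that sum because \<open>beta_max M p q \<le> 1\<close>.
\<close>

definition limit_prob ::
    "nat \<Rightarrow> real \<Rightarrow> (nat \<Rightarrow> real) \<Rightarrow> (nat \<Rightarrow> real) \<Rightarrow> (nat \<Rightarrow> real) \<Rightarrow> real \<Rightarrow> real" where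
  "limit_prob M \<alpha> \<alpha>s p q K =
     (let a = coef_a M \<alpha>s p q;
          b = coef_b M \<alpha>s p q;
          c = coef_c M \<alpha>s p q;
          R = sqrt (K\<^sup>2 + c\<^sup>2 * ln (c\<^sup>2 / b\<^sup>2))
      in if \<alpha> = (\<Sum>i = 1..M. p i * \<alpha>s i)
         then 1 - (LINT z:{..(c - b) / (a * c) * K}|lborel.
                     exp (- z\<^sup>2 / 2) / sqrt (2 * pi) *
                     ((Phi ((K - a * z) / b) - Phi (K / c)) / (1 - Phi (K / c))))
         else Phi (b * K / (a * c) - 1 / a * R) + Phi (- (K / a) + b / (a * c) * R))"

end

theory Submission
  imports Defs "HOL-Real_Asymp.Real_Asymp"
begin

text \<open>
  Tilting a Bernoulli vector (multiplying all odds by \<open>t\<close>) reweights it by \<open>t\<close> to the total number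
  of successes, so it does not change the conditional law given the total. That conditional law is
  stochastically increasing in the total (induction on the index set; the step needs the
  log-concavity of the law of the total). Hence all comparisons between vectors that are tilted
  and conditioned on their totals reduce to comparing likelihood ratios of the totals.

  Write \<open>X'\<close> for \<open>X\<close> tilted by \<open>1 / \<beta>\<^sub>m\<^sub>a\<^sub>x\<close>. Its success probabilities are those of \<open>Y\<close> on the
  blocks in \<open>I\<close> and smaller than those of \<open>Y\<close> elsewhere, and its mean total is \<open>k_hat\<close>. If \<open>k\<close> is far below
  \<open>k_hat\<close>, conditioning \<open>X'\<close> is harmless and \<open>X\<close> conditioned \<open>\<le>\<close> \<open>X'\<close> conditioned \<open>\<approx>\<close> \<open>X' \<le> Y\<close>. If
  \<open>k\<close> is far above, then the conditioned \<open>X\<close> dominates a slightly stronger tilt, whose total over \<open>I\<close>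
  exceeds that of \<open>Y\<close>. In the critical window only the totals over \<open>I\<close> matter: their optimal
  coupling succeeds with probability \<open>1 - sup (F\<^sub>Y - F\<^sub>X)\<close>, where \<open>F\<^sub>Y\<close> converges to a normal
  distribution function by the central limit theorem. The limit of \<open>F\<^sub>X\<close> is obtained by integrating the
  tail of the total off \<open>I\<close> against the law of the total over \<open>I\<close>; that tail is controlled by the central
  limit theorem if \<open>\<beta>\<^sub>m\<^sub>a\<^sub>x = 1\<close> and by a local limit theorem if \<open>\<beta>\<^sub>m\<^sub>a\<^sub>x < 1\<close>.
\<close>

section \<open>Couplings and stochastic domination\<close>

text \<open>Upper bounds on the supremum always come from one monotone threshold event, which is why
  the failure probability is a gap between distribution functions. Lower bounds may ignore the
  conditioning of \<open>Y\<close>, since it only raises \<open>Y\<close>; in the critical window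
  nothing is lost, because \<alpha> lies strictly below the limiting mean of \<open>Y\<close>. The
  conditioning of \<open>X\<close> is the obstacle: if \<beta> < 1, its event is exponentially
  unlikely. In terms of \<open>X'\<close> it becomes the weight \<beta> to the power of the total,
  restricted to totals of at least \<open>k\<close>. Relative to its value at \<open>k\<close> this
  weight lives on bounded excesses, so point probabilities of order one over the square root of
  \<open>n\<close> decide, and a central limit theorem alone is too coarse. Off \<open>I\<close> the
  means of \<open>X'\<close> and \<open>Y\<close> differ linearly, which leaves room for a tilt
  larger than \<open>1 / \<beta>\<close> and makes the coordinates off \<open>I\<close> harmless.
  The closed forms of the limit come from the sign changes of a difference of two densities: one if
  \<beta> = 1, and two, the roots of a quadratic, if \<beta> < 1.\<close>

abbreviation Pr :: "'a pmf \<Rightarrow> 'a set \<Rightarrow> real" where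
  "Pr \<mu> \<equiv> measure_pmf.prob \<mu>"

text \<open>Records one coupling instead of the supremum, so that couplings can be composed, mixed
  and mapped without approximating a supremum.\<close>

definition coup :: "real \<Rightarrow> ('a :: order) pmf \<Rightarrow> 'a pmf \<Rightarrow> bool" where
  "coup s \<mu> \<nu> \<longleftrightarrow> (\<exists>w \<in> couplings \<mu> \<nu>. s \<le> Pr w {(u, v). u \<le> v})"

lemma bdd_above_couplings:
  "bdd_above ((\<lambda>w. Pr w {(u, v). u \<le> v}) ` couplings \<mu> \<nu>)"
  by (rule bdd_aboveI[of _ 1]) auto

lemma pair_pmf_in_couplings: "pair_pmf \<mu> \<nu> \<in> couplings \<mu> \<nu>"
  by (simp add: couplings_def map_fst_pair_pmf map_snd_pair_pmf)

lemma sup_prob_le_ge: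
  assumes "coup s \<mu> \<nu>" shows "s \<le> sup_prob_le \<mu> \<nu>"
proof -
  obtain w where w: "w \<in> couplings \<mu> \<nu>" "s \<le> Pr w {(u, v). u \<le> v}"
    using assms by (auto simp: coup_def)
  have "Pr w {(u, v). u \<le> v} \<le> sup_prob_le \<mu> \<nu>"
    unfolding sup_prob_le_def by (rule cSUP_upper[OF w(1) bdd_above_couplings])
  with w(2) show ?thesis by simp
qed

lemma sup_prob_le_le:
  assumes "\<And>w. w \<in> couplings \<mu> \<nu> \<Longrightarrow> Pr w {(u, v). u \<le> v} \<le> c"
  shows "sup_prob_le \<mu> \<nu> \<le> c"
  unfolding sup_prob_le_def using pair_pmf_in_couplings[of \<mu> \<nu>] assms
  by (intro cSUP_least) auto

lemma sup_prob_le_le_1: "sup_prob_le \<mu> \<nu> \<le> 1"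
  by (rule sup_prob_le_le) simp

lemma sup_prob_le_nonneg: "0 \<le> sup_prob_le \<mu> \<nu>"
  by (rule sup_prob_le_ge) (auto simp: coup_def intro!: bexI[of _ "pair_pmf \<mu> \<nu>"] pair_pmf_in_couplings)

text \<open>If \<open>u \<le> v\<close>, then \<open>f u \<le> z\<close> or \<open>f v > z\<close>;
  the union bound does the rest. All nontrivial upper bounds on the supremum come from this
  inequality.\<close>

lemma sup_prob_le_threshold:
  fixes f :: "'a :: order \<Rightarrow> real"
  assumes "mono f"
  shows "sup_prob_le \<mu> \<nu> \<le> Pr \<mu> {x. f x \<le> z} + Pr \<nu> {x. f x > z}"
proof (rule sup_prob_le_le)
  fix w assume "w \<in> couplings \<mu> \<nu>"
  hence w: "\<mu> = map_pmf fst w" "\<nu> = map_pmf snd w" by (auto simp: couplings_def)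
  have "Pr w {(u, v). u \<le> v} \<le>
        Pr w ({x. f (fst x) \<le> z} \<union> {x. f (snd x) > z})"
    using monoD[OF assms] by (intro measure_pmf.finite_measure_mono) (force, simp)
  also have "\<dots> \<le> Pr w {x. f (fst x) \<le> z} + Pr w {x. f (snd x) > z}"
    by (rule measure_Un_le) auto
  finally show "Pr w {(u, v). u \<le> v} \<le>
      Pr \<mu> {x. f x \<le> z} + Pr \<nu> {x. f x > z}"
    by (simp add: w vimage_def)
qed

lemma coup_1I:
  assumes "rel_pmf (\<le>) \<mu> \<nu>" shows "coup 1 \<mu> \<nu>"
proof -
  obtain w where w: "\<And>x y. (x, y) \<in> set_pmf w \<Longrightarrow> x \<le> y" "map_pmf fst w = \<mu>" "map_pmf snd w = \<nu>"
    using assms by (auto simp: rel_pmf.simps)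
  have "Pr w {(u, v). u \<le> v} = 1"
    using w(1) by (subst measure_pmf.prob_eq_1) (auto simp: AE_measure_pmf_iff)
  with w show ?thesis by (auto simp: coup_def couplings_def intro!: bexI[of _ w])
qed

text \<open>Glues three couplings along their common marginals. The middle joint law
  \<open>w\<close> is itself coupled to \<open>\<mu>\<close> on the left, giving \<open>c\<close>,
  and \<open>c\<close> is coupled to \<open>\<nu>\<close> on the right, giving \<open>d\<close>;
  under \<open>d\<close> all four vectors live together.\<close>

lemma coup_mono:
  assumes "rel_pmf (\<le>) \<mu> \<mu>'" "coup s \<mu>' \<nu>'" "rel_pmf (\<le>) \<nu>' \<nu>"
  shows "coup s \<mu> \<nu>"
proof -
  obtain w where w: "\<mu>' = map_pmf fst w" "\<nu>' = map_pmf snd w"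
      "s \<le> Pr w {(u, v). u \<le> v}"
    using assms(2) by (auto simp: coup_def couplings_def)
  have "rel_pmf (\<lambda>x y. x \<le> fst y) \<mu> w"
    using assms(1) by (simp add: w pmf.rel_map)
  then obtain c where c: "\<And>x y. (x, y) \<in> set_pmf c \<Longrightarrow> x \<le> fst y" "map_pmf fst c = \<mu>" "map_pmf snd c = w"
    by (cases rule: rel_pmf.cases) auto
  have "rel_pmf (\<lambda>x y. snd (snd x) \<le> y) c \<nu>"
    using assms(3) by (simp add: w c(3)[symmetric] pmf.rel_map)
  then obtain d where d: "\<And>x y. (x, y) \<in> set_pmf d \<Longrightarrow> snd (snd x) \<le> y"
      "map_pmf fst d = c" "map_pmf snd d = \<nu>"
    by (cases rule: rel_pmf.cases) auto
  let ?e = "map_pmf (\<lambda>x. (fst (fst x), snd x)) d"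
  have "map_pmf fst ?e = \<mu>" "map_pmf snd ?e = \<nu>"
    using c(2) d(2,3) by (auto simp: pmf.map_comp o_def)
  hence "?e \<in> couplings \<mu> \<nu>" by (simp add: couplings_def)
  moreover have "s \<le> Pr ?e {(u, v). u \<le> v}"
  proof -
    have "w = map_pmf (\<lambda>x. snd (fst x)) d"
      using c(3) d(2) by (auto simp: pmf.map_comp o_def)
    hence "s \<le> Pr d {x. fst (snd (fst x)) \<le> snd (snd (fst x))}"
      using w(3) by (simp add: vimage_def case_prod_unfold)
    also have "\<dots> \<le> Pr d {x. fst (fst x) \<le> snd x}"
    proof (rule measure_pmf.finite_measure_mono_AE)
      have "fst (fst x) \<le> snd x" if x: "x \<in> set_pmf d" "fst (snd (fst x)) \<le> snd (snd (fst x))" for x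
      proof -
        have "fst x \<in> set_pmf c" using x(1) d(2) by auto
        hence "fst (fst x) \<le> fst (snd (fst x))" using c(1)[of "fst (fst x)" "snd (fst x)"] by simp
        also have "\<dots> \<le> snd (snd (fst x))" by (rule x(2))
        also have "\<dots> \<le> snd x" using d(1)[of "fst x" "snd x"] x(1) by simp
        finally show ?thesis .
      qed
      thus "AE x in d. x \<in> {x. fst (snd (fst x)) \<le> snd (snd (fst x))} \<longrightarrow> x \<in> {x. fst (fst x) \<le> snd x}"
        by (auto simp: AE_measure_pmf_iff)
    qed simp
    finally show ?thesis by (simp add: vimage_def case_prod_unfold)
  qed
  ultimately show ?thesis unfolding coup_def by (rule bexI[rotated])
qed

text \<open>Mixes couplings of the kernels along a coupling \<open>w\<close> of the mixing laws.
  \<open>G\<close> collects the pairs for which a good coupling is known; elsewhere the product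
  coupling serves and its contribution is bounded below by 0.\<close>

lemma coup_bind:
  assumes w: "map_pmf fst w = \<mu>" "map_pmf snd w = \<nu>"
    and "\<And>u v. (u, v) \<in> set_pmf w \<Longrightarrow> (u, v) \<in> G \<Longrightarrow> coup s (A u) (B v)" and "0 \<le> s"
  shows "coup (s * Pr w G) (bind_pmf \<mu> A) (bind_pmf \<nu> B)"
proof -
  have "\<exists>c. c \<in> couplings (A (fst x)) (B (snd x)) \<and>
          (x \<in> set_pmf w \<longrightarrow> x \<in> G \<longrightarrow> s \<le> Pr c {(u, v). u \<le> v})" for x
  proof (cases "x \<in> set_pmf w \<and> x \<in> G")
    case True
    thus ?thesis using assms(3)[of "fst x" "snd x"] by (auto simp: coup_def)
  next
    case False
    thus ?thesis using pair_pmf_in_couplings by blast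
  qed
  then obtain C where C: "\<And>x. C x \<in> couplings (A (fst x)) (B (snd x))"
      "\<And>x. x \<in> set_pmf w \<Longrightarrow> x \<in> G \<Longrightarrow> s \<le> Pr (C x) {(u, v). u \<le> v}"
    by metis
  have "bind_pmf w C \<in> couplings (bind_pmf \<mu> A) (bind_pmf \<nu> B)"
    using C(1) w by (auto simp: couplings_def map_bind_pmf bind_map_pmf)
  moreover have "s * Pr w G \<le> Pr (bind_pmf w C) {(u, v). u \<le> v}"
  proof -
    have "s * Pr w G = (\<integral>x. s * indicator G x \<partial>w)" by simp
    also have "\<dots> \<le> (\<integral>x. Pr (C x) {(u, v). u \<le> v} \<partial>w)"
    proof (rule integral_mono_AE)
      show "integrable w (\<lambda>x. s * indicator G x)"
        by (intro integrable_mult_right measure_pmf.integrable_const_bound[of _ 1]) (auto simp: indicator_def)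
      show "integrable w (\<lambda>x. Pr (C x) {(u, v). u \<le> v})"
        by (intro measure_pmf.integrable_const_bound[of _ 1]) auto
      show "AE x in w. s * indicator G x \<le> Pr (C x) {(u, v). u \<le> v}"
        using C(2) by (auto simp: AE_measure_pmf_iff indicator_def)
    qed
    also have "\<dots> = Pr (bind_pmf w C) {(u, v). u \<le> v}"
      by (subst measure_pmf_bind, subst measure_pmf.measure_bind[where N="count_space UNIV"]) (auto simp: space_subprob_algebra
        intro!: prob_space_imp_subprob_space measure_pmf.prob_space_axioms)
    finally show ?thesis .
  qed
  ultimately show ?thesis by (auto simp: coup_def)
qed

section \<open>Conditional laws and resampling\<close>

lemma pmf_cond_pos: "set_pmf \<mu> \<inter> A \<noteq> {} \<Longrightarrow> 0 < Pr \<mu> A"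
  using measure_pmf_posI[of _ \<mu> A] by auto

text \<open>The factor \<open>c\<close> cancels in the normalisation; this is how a tilt disappears
  once the total is fixed.\<close>

lemma cond_pmf_eqI:
  assumes ne: "set_pmf \<mu> \<inter> A \<noteq> {}" "set_pmf \<nu> \<inter> A \<noteq> {}"
    and eq: "\<And>x. x \<in> A \<Longrightarrow> pmf \<mu> x = c * pmf \<nu> x"
  shows "cond_pmf \<mu> A = cond_pmf \<nu> A"
proof -
  have "Pr \<mu> A = c * Pr \<nu> A"
  proof -
    have "Pr \<mu> A = infsetsum (pmf \<mu>) A" by (simp add: measure_pmf_conv_infsetsum)
    also have "\<dots> = infsetsum (\<lambda>x. c * pmf \<nu> x) A" by (intro infsetsum_cong) (auto simp: eq)
    also have "\<dots> = c * infsetsum (pmf \<nu>) A" by (intro infsetsum_cmult_right) (auto simp: pmf_abs_summable)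
    finally show ?thesis by (simp add: measure_pmf_conv_infsetsum)
  qed
  moreover have "Pr \<mu> A > 0"
    by (rule pmf_cond_pos[OF ne(1)])
  ultimately have c: "c \<noteq> 0" by auto
  show ?thesis
    by (rule pmf_eqI) (use c in \<open>auto simp: pmf_cond ne eq \<open>Pr \<mu> A = _\<close>\<close>)
qed

lemma prob_cond_pmf:
  assumes "set_pmf \<mu> \<inter> A \<noteq> {}"
  shows "Pr (cond_pmf \<mu> A) B = Pr \<mu> (A \<inter> B) / Pr \<mu> A"
proof -
  have "Pr (cond_pmf \<mu> A) B = infsetsum (pmf (cond_pmf \<mu> A)) B" by (simp add: measure_pmf_conv_infsetsum)
  also have "\<dots> = infsetsum (\<lambda>x. if x \<in> A then pmf \<mu> x / Pr \<mu> A else 0) B"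
    by (intro infsetsum_cong) (auto simp: pmf_cond assms)
  also have "\<dots> = infsetsum (\<lambda>x. pmf \<mu> x / Pr \<mu> A) (A \<inter> B)"
    by (intro infsetsum_cong_neutral) auto
  also have "\<dots> = infsetsum (\<lambda>x. pmf \<mu> x) (A \<inter> B) / Pr \<mu> A"
    by (intro infsetsum_cdiv) (auto simp: pmf_abs_summable)
  finally show ?thesis by (simp add: measure_pmf_conv_infsetsum)
qed

lemma prob_cond_pmf_le:
  assumes "set_pmf \<mu> \<inter> A \<noteq> {}"
  shows "Pr (cond_pmf \<mu> A) B \<le> Pr \<mu> B / Pr \<mu> A"
  unfolding prob_cond_pmf[OF assms] by (intro divide_right_mono measure_pmf.finite_measure_mono) auto

lemma bind_cond_pmf_disintegrate:
  "\<mu> = bind_pmf (map_pmf h \<mu>) (\<lambda>b. cond_pmf \<mu> {x. h x = b})"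
proof (rule pmf_eqI)
  fix x
  have "pmf (bind_pmf (map_pmf h \<mu>) (\<lambda>b. cond_pmf \<mu> {x. h x = b})) x =
        measure_pmf.expectation \<mu> (\<lambda>y. pmf (cond_pmf \<mu> {x. h x = h y}) x)"
    by (simp add: bind_map_pmf pmf_bind)
  also have "\<dots> = measure_pmf.expectation \<mu>
      (\<lambda>y. indicator {y. h y = h x} y * (pmf \<mu> x / Pr \<mu> {y. h y = h x}))"
  proof (intro integral_cong_AE)
    show "AE y in \<mu>. pmf (cond_pmf \<mu> {x. h x = h y}) x =
        indicator {y. h y = h x} y * (pmf \<mu> x / Pr \<mu> {y. h y = h x})"
      unfolding AE_measure_pmf_iff
    proof
      fix y assume "y \<in> set_pmf \<mu>"
      hence "set_pmf \<mu> \<inter> {x. h x = h y} \<noteq> {}" by auto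
      thus "pmf (cond_pmf \<mu> {x. h x = h y}) x =
        indicator {y. h y = h x} y * (pmf \<mu> x / Pr \<mu> {y. h y = h x})"
        by (auto simp: pmf_cond indicator_def)
    qed
  qed simp_all
  also have "\<dots> = Pr \<mu> {y. h y = h x} * (pmf \<mu> x / Pr \<mu> {y. h y = h x})"
    by simp
  also have "\<dots> = pmf \<mu> x"
  proof (cases "x \<in> set_pmf \<mu>")
    case True
    hence "Pr \<mu> {y. h y = h x} > 0" by (intro pmf_cond_pos) auto
    thus ?thesis by simp
  qed (simp add: pmf_eq_0_set_pmf[symmetric] del: pmf_eq_0_set_pmf)
  finally show "pmf \<mu> x = pmf (bind_pmf (map_pmf h \<mu>) (\<lambda>b. cond_pmf \<mu> {x. h x = b})) x" ..
qed

text \<open>Resampling: draw \<open>y\<close> from \<open>\<mu>\<close>, keep it if it lies in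
  \<open>A\<close>, and otherwise replace it by a fresh draw from the conditional law. The result
  has the conditional law and equals \<open>y\<close> whenever \<open>y\<close> is in
  \<open>A\<close>.\<close>

lemma coup_cond:
  fixes \<mu> :: "'a :: order pmf"
  assumes ne: "set_pmf \<mu> \<inter> A \<noteq> {}"
  shows "coup (Pr \<mu> A) (cond_pmf \<mu> A) \<mu>"
proof -
  define w where "w = bind_pmf \<mu> (\<lambda>y. map_pmf (\<lambda>x. (x, y)) (if y \<in> A then return_pmf y else cond_pmf \<mu> A))"
  have snd: "map_pmf snd w = \<mu>"
    by (simp add: w_def map_bind_pmf pmf.map_comp o_def map_pmf_const bind_return_pmf')
  have "map_pmf fst w = bind_pmf \<mu> (\<lambda>y. if y \<in> A then return_pmf y else cond_pmf \<mu> A)"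
    by (simp add: w_def map_bind_pmf pmf.map_comp o_def)
  also have "\<dots> = cond_pmf \<mu> A"
  proof (rule pmf_eqI)
    fix x
    let ?P = "Pr \<mu> A"
    have P: "?P > 0" by (rule pmf_cond_pos[OF ne])
    have "pmf (bind_pmf \<mu> (\<lambda>y. if y \<in> A then return_pmf y else cond_pmf \<mu> A)) x =
       measure_pmf.expectation \<mu> (\<lambda>y. indicator A x * indicator {x} y + indicator (-A) y * pmf (cond_pmf \<mu> A) x)"
      unfolding pmf_bind by (intro Bochner_Integration.integral_cong) (auto simp: indicator_def pmf_cond ne)
    also have "\<dots> = indicator A x * pmf \<mu> x + Pr \<mu> (-A) * pmf (cond_pmf \<mu> A) x"
      by (subst Bochner_Integration.integral_add)
         (auto simp: pmf.rep_eq intro!: integrable_mult_right integrable_mult_left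
            measure_pmf.integrable_const_bound[of _ 1])
    also have "Pr \<mu> (-A) = 1 - ?P"
      using measure_pmf.prob_compl[of A \<mu>] by (simp add: Compl_eq_Diff_UNIV)
    also have "indicator A x * pmf \<mu> x + (1 - ?P) * pmf (cond_pmf \<mu> A) x = pmf (cond_pmf \<mu> A) x"
      using P by (auto simp: pmf_cond ne field_simps)
    finally show "pmf (bind_pmf \<mu> (\<lambda>y. if y \<in> A then return_pmf y else cond_pmf \<mu> A)) x = pmf (cond_pmf \<mu> A) x" .
  qed
  finally have "w \<in> couplings (cond_pmf \<mu> A) \<mu>" using snd by (simp add: couplings_def)
  moreover have "Pr \<mu> A \<le> Pr w {(u, v). u \<le> v}"
  proof -
    have "Pr \<mu> A = Pr w {x. snd x \<in> A}"
      by (subst snd[symmetric]) (simp add: vimage_def)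
    also have "\<dots> \<le> Pr w {(u, v). u \<le> v}"
      by (rule measure_pmf.finite_measure_mono_AE) (auto simp: AE_measure_pmf_iff w_def)
    finally show ?thesis .
  qed
  ultimately show ?thesis by (auto simp: coup_def)
qed

lemma coup_weaken: "coup s \<mu> \<nu> \<Longrightarrow> s' \<le> s \<Longrightarrow> coup s' \<mu> \<nu>"
  by (force simp: coup_def)

lemma cond_pmf_pair_pmf:
  assumes "set_pmf \<mu> \<inter> A \<noteq> {}" "set_pmf \<nu> \<inter> B \<noteq> {}"
  shows "cond_pmf (pair_pmf \<mu> \<nu>) (A \<times> B) = pair_pmf (cond_pmf \<mu> A) (cond_pmf \<nu> B)"
proof (rule pmf_eqI)
  have ne: "set_pmf (pair_pmf \<mu> \<nu>) \<inter> (A \<times> B) \<noteq> {}" using assms by auto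
  have m: "Pr (pair_pmf \<mu> \<nu>) (A \<times> B) = Pr \<mu> A * Pr \<nu> B"
  proof -
    have "Pr (pair_pmf \<mu> \<nu>) (A \<times> B) =
        Pr (pair_pmf \<mu> \<nu>) ((A \<inter> set_pmf \<mu>) \<times> (B \<inter> set_pmf \<nu>))"
      using measure_Int_set_pmf[of "pair_pmf \<mu> \<nu>" "A \<times> B"] by (simp add: Times_Int_Times)
    also have "\<dots> = Pr \<mu> (A \<inter> set_pmf \<mu>) * Pr \<nu> (B \<inter> set_pmf \<nu>)"
      by (rule measure_pmf_prob_product) (rule countable_Int2, simp)+
    finally show ?thesis by (simp add: measure_Int_set_pmf)
  qed
  fix x show "pmf (cond_pmf (pair_pmf \<mu> \<nu>) (A \<times> B)) x = pmf (pair_pmf (cond_pmf \<mu> A) (cond_pmf \<nu> B)) x"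
    by (cases x) (auto simp: pmf_cond[OF ne] pmf_cond[OF assms(1)] pmf_cond[OF assms(2)] pmf_pair m)
qed

section \<open>Couplings of integer-valued and Boolean laws\<close>

lemma nat_pmf_eqI:
  fixes \<mu> \<nu> :: "nat pmf"
  assumes "\<And>z. Pr \<mu> {..z} = Pr \<nu> {..z}"
  shows "\<mu> = \<nu>"
proof (rule pmf_eqI)
  fix n
  have eq: "pmf \<rho> n = Pr \<rho> {..n} - (if n = 0 then 0 else Pr \<rho> {..n - 1})"
    for \<rho> :: "nat pmf"
  proof (cases n)
    case (Suc m)
    have "Pr \<rho> ({..m} \<union> {n}) = Pr \<rho> {..m} + Pr \<rho> {n}"
      by (rule measure_pmf.finite_measure_Union) (auto simp: Suc)
    also have "{..m} \<union> {n} = {..n}" by (auto simp: Suc)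
    finally show ?thesis by (simp add: measure_pmf_single Suc)
  qed (simp add: measure_pmf_single)
  show "pmf \<mu> n = pmf \<nu> n" by (simp add: eq assms)
qed

text \<open>Converts the law of a pair built on a continuous probability space into a pmf: on a
  countable type the points without mass form a null set.\<close>

lemma measure_pmf_Abs_countable:
  fixes M :: "'a :: countable measure"
  assumes "prob_space M" "sets M = UNIV"
  shows "measure_pmf (Abs_pmf M) = M"
proof (rule Abs_pmf_inverse)
  interpret prob_space M by fact
  have "AE x in M. \<forall>a\<in>{a. measure M {a} = 0}. x \<noteq> a"
  proof (subst AE_ball_countable)
    show "\<forall>a\<in>{a. measure M {a} = 0}. AE x in M. x \<noteq> a"
    proof
      fix a assume "a \<in> {a. measure M {a} = 0}"
      thus "AE x in M. x \<noteq> a"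
        by (intro AE_I[of _ _ "{a}"]) (auto simp: emeasure_eq_measure assms)
    qed
  qed simp
  hence "AE x in M. measure M {x} \<noteq> 0" by eventually_elim auto
  with assms show "M \<in> {M. prob_space M \<and> sets M = UNIV \<and> (AE x in M. measure M {x} \<noteq> 0)}"
    by simp
qed

text \<open>
  With \<open>U\<close> uniform on \<open>(0, 1)\<close>, take the \<open>\<mu>\<close>-quantile of \<open>U\<close> and the \<open>\<nu>\<close>-quantile of \<open>U + d\<close> mod 1:
  they are ordered as long as \<open>U + d < 1\<close>.
\<close>

lemma coup_nat:
  fixes \<mu> \<nu> :: "nat pmf"
  assumes d: "0 \<le> d" "d \<le> 1" and supp: "set_pmf \<mu> \<subseteq> {..N}" "set_pmf \<nu> \<subseteq> {..N}"
    and le: "\<And>z. Pr \<nu> {..z} \<le> Pr \<mu> {..z} + d"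
  shows "coup (1 - d) \<mu> \<nu>"
proof -
  define F where "F z = Pr \<mu> {..z}" for z
  define G where "G z = Pr \<nu> {..z}" for z
  define \<Omega> where "\<Omega> = restrict_space lborel {0<..<1::real}"
  define s where "s \<omega> = (if \<omega> + d < 1 then \<omega> + d else \<omega> + d - 1)" for \<omega> :: real
  define X where "X \<omega> = (LEAST x. \<omega> \<le> F x)" for \<omega>
  define Y where "Y \<omega> = (LEAST y. s \<omega> \<le> G y)" for \<omega>
  interpret prob_space \<Omega>
    unfolding \<Omega>_def by (rule prob_spaceI) (simp add: space_restrict_space emeasure_restrict_space)
  have FN: "F N = 1" unfolding F_def using supp(1)
    by (subst measure_pmf.prob_eq_1) (auto simp: AE_measure_pmf_iff)
  have GN: "G N = 1" unfolding G_def using supp(2)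
    by (subst measure_pmf.prob_eq_1) (auto simp: AE_measure_pmf_iff)
  have F01: "0 \<le> F z" "F z \<le> 1" and G01: "0 \<le> G z" "G z \<le> 1" for z by (auto simp: F_def G_def)
  have monoF: "F x \<le> F y" if "x \<le> y" for x y
    unfolding F_def using that by (intro measure_pmf.finite_measure_mono) auto
  have monoG: "G x \<le> G y" if "x \<le> y" for x y
    unfolding G_def using that by (intro measure_pmf.finite_measure_mono) auto
  have X_le: "X \<omega> \<le> z \<longleftrightarrow> \<omega> \<le> F z" if "\<omega> \<le> 1" for \<omega> z
  proof
    have "\<omega> \<le> F (X \<omega>)" unfolding X_def by (rule LeastI[of _ N]) (use that FN in simp)
    thus "X \<omega> \<le> z \<Longrightarrow> \<omega> \<le> F z" using monoF by (meson order_trans)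
  next
    assume "\<omega> \<le> F z" thus "X \<omega> \<le> z" unfolding X_def by (rule Least_le)
  qed
  have Y_le: "Y \<omega> \<le> z \<longleftrightarrow> s \<omega> \<le> G z" if "\<omega> \<le> 1" for \<omega> z
  proof
    have "s \<omega> \<le> 1" using that d by (auto simp: s_def)
    hence "s \<omega> \<le> G N" using GN by simp
    hence "s \<omega> \<le> G (Y \<omega>)" unfolding Y_def by (rule LeastI)
    thus "Y \<omega> \<le> z \<Longrightarrow> s \<omega> \<le> G z" using monoG by (meson order_trans)
  next
    assume "s \<omega> \<le> G z" thus "Y \<omega> \<le> z" unfolding Y_def by (rule Least_le)
  qed
  have [measurable]: "id \<in> borel_measurable \<Omega>"
    unfolding \<Omega>_def by (intro measurable_restrict_space1) auto
  have [measurable]: "s \<in> borel_measurable borel" unfolding s_def by measurable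
  have idm: "(\<lambda>x. x) \<in> borel_measurable \<Omega>"
    unfolding \<Omega>_def by (intro measurable_restrict_space1) auto
  have [measurable]: "X \<in> measurable \<Omega> (count_space UNIV)"
    unfolding X_def using idm by measurable
  have sm: "s \<in> borel_measurable \<Omega>" using measurable_compose[OF idm, of s borel] by simp
  have [measurable]: "Y \<in> measurable \<Omega> (count_space UNIV)"
    unfolding Y_def using sm by measurable
  have XY [measurable]: "(\<lambda>\<omega>. (X \<omega>, Y \<omega>)) \<in> measurable \<Omega> (count_space UNIV)"
    using measurable_Pair[of X \<Omega> "count_space UNIV" Y "count_space UNIV"]
    by (simp add: pair_measure_countable)
  define M where "M = distr \<Omega> (count_space UNIV) (\<lambda>\<omega>. (X \<omega>, Y \<omega>))"
  define w where "w = Abs_pmf M"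
  have w: "measure_pmf w = M" unfolding w_def
    by (rule measure_pmf_Abs_countable) (auto simp: M_def intro!: prob_space_distr)
  have space: "space \<Omega> = {0<..<1}" by (simp add: \<Omega>_def space_restrict_space)
  have prob: "Pr w A = measure lborel {\<omega>\<in>{0<..<1}. (X \<omega>, Y \<omega>) \<in> A}" for A
  proof -
    have "Pr w A = measure \<Omega> ((\<lambda>\<omega>. (X \<omega>, Y \<omega>)) -` A \<inter> space \<Omega>)"
      unfolding w M_def by (subst measure_distr) auto
    also have "(\<lambda>\<omega>. (X \<omega>, Y \<omega>)) -` A \<inter> space \<Omega> = {\<omega>\<in>{0<..<1}. (X \<omega>, Y \<omega>) \<in> A}"
      by (auto simp: space)
    also have "measure \<Omega> \<dots> = measure lborel {\<omega>\<in>{0<..<1}. (X \<omega>, Y \<omega>) \<in> A}"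
      unfolding \<Omega>_def by (rule measure_restrict_space) auto
    finally show ?thesis .
  qed
  have "map_pmf fst w = \<mu>"
  proof (rule nat_pmf_eqI)
    fix z
    have "Pr (map_pmf fst w) {..z} = measure lborel {\<omega>\<in>{0<..<1}. X \<omega> \<le> z}"
      by (simp add: prob vimage_def)
    also have "{\<omega>\<in>{0<..<1}. X \<omega> \<le> z} = (if F z = 1 then {0<..<1} else {0<..F z})"
      using F01[of z] by (auto simp: X_le)
    also have "measure lborel \<dots> = F z" using F01[of z] by simp
    finally show "Pr (map_pmf fst w) {..z} = Pr \<mu> {..z}"
      by (simp add: F_def)
  qed
  moreover have "map_pmf snd w = \<nu>"
  proof (rule nat_pmf_eqI)
    fix z
    have "Pr (map_pmf snd w) {..z} = measure lborel {\<omega>\<in>{0<..<1}. s \<omega> \<le> G z}"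
      by (simp add: prob vimage_def Y_le cong: conj_cong)
    also have "\<dots> = G z"
    proof (cases "d \<le> G z")
      case True
      \<comment> \<open>The wrap at \<open>1 - d\<close> splits the preimage into a piece before it
        and a piece after it. Removing \<open>1 - d\<close> matters when \<open>G z = 1\<close>,
        removing \<open>0\<close> when \<open>d = 1\<close>; neither changes the length.\<close>
      have "{\<omega>\<in>{0<..<1}. s \<omega> \<le> G z} = ({0<..G z - d} - {1 - d}) \<union> ({1-d..<1} - {0})"
        using G01[of z] d True by (auto simp: s_def split: if_splits)
      also have "measure lborel \<dots> = measure lborel ({0<..G z - d} - {1 - d}) + measure lborel ({1-d..<1} - {0})"
        using emeasure_bounded_finite[of "{0<..G z - d} - {1 - d}"] emeasure_bounded_finite[of "{1-d..<1} - {0}"]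
          G01[of z] by (intro measure_Union) (auto simp: bounded_diff top.not_eq_extremum)
      also have "measure lborel ({0<..G z - d} - {1 - d}) = G z - d"
        using True by (subst measure_Diff_null_set) auto
      also have "measure lborel ({1-d..<1} - {0}) = d"
        using d by (subst measure_Diff_null_set) auto
      finally show ?thesis by simp
    next
      case False
      have "{\<omega>\<in>{0<..<1}. s \<omega> \<le> G z} = {1-d..G z + 1 - d} - {0}"
        using G01[of z] d False by (auto simp: s_def split: if_splits)
      also have "measure lborel \<dots> = G z"
        using G01[of z] by (subst measure_Diff_null_set) auto
      finally show ?thesis .
    qed
    finally show "Pr (map_pmf snd w) {..z} = Pr \<nu> {..z}"
      by (simp add: G_def)
  qed
  moreover have "1 - d \<le> Pr w {(u, v). u \<le> v}"
  proof -
    have "X \<omega> \<le> Y \<omega>" if "\<omega> \<in> {0<..<1 - d}" for \<omega>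
    proof -
      have 1: "\<omega> \<le> 1" using that d by auto
      have "s \<omega> \<le> G (Y \<omega>)" using Y_le[OF 1, of "Y \<omega>"] by simp
      moreover have "s \<omega> = \<omega> + d" using that by (simp add: s_def)
      moreover have "G (Y \<omega>) \<le> F (Y \<omega>) + d" using le by (simp add: F_def G_def)
      ultimately show ?thesis by (simp add: X_le[OF 1])
    qed
    hence "{0<..<1 - d} \<subseteq> {\<omega>\<in>{0<..<1}. (X \<omega>, Y \<omega>) \<in> {(u, v). u \<le> v}}" using d by auto
    hence "measure \<Omega> {0<..<1 - d} \<le> measure \<Omega> {\<omega>\<in>space \<Omega>. X \<omega> \<le> Y \<omega>}"
    proof (intro finite_measure_mono)
      have "{\<omega>\<in>space \<Omega>. X \<omega> \<le> Y \<omega>} = (\<lambda>\<omega>. (X \<omega>, Y \<omega>)) -` {(u, v). u \<le> v} \<inter> space \<Omega>" by auto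
      also have "\<dots> \<in> events" by (rule measurable_sets[OF XY]) simp
      finally show "{\<omega>\<in>space \<Omega>. X \<omega> \<le> Y \<omega>} \<in> events" .
    qed (auto simp: space)
    also have "\<dots> = Pr w {(u, v). u \<le> v}"
      unfolding prob space \<Omega>_def by (subst measure_restrict_space) auto
    also have "measure \<Omega> {0<..<1 - d} = 1 - d"
      using d unfolding \<Omega>_def by (subst measure_restrict_space) auto
    finally show ?thesis .
  qed
  ultimately show ?thesis by (auto simp: coup_def couplings_def)
qed

lemma rel_pmf_if_coup_1:
  assumes "coup 1 \<mu> \<nu>" shows "rel_pmf (\<le>) \<mu> \<nu>"
proof -
  obtain w where w: "w \<in> couplings \<mu> \<nu>" "1 \<le> Pr w {(u, v). u \<le> v}"
    using assms by (auto simp: coup_def)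
  hence "Pr w {(u, v). u \<le> v} = 1" by (intro antisym) auto
  hence "\<forall>x\<in>set_pmf w. x \<in> {(u, v). u \<le> v}"
    by (subst (asm) measure_pmf.prob_eq_1) (auto simp: AE_measure_pmf_iff)
  with w(1) show ?thesis
    by (intro rel_pmf.intros[of w]) (auto simp: couplings_def)
qed

lemma rel_pmf_nat:
  fixes \<mu> \<nu> :: "nat pmf"
  assumes "set_pmf \<mu> \<subseteq> {..N}" "set_pmf \<nu> \<subseteq> {..N}"
    and "\<And>z. Pr \<nu> {..z} \<le> Pr \<mu> {..z}"
  shows "rel_pmf (\<le>) \<mu> \<nu>"
  using coup_nat[of 0 \<mu> N \<nu>] assms by (intro rel_pmf_if_coup_1) simp

lemma rel_pmf_bool:
  assumes "pmf \<mu> True \<le> pmf \<nu> True" shows "rel_pmf (\<le>) \<mu> \<nu>"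
proof -
  have eq: "Pr (map_pmf of_bool \<rho>) {..z} = (if z = 0 then 1 - pmf \<rho> True else 1)"
    for \<rho> and z :: nat
  proof (cases "z = 0")
    case True
    have "Pr \<rho> {x. \<not> x} = 1 - Pr \<rho> {True}"
      by (subst measure_pmf.prob_compl[symmetric]) (auto intro!: arg_cong[where f="Pr \<rho>"])
    moreover have "Pr (map_pmf of_bool \<rho>) {..z} = Pr \<rho> {x. \<not> x}"
      using True unfolding measure_map_pmf by (intro arg_cong[where f="Pr \<rho>"]) auto
    ultimately show ?thesis using True by (simp add: measure_pmf_single)
  next
    case False
    hence "of_bool -` {..z} = (UNIV :: bool set)" by (auto simp: of_bool_def)
    thus ?thesis using False by simp
  qed
  have "rel_pmf (\<le>) (map_pmf of_bool \<mu> :: nat pmf) (map_pmf of_bool \<nu>)"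
  proof (rule rel_pmf_nat[of _ 1])
    show "Pr (map_pmf of_bool \<nu>) {..z} \<le> Pr (map_pmf of_bool \<mu>) {..z}" for z :: nat
      unfolding eq using assms by simp
  qed auto
  thus ?thesis
    unfolding pmf.rel_map by (rule pmf.rel_mono_strong) (auto split: if_splits)
qed

text \<open>Summing \<open>lr\<close> over \<open>x \<le> z < y\<close> gives B (1 - A) \<le> A (1 -
  B) for the two distribution functions at \<open>z\<close>, and the products cancel. The
  cross-multiplied form of the ratio order allows different supports.\<close>

lemma rel_pmf_nat_likelihood_ratio:
  fixes \<mu> \<nu> :: "nat pmf"
  assumes supp: "set_pmf \<mu> \<subseteq> {..N}" "set_pmf \<nu> \<subseteq> {..N}"
    and lr: "\<And>x y. x \<le> y \<Longrightarrow> pmf \<mu> y * pmf \<nu> x \<le> pmf \<mu> x * pmf \<nu> y"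
  shows "rel_pmf (\<le>) \<mu> \<nu>"
proof (rule rel_pmf_nat[OF supp])
  fix z
  let ?A = "Pr \<mu> {..z}" and ?B = "Pr \<nu> {..z}"
  have compl: "1 - Pr \<rho> {..z} = (\<Sum>y\<in>{z<..N}. pmf \<rho> y)" if "set_pmf \<rho> \<subseteq> {..N}" for \<rho>
  proof -
    have "1 - Pr \<rho> {..z} = Pr \<rho> (UNIV - {..z})"
      by (subst measure_pmf.prob_compl[symmetric]) auto
    also have "\<dots> = Pr \<rho> {z<..N}"
      by (rule measure_prob_cong_0) (use that in \<open>auto simp: set_pmf_iff\<close>)
    also have "\<dots> = (\<Sum>y\<in>{z<..N}. pmf \<rho> y)" by (rule measure_measure_pmf_finite) simp
    finally show ?thesis .
  qed
  have "?B * (1 - ?A) = (\<Sum>x\<le>z. \<Sum>y\<in>{z<..N}. pmf \<nu> x * pmf \<mu> y)"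
    unfolding compl[OF supp(1)] by (simp add: measure_measure_pmf_finite sum_product)
  also have "\<dots> \<le> (\<Sum>x\<le>z. \<Sum>y\<in>{z<..N}. pmf \<mu> x * pmf \<nu> y)"
    using lr by (intro sum_mono) (simp add: mult.commute)
  also have "\<dots> = ?A * (1 - ?B)"
    unfolding compl[OF supp(2)] by (simp add: measure_measure_pmf_finite sum_product)
  finally show "?B \<le> ?A" by (simp add: algebra_simps)
qed

lemma rel_pmf_bindI_supp:
  assumes "rel_pmf R p q"
    and "\<And>x y. x \<in> set_pmf p \<Longrightarrow> y \<in> set_pmf q \<Longrightarrow> R x y \<Longrightarrow> rel_pmf P (f x) (g y)"
  shows "rel_pmf P (bind_pmf p f) (bind_pmf q g)"
proof (rule rel_pmf_bindI)
  show "rel_pmf (\<lambda>x y. x \<in> set_pmf p \<and> y \<in> set_pmf q \<and> R x y) p q"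
    using assms(1) by (rule pmf.rel_mono_strong) auto
qed (use assms(2) in auto)

section \<open>Bernoulli vectors and their totals\<close>

text \<open>The index set is arbitrary and the probabilities are attached to indices, so that
  vectors can be restricted to unions of blocks and inductions can remove one index.\<close>

definition bvec :: "'a set \<Rightarrow> ('a \<Rightarrow> real) \<Rightarrow> ('a \<Rightarrow> bool) pmf" where
  "bvec J r = Pi_pmf J False (\<lambda>j. bernoulli_pmf (r j))"

definition tot :: "'a set \<Rightarrow> ('a \<Rightarrow> bool) \<Rightarrow> nat" where
  "tot J x = card {j \<in> J. x j}"

definition unit_probs :: "'a set \<Rightarrow> ('a \<Rightarrow> real) \<Rightarrow> bool" where
  "unit_probs J r \<longleftrightarrow> finite J \<and> (\<forall>j\<in>J. 0 < r j \<and> r j < 1)"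

lemma unit_probs_finite: "unit_probs J r \<Longrightarrow> finite J"
  by (simp add: unit_probs_def)

lemma unit_probs_subset: "unit_probs J r \<Longrightarrow> I \<subseteq> J \<Longrightarrow> unit_probs I r"
  by (auto simp: unit_probs_def dest: finite_subset)

lemma tot_le_card: "finite J \<Longrightarrow> tot J x \<le> card J"
  unfolding tot_def by (rule card_mono) auto

lemma tot_eq_sum: "finite J \<Longrightarrow> tot J x = (\<Sum>j\<in>J. of_bool (x j))"
  by (simp add: tot_def sum.If_cases Int_def of_bool_def)

lemma tot_mono: "finite J \<Longrightarrow> mono (tot J)"
  by (auto intro!: monoI card_mono simp: tot_def le_fun_def)

lemma tot_insert_upd:
  assumes "finite J" "j \<notin> J"
  shows "tot (insert j J) (x(j := b)) = tot J x + of_bool b"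
proof -
  have "(\<Sum>i\<in>J. of_bool ((x(j := b)) i)) = (\<Sum>i\<in>J. of_bool (x i) :: nat)"
    using assms by (intro sum.cong) auto
  thus ?thesis using assms by (simp add: tot_eq_sum del: fun_upd_apply sum_of_bool_eq) simp
qed

lemma set_pmf_bvec:
  assumes "unit_probs J r" shows "set_pmf (bvec J r) = {x. \<forall>j. j \<notin> J \<longrightarrow> \<not> x j}"
proof -
  have "set_pmf (bernoulli_pmf (r j)) = UNIV" if "j \<in> J" for j
    using assms that by (intro set_pmf_bernoulli) (auto simp: unit_probs_def)
  thus ?thesis using assms
    by (auto simp: bvec_def unit_probs_def set_Pi_pmf PiE_dflt_def)
qed

lemma ex_bvec_tot:
  assumes "unit_probs J r" "u \<le> card J"
  shows "\<exists>x\<in>set_pmf (bvec J r). tot J x = u"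
proof -
  obtain A where "A \<subseteq> J" "card A = u" using assms(2) by (meson obtain_subset_with_card_n)
  hence "(\<lambda>j. j \<in> A) \<in> set_pmf (bvec J r)" "tot J (\<lambda>j. j \<in> A) = u"
    using assms(1) by (auto simp: set_pmf_bvec tot_def intro!: arg_cong[where f=card])
  thus ?thesis by blast
qed

text \<open>The mass function of the Poisson binomial law, as a plain weight sequence.\<close>

definition sumw :: "'a set \<Rightarrow> ('a \<Rightarrow> real) \<Rightarrow> nat \<Rightarrow> real" where
  "sumw J r u = pmf (map_pmf (tot J) (bvec J r)) u"

lemma sumw_nonneg: "0 \<le> sumw J r u" by (simp add: sumw_def)

lemma sumw_pos: "unit_probs J r \<Longrightarrow> u \<le> card J \<Longrightarrow> 0 < sumw J r u"
  using ex_bvec_tot[of J r u] by (auto simp: sumw_def pmf_positive_iff)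

lemma sumw_eq_0:
  assumes "finite J" "card J < u" shows "sumw J r u = 0"
proof -
  have "tot J x \<noteq> u" for x using tot_le_card[OF assms(1), of x] assms(2) by simp
  thus ?thesis by (auto simp: sumw_def pmf_eq_0_set_pmf)
qed

lemma sumw_conv_prob: "sumw J r u = Pr (bvec J r) {x. tot J x = u}"
  by (simp add: sumw_def pmf_map vimage_def)

lemma bvec_insert:
  "finite J \<Longrightarrow> j \<notin> J \<Longrightarrow>
     bvec (insert j J) r = map_pmf (\<lambda>(b, f). f(j := b)) (pair_pmf (bernoulli_pmf (r j)) (bvec J r))"
  unfolding bvec_def by (rule Pi_pmf_insert)

lemma prob_bvec_insert:
  assumes "unit_probs (insert j J) r" "j \<notin> J"
  shows "Pr (bvec (insert j J) r) {x. x j = b \<and> tot (insert j J) x = u} =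
         (if b then r j else 1 - r j) * Pr (bvec J r) {x. tot J x + of_bool b = u}"
proof -
  have fin: "finite J" using unit_probs_finite[OF assms(1)] by simp
  have r: "0 \<le> r j" "r j \<le> 1" using assms(1) by (auto simp: unit_probs_def)
  have J: "unit_probs J r" using unit_probs_subset[OF assms(1)] by auto
  let ?B = "{x. tot J x + of_bool b = u} \<inter> set_pmf (bvec J r)"
  have "Pr (bvec (insert j J) r) {x. x j = b \<and> tot (insert j J) x = u} =
     Pr (pair_pmf (bernoulli_pmf (r j)) (bvec J r)) ({b} \<times> {x. tot J x + of_bool b = u})"
    unfolding bvec_insert[OF fin assms(2)] measure_map_pmf
    by (rule arg_cong[where f="Pr _"]) (auto simp: tot_insert_upd[OF fin assms(2)])
  also have "\<dots> = Pr (pair_pmf (bernoulli_pmf (r j)) (bvec J r)) ({b} \<times> ?B)"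
    by (rule measure_prob_cong_0) (auto simp: pmf_pair set_pmf_iff)
  also have "\<dots> = Pr (bernoulli_pmf (r j)) {b} * Pr (bvec J r) ?B"
    by (rule measure_pmf_prob_product) auto
  also have "Pr (bernoulli_pmf (r j)) {b} = (if b then r j else 1 - r j)"
    using r by (simp add: measure_pmf_single)
  finally show ?thesis by (simp add: measure_Int_set_pmf)
qed

lemma sumw_insert:
  assumes "unit_probs (insert j J) r" "j \<notin> J"
  shows "sumw (insert j J) r 0 = (1 - r j) * sumw J r 0"
    and "sumw (insert j J) r (Suc u) = (1 - r j) * sumw J r (Suc u) + r j * sumw J r u"
proof -
  have split: "sumw (insert j J) r u =
     Pr (bvec (insert j J) r) {x. x j = False \<and> tot (insert j J) x = u} +
     Pr (bvec (insert j J) r) {x. x j = True \<and> tot (insert j J) x = u}" for u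
    unfolding sumw_conv_prob
    by (subst measure_pmf.finite_measure_Union[symmetric]) (auto intro!: arg_cong[where f="Pr _"])
  show "sumw (insert j J) r 0 = (1 - r j) * sumw J r 0"
    unfolding split prob_bvec_insert[OF assms] by (simp add: sumw_conv_prob)
  show "sumw (insert j J) r (Suc u) = (1 - r j) * sumw J r (Suc u) + r j * sumw J r u"
    unfolding split prob_bvec_insert[OF assms] by (simp add: sumw_conv_prob)
qed

text \<open>Adding an index with probability \<open>p\<close> turns the weights f(u) into (1 - p)
  f(u) + p f(u - 1). The difference of the two products then expands into a nonnegative combination
  of differences of the same kind for f; the mixed one, \<open>cross\<close>, chains two instances
  of the induction hypothesis. The form with two indices says that successive ratios decrease and
  stays meaningful where weights vanish.\<close>

lemma sumw_log_concave:
  assumes "unit_probs J r" "a \<le> b"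
  shows "sumw J r a * sumw J r (Suc b) \<le> sumw J r (Suc a) * sumw J r b"
  using unit_probs_finite[OF assms(1)] assms
proof (induction J arbitrary: a b rule: finite_induct)
  case empty
  thus ?case by (simp add: sumw_eq_0)
next
  case (insert j J)
  have J: "unit_probs J r" using unit_probs_subset[OF insert.prems(1)] by auto
  note IH = insert.IH[OF J]
  define f where "f = sumw J r"
  define p where "p = r j"
  have p: "0 \<le> p" "0 \<le> 1 - p" using insert.prems(1) by (auto simp: p_def unit_probs_def)
  have f0: "0 \<le> f u" for u by (simp add: f_def sumw_nonneg)
  have lc: "f a * f (Suc b) \<le> f (Suc a) * f b" if "a \<le> b" for a b using IH[OF that] by (simp add: f_def)
  note rec = sumw_insert[OF insert.prems(1) insert.hyps(2), folded f_def p_def]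
  show ?case
  proof (cases a)
    case 0
    show ?thesis
    proof (cases b)
      case (Suc c)
      have "0 \<le> (1 - p) * (1 - p) * (f 1 * f (Suc c) - f 0 * f (Suc (Suc c))) + (1 - p) * p * (f 1 * f c)"
        using lc[of 0 "Suc c"] p f0 by (intro add_nonneg_nonneg mult_nonneg_nonneg) auto
      also have "\<dots> \<le> ((1 - p) * f 1 + p * f 0) * ((1 - p) * f (Suc c) + p * f c)
          - (1 - p) * f 0 * ((1 - p) * f (Suc (Suc c)) + p * f (Suc c))"
        using mult_nonneg_nonneg[OF mult_nonneg_nonneg[OF p(1) p(1)] mult_nonneg_nonneg[OF f0[of 0] f0[of c]]]
        by (simp add: algebra_simps)
      finally show ?thesis by (simp add: 0 Suc rec)
    qed (simp add: 0 rec mult.commute)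
  next
    case (Suc a')
    with insert.prems(2) obtain b' where b: "b = Suc b'" "a' \<le> b'" by (cases b) auto
    have cross: "f a' * f (Suc (Suc b')) \<le> f (Suc (Suc a')) * f b'"
    proof (cases "a' = b'")
      case False
      have "f a' * f (Suc (Suc b')) \<le> f (Suc a') * f (Suc b')" using b by (intro lc) auto
      also have "\<dots> \<le> f (Suc (Suc a')) * f b'" using b False by (intro lc) auto
      finally show ?thesis .
    qed simp
    have "0 \<le> (1 - p) * (1 - p) * (f (Suc (Suc a')) * f (Suc b') - f (Suc a') * f (Suc (Suc b')))
        + p * p * (f (Suc a') * f b' - f a' * f (Suc b'))
        + (1 - p) * p * (f (Suc (Suc a')) * f b' - f a' * f (Suc (Suc b')))"
      using lc[of "Suc a'" "Suc b'"] lc[of a' b'] cross p b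
      by (intro add_nonneg_nonneg mult_nonneg_nonneg) auto
    also have "\<dots> = ((1 - p) * f (Suc (Suc a')) + p * f (Suc a')) * ((1 - p) * f (Suc b') + p * f b')
        - ((1 - p) * f (Suc a') + p * f a') * ((1 - p) * f (Suc (Suc b')) + p * f (Suc b'))"
      by (simp add: algebra_simps)
    finally show ?thesis by (simp add: Suc b rec)
  qed
qed

section \<open>The conditional law given the total\<close>

definition level :: "'a set \<Rightarrow> ('a \<Rightarrow> real) \<Rightarrow> nat \<Rightarrow> ('a \<Rightarrow> bool) pmf" where
  "level J r u = cond_pmf (bvec J r) {x. tot J x = u}"

lemma level_nonempty:
  "unit_probs J r \<Longrightarrow> u \<le> card J \<Longrightarrow> set_pmf (bvec J r) \<inter> {x. tot J x = u} \<noteq> {}"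
  using ex_bvec_tot[of J r u] by blast

lemma cond_cond_pmf:
  assumes A: "set_pmf \<mu> \<inter> A \<noteq> {}" and AB: "set_pmf \<mu> \<inter> (A \<inter> B) \<noteq> {}"
  shows "cond_pmf (cond_pmf \<mu> A) B = cond_pmf \<mu> (A \<inter> B)"
proof (rule pmf_eqI)
  fix x
  have ne: "set_pmf (cond_pmf \<mu> A) \<inter> B \<noteq> {}" using AB by (auto simp: set_cond_pmf[OF A])
  have "0 < Pr \<mu> A" "0 < Pr \<mu> (A \<inter> B)"
    by (rule pmf_cond_pos[OF A], rule pmf_cond_pos[OF AB])
  thus "pmf (cond_pmf (cond_pmf \<mu> A) B) x = pmf (cond_pmf \<mu> (A \<inter> B)) x"
    by (simp add: pmf_cond[OF ne] pmf_cond[OF A] pmf_cond[OF AB] prob_cond_pmf[OF A])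
qed

text \<open>Once coordinate \<open>j\<close> is revealed, the event of total \<open>u\<close> is a
  rectangle in the product of that coordinate and the rest, so the conditioning factorises.\<close>

lemma level_insert:
  assumes J: "unit_probs (insert j J) r" "j \<notin> J" and u: "u \<le> card (insert j J)"
  shows "level (insert j J) r u =
     bind_pmf (map_pmf (\<lambda>x. x j) (level (insert j J) r u))
       (\<lambda>b. map_pmf (\<lambda>f. f(j := b)) (level J r (u - of_bool b)))"
proof -
  let ?B = "bvec (insert j J) r"
  have fin: "finite J" using unit_probs_finite[OF J(1)] by simp
  have J': "unit_probs J r" using unit_probs_subset[OF J(1)] by auto
  note ne = level_nonempty[OF J(1) u]
  have "level (insert j J) r u = bind_pmf (map_pmf (\<lambda>x. x j) (level (insert j J) r u))
      (\<lambda>b. cond_pmf (level (insert j J) r u) {x. x j = b})"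
    by (rule bind_cond_pmf_disintegrate)
  also have "\<dots> = bind_pmf (map_pmf (\<lambda>x. x j) (level (insert j J) r u))
       (\<lambda>b. map_pmf (\<lambda>f. f(j := b)) (level J r (u - of_bool b)))"
  proof (rule bind_pmf_cong[OF refl])
    fix b assume "b \<in> set_pmf (map_pmf (\<lambda>x. x j) (level (insert j J) r u))"
    then obtain x where x: "x \<in> set_pmf ?B" "tot (insert j J) x = u" "x j = b"
      using ne by (auto simp: level_def)
    let ?P = "pair_pmf (bernoulli_pmf (r j)) (bvec J r)"
    let ?h = "\<lambda>(b, f). f(j := b) :: 'a \<Rightarrow> bool"
    let ?S = "{x. tot (insert j J) x = u} \<inter> {x. x j = b}"
    have B: "?B = map_pmf ?h ?P" by (rule bvec_insert[OF fin J(2)])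
    have vim: "?h -` ?S = {b} \<times> {f. tot J f + of_bool b = u}"
      by (auto simp: tot_insert_upd[OF fin J(2)])
    have "\<exists>y\<in>set_pmf ?P. ?h y \<in> ?S" using x B by auto
    hence neP: "set_pmf ?P \<inter> ?h -` ?S \<noteq> {}" by blast
    hence ne2: "set_pmf (bernoulli_pmf (r j)) \<inter> {b} \<noteq> {}" "set_pmf (bvec J r) \<inter> {f. tot J f + of_bool b = u} \<noteq> {}"
      unfolding vim by auto
    have "of_bool b \<le> u" using ne2(2) by auto
    hence eqS: "{f. tot J f + of_bool b = u} = {f. tot J f = u - of_bool b}" by auto
    have "cond_pmf (level (insert j J) r u) {x. x j = b} = cond_pmf ?B ?S"
      unfolding level_def by (rule cond_cond_pmf[OF ne]) (use x in blast)
    also have "\<dots> = map_pmf ?h (cond_pmf ?P (?h -` ?S))"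
      unfolding B by (rule cond_map_pmf[OF neP])
    also have "cond_pmf ?P (?h -` ?S) = pair_pmf (cond_pmf (bernoulli_pmf (r j)) {b}) (level J r (u - of_bool b))"
      using cond_pmf_pair_pmf[OF ne2] unfolding vim level_def eqS .
    also have "cond_pmf (bernoulli_pmf (r j)) {b} = return_pmf b"
      using set_cond_pmf[OF ne2(1)] ne2(1) by (intro set_pmf_subset_singleton[THEN iffD1]) auto
    finally show "cond_pmf (level (insert j J) r u) {x. x j = b} =
        map_pmf (\<lambda>f. f(j := b)) (level J r (u - of_bool b))"
      by (cases b) (simp_all add: pair_return_pmf1 pmf.map_comp o_def fun_upd_def)
  qed
  finally show ?thesis .
qed

lemma pmf_level_insert_True:
  assumes J: "unit_probs (insert j J) r" "j \<notin> J" and u: "u \<le> card (insert j J)"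
  shows "pmf (map_pmf (\<lambda>x. x j) (level (insert j J) r u)) True =
    (if u = 0 then 0 else r j * sumw J r (u - 1) / sumw (insert j J) r u)"
proof -
  have "pmf (map_pmf (\<lambda>x. x j) (level (insert j J) r u)) True =
      Pr (level (insert j J) r u) {x. x j}"
    by (simp add: pmf_map vimage_def)
  also have "\<dots> = Pr (bvec (insert j J) r) {x. x j = True \<and> tot (insert j J) x = u} /
      sumw (insert j J) r u"
    unfolding level_def prob_cond_pmf[OF level_nonempty[OF J(1) u]] sumw_conv_prob
    by (auto intro!: arg_cong2[where f="(/)"] arg_cong[where f="Pr _"])
  also have "\<dots> = (if u = 0 then 0 else r j * sumw J r (u - 1) / sumw (insert j J) r u)"
    unfolding prob_bvec_insert[OF J] by (cases u) (auto simp: sumw_conv_prob)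
  finally show ?thesis .
qed

text \<open>Coordinate \<open>j\<close> is stochastically larger under the larger total, by
  log-concavity. Given ordered values \<open>b \<le> c\<close> of it, the totals left for
  \<open>J\<close> are still ordered: when \<open>b\<close> is \<open>False\<close> and
  \<open>c\<close> is \<open>True\<close>, the strict inequality \<open>u < v\<close> pays for the
  difference. The induction hypothesis then couples the rest.\<close>

lemma rel_pmf_level:
  assumes "unit_probs J r" "u \<le> v" "v \<le> card J"
  shows "rel_pmf (\<le>) (level J r u) (level J r v)"
  using unit_probs_finite[OF assms(1)] assms
proof (induction J arbitrary: u v rule: finite_induct)
  case empty
  thus ?case by (auto intro: rel_pmf_reflI)
next
  case (insert j J)
  show ?case
  proof (cases "u = v")
    case True
    thus ?thesis by (auto intro: rel_pmf_reflI)
  next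
    case False
    hence uv: "u < v" "u \<le> card (insert j J)" using insert.prems by auto
    have J: "unit_probs J r" using unit_probs_subset[OF insert.prems(1)] by auto
    note ins = insert.prems(1) insert.hyps(2)
    let ?m = "\<lambda>u. map_pmf (\<lambda>x. x j) (level (insert j J) r u)"
    have cardJ: "card (insert j J) = Suc (card J)" using insert.hyps by simp
    have 1: "rel_pmf (\<le>) (?m u) (?m v)"
    proof (rule rel_pmf_bool)
      obtain w where w: "v = Suc w" using uv(1) by (cases v) auto
      show "pmf (?m u) True \<le> pmf (?m v) True"
      proof (cases u)
        case 0
        thus ?thesis unfolding pmf_level_insert_True[OF ins uv(2)] by simp
      next
        case (Suc a)
        have "sumw J r a * sumw J r (Suc w) \<le> sumw J r (Suc a) * sumw J r w"
          using uv by (intro sumw_log_concave[OF J]) (simp add: Suc w)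
        moreover have "0 \<le> r j" "0 \<le> 1 - r j" using insert.prems(1) by (auto simp: unit_probs_def)
        \<comment> \<open>Cross-multiplying the two probabilities of success at \<open>j\<close>
          leaves exactly this inequality, since the terms with the square of \<open>r j\<close>
          agree on both sides.\<close>
        ultimately have *: "r j * (1 - r j) * (sumw J r a * sumw J r (Suc w)) \<le>
            r j * (1 - r j) * (sumw J r (Suc a) * sumw J r w)"
          by (intro mult_left_mono) auto
        have pos: "0 < sumw (insert j J) r (Suc a)" "0 < sumw (insert j J) r (Suc w)"
          using insert.prems uv by (auto intro!: sumw_pos simp: Suc w)
        show ?thesis
          unfolding pmf_level_insert_True[OF ins uv(2)] pmf_level_insert_True[OF ins insert.prems(3)]
          using pos * by (simp add: Suc w divide_le_eq le_divide_eq pos_divide_le_eq pos_le_divide_eq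
            sumw_insert[OF ins] field_simps)
      qed
    qed
    have 2: "rel_pmf (\<le>) (map_pmf (\<lambda>f. f(j := b)) (level J r (u - of_bool b)))
        (map_pmf (\<lambda>f. f(j := c)) (level J r (v - of_bool c)))"
      if bc: "b \<in> set_pmf (?m u)" "c \<in> set_pmf (?m v)" "b \<le> c" for b c
    proof -
      have "\<exists>x. tot (insert j J) x = v \<and> x j = c \<and> x \<in> set_pmf (bvec (insert j J) r)"
        using bc(2) level_nonempty[OF insert.prems(1,3)] by (auto simp: level_def)
      then obtain x where x: "tot (insert j J) x = v" "x j = c" by blast
      have "tot (insert j J) (x(j := c)) = tot J x + of_bool c"
        by (rule tot_insert_upd) (use insert.hyps in auto)
      hence "v = tot J x + of_bool c" using x by (simp add: fun_upd_idem)
      hence v: "v - of_bool c \<le> card J" using tot_le_card[OF insert.hyps(1), of x] by simp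
      have "u - of_bool b \<le> v - of_bool c" using uv bc(3) by (auto simp: of_bool_def)
      hence "rel_pmf (\<le>) (level J r (u - of_bool b)) (level J r (v - of_bool c))"
        using insert.IH[OF J _ v] by blast
      thus ?thesis
        unfolding pmf.rel_map by (rule pmf.rel_mono_strong) (use bc(3) in \<open>auto simp: le_fun_def\<close>)
    qed
    show ?thesis
      by (subst level_insert[OF ins uv(2)], subst level_insert[OF ins insert.prems(3)])
         (rule rel_pmf_bindI_supp[OF 1 2])
  qed
qed

text \<open>
  Reweighting a Bernoulli vector by a function of its total leaves the conditional law given the
  total unchanged, so only the totals have to be compared.
\<close>

lemma bind_level:
  assumes J: "unit_probs J r"
    and \<mu>: "\<And>x. pmf \<mu> x = f (tot J x) * pmf (bvec J r) x"
  shows "\<mu> = bind_pmf (map_pmf (tot J) \<mu>) (level J r)"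
proof -
  have "\<mu> = bind_pmf (map_pmf (tot J) \<mu>) (\<lambda>u. cond_pmf \<mu> {x. tot J x = u})"
    by (rule bind_cond_pmf_disintegrate)
  also have "\<dots> = bind_pmf (map_pmf (tot J) \<mu>) (level J r)"
  proof (rule bind_pmf_cong[OF refl])
    fix u assume "u \<in> set_pmf (map_pmf (tot J) \<mu>)"
    then obtain x where x: "x \<in> set_pmf \<mu>" "tot J x = u" by auto
    hence "x \<in> set_pmf (bvec J r)" by (auto simp: set_pmf_iff \<mu>)
    with x show "cond_pmf \<mu> {x. tot J x = u} = level J r u"
      unfolding level_def by (intro cond_pmf_eqI[where c="f u"]) (auto simp: \<mu>)
  qed
  finally show ?thesis .
qed

lemma pmf_map_tot_reweight:
  assumes J: "unit_probs J r"
    and \<mu>: "\<And>x. pmf \<mu> x = f (tot J x) * pmf (bvec J r) x"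
  shows "pmf (map_pmf (tot J) \<mu>) u = f u * sumw J r u"
proof -
  have "pmf (map_pmf (tot J) \<mu>) u = infsetsum (pmf \<mu>) {x. tot J x = u}"
    by (simp add: pmf_map vimage_def measure_pmf_conv_infsetsum)
  also have "\<dots> = infsetsum (\<lambda>x. f u * pmf (bvec J r) x) {x. tot J x = u}"
    by (rule infsetsum_cong) (auto simp: \<mu>)
  also have "\<dots> = f u * infsetsum (pmf (bvec J r)) {x. tot J x = u}"
    by (rule infsetsum_cmult_right) (auto simp: pmf_abs_summable)
  finally show ?thesis by (simp add: sumw_conv_prob measure_pmf_conv_infsetsum)
qed

text \<open>The weight \<open>sumw\<close> is common to both totals and drops out of their
  likelihood ratio, so only \<open>f\<close> and \<open>g\<close> have to be compared.
  Cross-multiplication admits weights with zeros, such as those carrying the indicators of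
  \<open>at_least\<close> and \<open>at_most\<close>.\<close>

lemma rel_pmf_reweight:
  assumes J: "unit_probs J r"
    and \<mu>: "\<And>x. pmf \<mu> x = f (tot J x) * pmf (bvec J r) x"
    and \<nu>: "\<And>x. pmf \<nu> x = g (tot J x) * pmf (bvec J r) x"
    and fg: "\<And>a b. a \<le> b \<Longrightarrow> b \<le> card J \<Longrightarrow> f b * g a \<le> f a * g b"
  shows "rel_pmf (\<le>) \<mu> \<nu>"
proof -
  note fin = unit_probs_finite[OF J]
  have "rel_pmf (\<le>) (map_pmf (tot J) \<mu>) (map_pmf (tot J) \<nu>)"
  proof (rule rel_pmf_nat_likelihood_ratio[of _ "card J"])
    fix x y :: nat assume xy: "x \<le> y"
    show "pmf (map_pmf (tot J) \<mu>) y * pmf (map_pmf (tot J) \<nu>) x \<le>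
        pmf (map_pmf (tot J) \<mu>) x * pmf (map_pmf (tot J) \<nu>) y"
    proof (cases "y \<le> card J")
      case True
      have "(sumw J r x * sumw J r y) * (f y * g x) \<le> (sumw J r x * sumw J r y) * (f x * g y)"
        by (rule mult_left_mono[OF fg[OF xy True]]) (simp add: sumw_nonneg)
      thus ?thesis
        unfolding pmf_map_tot_reweight[OF J \<mu>] pmf_map_tot_reweight[OF J \<nu>]
        by (simp add: algebra_simps)
    next
      case False
      thus ?thesis
        unfolding pmf_map_tot_reweight[OF J \<mu>] pmf_map_tot_reweight[OF J \<nu>]
        by (simp add: sumw_eq_0[OF fin])
    qed
  qed (use tot_le_card[OF fin] in auto)
  hence "rel_pmf (\<le>) (bind_pmf (map_pmf (tot J) \<mu>) (level J r)) (bind_pmf (map_pmf (tot J) \<nu>) (level J r))"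
    by (rule rel_pmf_bindI_supp) (use tot_le_card[OF fin] in \<open>auto intro!: rel_pmf_level[OF J]\<close>)
  thus ?thesis using bind_level[OF J \<mu>] bind_level[OF J \<nu>] by metis
qed

section \<open>Exponential tilting\<close>

definition tilt :: "real \<Rightarrow> real \<Rightarrow> real" where
  "tilt t r = t * r / (1 - r + t * r)"

definition at_least :: "'a set \<Rightarrow> nat \<Rightarrow> ('a \<Rightarrow> bool) set" where
  "at_least J k = {x. k \<le> tot J x}"

definition at_most :: "'a set \<Rightarrow> nat \<Rightarrow> ('a \<Rightarrow> bool) set" where
  "at_most J k = {x. tot J x \<le> k}"

lemma tilt_denom_pos: "0 < t \<Longrightarrow> 0 < r \<Longrightarrow> r < 1 \<Longrightarrow> 0 < 1 - r + t * (r::real)"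
  by (simp add: add_pos_pos)

lemma tilt_pos: "0 < t \<Longrightarrow> 0 < r \<Longrightarrow> r < 1 \<Longrightarrow> 0 < tilt t r"
  unfolding tilt_def using tilt_denom_pos[of t r] by simp

lemma tilt_less_1: "0 < t \<Longrightarrow> 0 < r \<Longrightarrow> r < 1 \<Longrightarrow> tilt t r < 1"
  unfolding tilt_def using tilt_denom_pos[of t r] by simp

lemma one_minus_tilt:
  "0 < t \<Longrightarrow> 0 < r \<Longrightarrow> r < 1 \<Longrightarrow> 1 - tilt t r = (1 - r) / (1 - r + t * r)"
  unfolding tilt_def using tilt_denom_pos[of t r] by (simp add: field_simps)

lemma tilt_1 [simp]: "tilt 1 r = r"
  by (simp add: tilt_def)

lemma tilt_tilt:
  assumes "0 < t" "0 < s" "0 < r" "r < 1" shows "tilt t (tilt s r) = tilt (t * s) r"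
proof -
  have "tilt t (tilt s r) = t * (s * r / (1 - r + s * r)) / ((1 - r) / (1 - r + s * r) + t * (s * r / (1 - r + s * r)))"
    using one_minus_tilt[of s r] assms by (simp add: tilt_def)
  also have "\<dots> = (t * s * r / (1 - r + s * r)) / ((1 - r + t * s * r) / (1 - r + s * r))"
    by (simp add: add_divide_distrib mult.assoc)
  also have "\<dots> = tilt (t * s) r"
    using tilt_denom_pos[of s r] assms by (simp add: tilt_def)
  finally show ?thesis .
qed

lemma tilt_less:
  assumes "0 < t" "t < s" "0 < r" "r < 1" shows "tilt t r < tilt s r"
proof -
  have "t * r * (1 - r) < s * r * (1 - r)" using assms by simp
  hence "t * r * (1 - r + s * r) < s * r * (1 - r + t * r)" by (simp add: algebra_simps)
  thus ?thesis using tilt_denom_pos[of t r] tilt_denom_pos[of s r] assms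
    by (simp add: tilt_def frac_less_eq pos_divide_less_eq pos_less_divide_eq divide_less_eq less_divide_eq field_simps)
qed

lemma tilt_le: "0 < t \<Longrightarrow> t \<le> s \<Longrightarrow> 0 < r \<Longrightarrow> r < 1 \<Longrightarrow> tilt t r \<le> tilt s r"
  using tilt_less[of t s r] by (cases "t = s") auto

lemma unit_probs_tilt: "unit_probs J r \<Longrightarrow> 0 < t \<Longrightarrow> unit_probs J (\<lambda>j. tilt t (r j))"
  by (auto simp: unit_probs_def tilt_pos tilt_less_1)

lemma pmf_bvec:
  assumes "unit_probs J r"
  shows "pmf (bvec J r) x = (if \<forall>j. j \<notin> J \<longrightarrow> \<not> x j then \<Prod>j\<in>J. if x j then r j else 1 - r j else 0)"
proof -
  have "pmf (bernoulli_pmf (r j)) b = (if b then r j else 1 - r j)" if "j \<in> J" for j b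
    using assms that by (cases b) (auto simp: unit_probs_def less_imp_le)
  thus ?thesis using unit_probs_finite[OF assms]
    by (auto simp: bvec_def pmf_Pi intro!: prod.cong)
qed

lemma pmf_bvec_tilt:
  assumes J: "unit_probs J r" and t: "0 < t"
  shows "pmf (bvec J (\<lambda>j. tilt t (r j))) x = t ^ tot J x / (\<Prod>j\<in>J. 1 - r j + t * r j) * pmf (bvec J r) x"
proof -
  note fin = unit_probs_finite[OF J]
  have "(\<Prod>j\<in>J. if x j then tilt t (r j) else 1 - tilt t (r j)) =
        (\<Prod>j\<in>J. (if x j then t else 1) / (1 - r j + t * r j) * (if x j then r j else 1 - r j))"
  proof (intro prod.cong refl)
    fix j assume "j \<in> J"
    thus "(if x j then tilt t (r j) else 1 - tilt t (r j)) =
        (if x j then t else 1) / (1 - r j + t * r j) * (if x j then r j else 1 - r j)"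
      using J t one_minus_tilt[of t "r j"] by (cases "x j") (auto simp: unit_probs_def tilt_def)
  qed
  also have "\<dots> = (\<Prod>j\<in>J. if x j then t else 1) / (\<Prod>j\<in>J. 1 - r j + t * r j) *
      (\<Prod>j\<in>J. if x j then r j else 1 - r j)"
    by (simp only: prod.distrib prod_dividef)
  also have "(\<Prod>j\<in>J. if x j then t else 1) = t ^ tot J x"
    using fin by (simp add: prod.If_cases tot_def Int_def)
  finally show ?thesis
    unfolding pmf_bvec[OF J] pmf_bvec[OF unit_probs_tilt[OF J t]] by auto
qed

section \<open>Comparison of conditioned and tilted vectors\<close>

lemma at_least_nonempty:
  "unit_probs J r \<Longrightarrow> k \<le> card J \<Longrightarrow> set_pmf (bvec J r) \<inter> at_least J k \<noteq> {}"
  using ex_bvec_tot[of J r k] by (auto simp: at_least_def)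

lemma at_most_nonempty:
  "unit_probs J r \<Longrightarrow> set_pmf (bvec J r) \<inter> at_most J k \<noteq> {}"
  using ex_bvec_tot[of J r 0] by (force simp: at_most_def)

lemma prod_denom_pos:
  "unit_probs J r \<Longrightarrow> 0 < t \<Longrightarrow> 0 < (\<Prod>j\<in>J. 1 - r j + t * r j)"
  by (intro prod_pos) (auto simp: unit_probs_def tilt_denom_pos)

text \<open>On the conditioning event the density ratio is proportional to
  \<open>t ^ tot J x\<close>, which increases with the total as \<open>t \<ge> 1\<close>.\<close>

lemma rel_pmf_at_least_tilt:
  assumes J: "unit_probs J r" and t: "1 \<le> t" and k: "k \<le> card J"
  shows "rel_pmf (\<le>) (cond_pmf (bvec J r) (at_least J k))
           (cond_pmf (bvec J (\<lambda>j. tilt t (r j))) (at_least J k))"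
proof -
  have t0: "0 < t" using t by simp
  define Z where "Z = (\<Prod>j\<in>J. 1 - r j + t * r j)"
  define P where "P = Pr (bvec J r) (at_least J k)"
  define Q where "Q = Pr (bvec J (\<lambda>j. tilt t (r j))) (at_least J k)"
  note ne = at_least_nonempty[OF J k] at_least_nonempty[OF unit_probs_tilt[OF J t0] k]
  have pos: "0 < Z" "0 < P" "0 < Q"
    using prod_denom_pos[OF J t0] pmf_cond_pos[OF ne(1)] pmf_cond_pos[OF ne(2)] by (auto simp: Z_def P_def Q_def)
  show ?thesis
  proof (rule rel_pmf_reweight[OF J])
    show "pmf (cond_pmf (bvec J r) (at_least J k)) x = (if k \<le> tot J x then 1 / P else 0) * pmf (bvec J r) x" for x
      unfolding pmf_cond[OF ne(1)] P_def by (simp add: at_least_def)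
    show "pmf (cond_pmf (bvec J (\<lambda>j. tilt t (r j))) (at_least J k)) x =
        (if k \<le> tot J x then t ^ tot J x / (Z * Q) else 0) * pmf (bvec J r) x" for x
      unfolding pmf_cond[OF ne(2)] Q_def by (simp add: at_least_def pmf_bvec_tilt[OF J t0] Z_def)
    fix a b :: nat assume "a \<le> b"
    thus "(if k \<le> b then 1 / P else 0) * (if k \<le> a then t ^ a / (Z * Q) else 0) \<le>
        (if k \<le> a then 1 / P else 0) * (if k \<le> b then t ^ b / (Z * Q) else 0)"
      using pos t by (auto intro!: divide_right_mono power_increasing simp: mult.commute[of P])
  qed
qed

text \<open>The two laws overlap only at total \<open>k\<close>, so any positive tilt is admissible.
  With a tilt whose mean lies below \<open>k\<close> the event \<open>at_most\<close> is likely, and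
  the conditioned vector is bounded below by an essentially unconditioned one.\<close>

lemma rel_pmf_at_most_tilt_at_least:
  assumes J: "unit_probs J r" and t: "0 < t" and k: "k \<le> card J"
  shows "rel_pmf (\<le>) (cond_pmf (bvec J (\<lambda>j. tilt t (r j))) (at_most J k))
           (cond_pmf (bvec J r) (at_least J k))"
proof -
  define Z where "Z = (\<Prod>j\<in>J. 1 - r j + t * r j)"
  define P where "P = Pr (bvec J r) (at_least J k)"
  define Q where "Q = Pr (bvec J (\<lambda>j. tilt t (r j))) (at_most J k)"
  note ne = at_least_nonempty[OF J k] at_most_nonempty[OF unit_probs_tilt[OF J t], of k]
  have pos: "0 < Z" "0 < P" "0 < Q"
    using prod_denom_pos[OF J t] pmf_cond_pos[OF ne(1)] pmf_cond_pos[OF ne(2)] by (auto simp: Z_def P_def Q_def)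
  show ?thesis
  proof (rule rel_pmf_reweight[OF J])
    show "pmf (cond_pmf (bvec J r) (at_least J k)) x = (if k \<le> tot J x then 1 / P else 0) * pmf (bvec J r) x" for x
      unfolding pmf_cond[OF ne(1)] P_def by (simp add: at_least_def)
    show "pmf (cond_pmf (bvec J (\<lambda>j. tilt t (r j))) (at_most J k)) x =
        (if tot J x \<le> k then t ^ tot J x / (Z * Q) else 0) * pmf (bvec J r) x" for x
      unfolding pmf_cond[OF ne(2)] Q_def by (simp add: at_most_def pmf_bvec_tilt[OF J t] Z_def)
    fix a b :: nat assume "a \<le> b"
    thus "(if b \<le> k then t ^ b / (Z * Q) else 0) * (if k \<le> a then 1 / P else 0) \<le>
        (if a \<le> k then t ^ a / (Z * Q) else 0) * (if k \<le> b then 1 / P else 0)"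
      using pos t by auto
  qed
qed

lemma rel_pmf_bvec_at_least:
  assumes J: "unit_probs J r" and k: "k \<le> card J"
  shows "rel_pmf (\<le>) (bvec J r) (cond_pmf (bvec J r) (at_least J k))"
proof -
  define P where "P = Pr (bvec J r) (at_least J k)"
  note ne = at_least_nonempty[OF J k]
  have pos: "0 < P" using pmf_cond_pos[OF ne] by (simp add: P_def)
  show ?thesis
  proof (rule rel_pmf_reweight[OF J])
    show "pmf (cond_pmf (bvec J r) (at_least J k)) x = (if k \<le> tot J x then 1 / P else 0) * pmf (bvec J r) x" for x
      unfolding pmf_cond[OF ne] P_def by (simp add: at_least_def)
    show "pmf (bvec J r) x = 1 * pmf (bvec J r) x" for x by simp
  qed (use pos in auto)
qed

lemma rel_pmf_bvec_mono:
  assumes "unit_probs J r" "unit_probs J s" "\<And>j. j \<in> J \<Longrightarrow> r j \<le> s j"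
  shows "rel_pmf (\<le>) (bvec J r) (bvec J s)"
  using unit_probs_finite[OF assms(1)] assms
proof (induction J rule: finite_induct)
  case empty
  thus ?case by (auto simp: bvec_def)
next
  case (insert j J)
  have "rel_pmf (\<le>) (bvec J r) (bvec J s)"
    using insert.prems by (intro insert.IH) (auto elim: unit_probs_subset)
  moreover have "rel_pmf (\<le>) (bernoulli_pmf (r j)) (bernoulli_pmf (s j))"
    using insert.prems by (intro rel_pmf_bool) (auto simp: unit_probs_def less_imp_le)
  ultimately have "rel_pmf (rel_prod (\<le>) (\<le>)) (pair_pmf (bernoulli_pmf (r j)) (bvec J r))
      (pair_pmf (bernoulli_pmf (s j)) (bvec J s))"
    by (simp add: rel_pmf_rel_prod)
  thus ?case
    unfolding bvec_insert[OF insert.hyps] pmf.rel_map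
    by (rule pmf.rel_mono_strong) (auto simp: le_fun_def)
qed

lemma rel_pmf_prob_gt:
  fixes f :: "'a :: order \<Rightarrow> real"
  assumes "rel_pmf (\<le>) \<mu> \<nu>" "mono f"
  shows "Pr \<mu> {x. z < f x} \<le> Pr \<nu> {x. z < f x}"
proof -
  have "Pr \<mu> {x. z < f x} \<le> Pr \<nu> {y. \<exists>x\<in>{x. z < f x}. x \<le> y}"
    by (rule rel_pmf_measureD[OF assms(1)])
  also have "\<dots> \<le> Pr \<nu> {x. z < f x}"
    using monoD[OF assms(2)] by (intro measure_pmf.finite_measure_mono) (auto intro: less_le_trans)
  finally show ?thesis .
qed

lemma prob_le_conv_gt:
  fixes f :: "'a \<Rightarrow> real"
  shows "Pr \<mu> {x. f x \<le> z} = 1 - Pr \<mu> {x. z < f x}"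
  by (subst measure_pmf.prob_compl[symmetric]) (auto intro!: arg_cong[where f="Pr \<mu>"])

lemma rel_pmf_prob_le:
  fixes f :: "'a :: order \<Rightarrow> real"
  assumes "rel_pmf (\<le>) \<mu> \<nu>" "mono f"
  shows "Pr \<nu> {x. f x \<le> z} \<le> Pr \<mu> {x. f x \<le> z}"
  using rel_pmf_prob_gt[OF assms, of z] by (simp add: prob_le_conv_gt)

text \<open>Tilting upwards under the conditioning makes the event cheaper; the conditioning is then
  dropped by resampling, and the remaining independent vectors compare coordinatewise.\<close>

lemma coup_at_least_tilt:
  assumes J: "unit_probs J r" "unit_probs J s" and t: "1 \<le> t" and k: "k \<le> card J"
    and le: "\<And>j. j \<in> J \<Longrightarrow> tilt t (r j) \<le> s j"
  shows "coup (Pr (bvec J (\<lambda>j. tilt t (r j))) (at_least J k))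
           (cond_pmf (bvec J r) (at_least J k)) (bvec J s)"
proof (rule coup_mono)
  have J': "unit_probs J (\<lambda>j. tilt t (r j))" using t by (intro unit_probs_tilt J) auto
  show "rel_pmf (\<le>) (cond_pmf (bvec J r) (at_least J k)) (cond_pmf (bvec J (\<lambda>j. tilt t (r j))) (at_least J k))"
    by (rule rel_pmf_at_least_tilt) fact+
  show "coup (Pr (bvec J (\<lambda>j. tilt t (r j))) (at_least J k))
     (cond_pmf (bvec J (\<lambda>j. tilt t (r j))) (at_least J k)) (bvec J (\<lambda>j. tilt t (r j)))"
    by (rule coup_cond[OF at_least_nonempty[OF J' k]])
  show "rel_pmf (\<le>) (bvec J (\<lambda>j. tilt t (r j))) (bvec J s)"
    by (rule rel_pmf_bvec_mono[OF J' J(2) le])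
qed

lemma prob_at_least_gt_le:
  fixes f :: "('a \<Rightarrow> bool) \<Rightarrow> real"
  assumes J: "unit_probs J r" and t: "1 \<le> t" and k: "k \<le> card J" and f: "mono f"
  shows "Pr (cond_pmf (bvec J r) (at_least J k)) {x. z < f x} \<le>
     Pr (bvec J (\<lambda>j. tilt t (r j))) {x. z < f x} /
     Pr (bvec J (\<lambda>j. tilt t (r j))) (at_least J k)"
proof -
  have J': "unit_probs J (\<lambda>j. tilt t (r j))" using t by (intro unit_probs_tilt J) auto
  show ?thesis
    by (rule order_trans[OF rel_pmf_prob_gt[OF rel_pmf_at_least_tilt[OF J t k] f]
          prob_cond_pmf_le[OF at_least_nonempty[OF J' k]]])
qed

lemma prob_at_least_le_le:
  fixes f :: "('a \<Rightarrow> bool) \<Rightarrow> real"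
  assumes J: "unit_probs J r" and t: "0 < t" and k: "k \<le> card J" and f: "mono f"
  shows "Pr (cond_pmf (bvec J r) (at_least J k)) {x. f x \<le> z} \<le>
     Pr (bvec J (\<lambda>j. tilt t (r j))) {x. f x \<le> z} /
     Pr (bvec J (\<lambda>j. tilt t (r j))) (at_most J k)"
  by (rule order_trans[OF rel_pmf_prob_le[OF rel_pmf_at_most_tilt_at_least[OF J t k] f]
          prob_cond_pmf_le[OF at_most_nonempty[OF unit_probs_tilt[OF J t]]]])

text \<open>Hoeffding's inequality for the coordinates in \<open>I\<close>. The bound is stated with
  \<open>N\<close> in place of \<open>card I\<close>, so that \<open>N = n\<close> serves every
  union of blocks, also an empty one.\<close>

lemma prob_tot_deviation:
  assumes J: "unit_probs J r" and I: "I \<subseteq> J" "card I \<le> N" and \<epsilon>: "0 < \<epsilon>"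
  shows "Pr (bvec J r) {x. \<epsilon> \<le> \<bar>real (tot I x) - (\<Sum>j\<in>I. r j)\<bar>} \<le> 2 * exp (- 2 * \<epsilon>\<^sup>2 / real N)"
proof (cases "I = {}")
  case True
  hence "{x. \<epsilon> \<le> \<bar>real (tot I x) - (\<Sum>j\<in>I. r j)\<bar>} = {}" using \<epsilon> by (auto simp: tot_def)
  thus ?thesis by simp
next
  case False
  note finJ = unit_probs_finite[OF J]
  have finI: "finite I" using I finJ finite_subset by blast
  let ?M = "measure_pmf (bvec J r)"
  let ?X = "\<lambda>i x. of_bool (x i) :: real"
  interpret Hoeffding_ineq ?M I ?X "\<lambda>_. 0" "\<lambda>_. 1" "\<Sum>i\<in>I. measure_pmf.expectation (bvec J r) (?X i)"
  proof (unfold_locales)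
    have "prob_space.indep_vars ?M (\<lambda>_. count_space UNIV) (\<lambda>x f. f x) J"
      unfolding bvec_def by (rule indep_vars_Pi_pmf[OF finJ])
    hence "prob_space.indep_vars ?M (\<lambda>_. count_space UNIV) (\<lambda>x f. f x) I"
      by (rule prob_space.indep_vars_subset[OF measure_pmf.prob_space_axioms]) (rule I(1))
    thus "prob_space.indep_vars ?M (\<lambda>_. borel) ?X I"
      by (rule prob_space.indep_vars_compose2[OF measure_pmf.prob_space_axioms]) auto
  qed (use finI in auto)
  have "measure_pmf.expectation (bvec J r) (?X i) = r i" if "i \<in> I" for i
  proof -
    have "map_pmf (\<lambda>x. x i) (bvec J r) = bernoulli_pmf (r i)"
      unfolding bvec_def using that I(1) by (subst Pi_pmf_component[OF finJ]) auto
    hence "measure_pmf.expectation (bvec J r) (?X i) = measure_pmf.expectation (bernoulli_pmf (r i)) of_bool"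
      using integral_map_pmf[of "\<lambda>x. x i" "bvec J r" "of_bool :: bool \<Rightarrow> real"] by simp
    also have "\<dots> = r i" using that I(1) J by (auto simp: unit_probs_def less_imp_le)
    finally show ?thesis .
  qed
  hence mean: "(\<Sum>i\<in>I. measure_pmf.expectation (bvec J r) (?X i)) = (\<Sum>j\<in>I. r j)"
    by (intro sum.cong) auto
  have cI: "0 < card I" using False finI by (simp add: card_gt_0_iff)
  have "Pr (bvec J r) {x. \<epsilon> \<le> \<bar>real (tot I x) - (\<Sum>j\<in>I. r j)\<bar>} \<le> 2 * exp (- 2 * \<epsilon>\<^sup>2 / real (card I))"
    using Hoeffding_ineq_abs_ge[of \<epsilon>] \<epsilon> cI by (simp add: mean tot_eq_sum[OF finI])
  also have "\<dots> \<le> 2 * exp (- 2 * \<epsilon>\<^sup>2 / real N)"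
    using I(2) cI \<epsilon> by (simp add: frac_le)
  finally show ?thesis .
qed

section \<open>Limit theorems for the totals\<close>

lemma sumw_generating_function:
  fixes z :: complex
  assumes "unit_probs J r"
  shows "(\<Sum>u\<le>card J. of_real (sumw J r u) * z ^ u) = (\<Prod>j\<in>J. of_real (1 - r j) + of_real (r j) * z)"
  using unit_probs_finite[OF assms] assms
proof (induction J rule: finite_induct)
  case empty
  have "sumw {} r 0 = 1" by (simp add: sumw_conv_prob tot_def)
  thus ?case by simp
next
  case (insert j J)
  have J: "unit_probs J r" using unit_probs_subset[OF insert.prems] by auto
  let ?s = "\<lambda>u. complex_of_real (sumw J r u)"
  have IH: "(\<Sum>u\<le>card J. ?s u * z ^ u) = (\<Prod>j\<in>J. of_real (1 - r j) + of_real (r j) * z)"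
    by (rule insert.IH[OF J])
  note rec = sumw_insert[OF insert.prems insert.hyps(2)]
  have top: "?s (Suc (card J)) = 0" using insert.hyps(1) by (simp add: sumw_eq_0)
  have "(\<Sum>u\<le>card (insert j J). of_real (sumw (insert j J) r u) * z ^ u) =
      of_real (sumw (insert j J) r 0) + (\<Sum>u\<le>card J. of_real (sumw (insert j J) r (Suc u)) * z ^ Suc u)"
    using insert.hyps by (simp add: sum.atMost_Suc_shift del: sum.atMost_Suc)
  also have "\<dots> = of_real (1 - r j) * (?s 0 + (\<Sum>u\<le>card J. ?s (Suc u) * z ^ Suc u)) +
      of_real (r j) * z * (\<Sum>u\<le>card J. ?s u * z ^ u)"
    by (simp add: rec sum_distrib_left sum.distrib sum_subtractf algebra_simps)
  also have "?s 0 + (\<Sum>u\<le>card J. ?s (Suc u) * z ^ Suc u) = (\<Sum>u\<le>Suc (card J). ?s u * z ^ u)"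
    by (simp add: sum.atMost_Suc_shift del: sum.atMost_Suc)
  also have "\<dots> = (\<Sum>u\<le>card J. ?s u * z ^ u)" using top by simp
  finally show ?case
    unfolding IH using insert.hyps by (simp add: algebra_simps)
qed

text \<open>Orthogonality of characters over one period. The scale \<open>b\<close> becomes the
  square root of \<open>n\<close>, so that the inversion integral already has the scaling of its
  limit.\<close>

lemma iexp_lattice_integral:
  fixes m :: int
  assumes b: "0 < b"
  shows "(CLINT s|lborel. indicator {-(pi * b)..pi * b} s *\<^sub>R iexp (s * (m / b))) = (if m = 0 then 2 * pi * b else 0)"
proof (cases "m = 0")
  case True
  thus ?thesis using b by (simp add: mult_ac scaleR_conv_of_real)
next
  case False
  let ?c = "of_int m / b" let ?F = "\<lambda>s. iexp (s * ?c) / (\<i> * ?c)"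
  have c: "?c \<noteq> 0" using False b by simp
  have "(CLINT s|lborel. indicator {-(pi * b)..pi * b} s *\<^sub>R iexp (s * ?c)) = ?F (pi * b) - ?F (-(pi * b))"
  proof (rule integral_FTC_Icc)
    fix x show "(?F has_vector_derivative iexp (x * ?c)) (at x within {-(pi * b)..pi * b})"
      using c by (auto intro!: derivative_eq_intros has_vector_derivative_real_field simp: field_simps)
  qed (use b in \<open>auto intro!: continuous_intros\<close>)
  also have "iexp (pi * b * ?c) = iexp (-(pi * b) * ?c)"
  proof -
    have "pi * b * ?c = of_int m * pi" using b by simp
    moreover have "-(pi * b) * ?c = - (of_int m * pi)" using b by simp
    ultimately show ?thesis
      using sin_zero_iff_int2[of "of_int m * pi"]
      by (simp only: cis_conv_exp[symmetric]) (auto simp: complex_eq_iff)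
  qed
  finally show ?thesis using False by simp
qed

text \<open>Extended by zero to negative totals, because thresholds such as \<open>k - u\<close> run
  through all integers.\<close>

definition sumz :: "'a set \<Rightarrow> ('a \<Rightarrow> real) \<Rightarrow> int \<Rightarrow> real" where
  "sumz J r k = (if 0 \<le> k then sumw J r (nat k) else 0)"

lemma sumz_fourier:
  assumes J: "unit_probs J r" and b: "0 < b"
  shows "complex_of_real (2 * pi * b * sumz J r k) =
    (CLINT s|lborel. indicator {-(pi * b)..pi * b} s *\<^sub>R
       ((\<Sum>u\<le>card J. of_real (sumw J r u) * iexp (s * (u / b))) * iexp (- (s * (k / b)))))"
proof -
  note fin = unit_probs_finite[OF J]
  let ?I = "\<lambda>s. indicator {-(pi * b)..pi * b} s :: real"
  have int: "integrable lborel (\<lambda>s. ?I s *\<^sub>R iexp (s * c))" for c :: real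
    using borel_integrable_atLeastAtMost'[of "-(pi * b)" "pi * b" "\<lambda>s. iexp (s * c)"]
    by (simp add: set_integrable_def continuous_intros)
  have "(CLINT s|lborel. ?I s *\<^sub>R
       ((\<Sum>u\<le>card J. of_real (sumw J r u) * iexp (s * (u / b))) * iexp (- (s * (k / b))))) =
     (CLINT s|lborel. (\<Sum>u\<le>card J. of_real (sumw J r u) * (?I s *\<^sub>R iexp (s * (of_int (int u - k) / b)))))"
  proof (intro Bochner_Integration.integral_cong refl)
    fix s
    have "iexp (s * (u / b)) * iexp (- (s * (k / b))) = iexp (s * (of_int (int u - k) / b))" for u
      by (simp add: exp_add[symmetric] diff_divide_distrib algebra_simps)
    thus "?I s *\<^sub>R ((\<Sum>u\<le>card J. of_real (sumw J r u) * iexp (s * (u / b))) * iexp (- (s * (k / b)))) =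
      (\<Sum>u\<le>card J. of_real (sumw J r u) * (?I s *\<^sub>R iexp (s * (of_int (int u - k) / b))))"
      by (simp add: sum_distrib_right sum_distrib_left mult.assoc mult.left_commute scaleR_conv_of_real)
  qed
  also have "\<dots> = (\<Sum>u\<le>card J. of_real (sumw J r u) * (CLINT s|lborel. ?I s *\<^sub>R iexp (s * (of_int (int u - k) / b))))"
    by (subst Bochner_Integration.integral_sum[OF integrable_mult_right[OF int]])
       (simp only: integral_mult_right_zero)
  also have "\<dots> = (\<Sum>u\<le>card J. if int u = k then complex_of_real (sumw J r u * (2 * pi * b)) else 0)"
    unfolding iexp_lattice_integral[OF b] by (intro sum.cong) auto
  also have "\<dots> = complex_of_real (2 * pi * b * sumz J r k)"
  proof (cases "0 \<le> k")
    case True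
    have "(\<Sum>u\<le>card J. if int u = k then complex_of_real (sumw J r u * (2 * pi * b)) else 0) =
        (\<Sum>u\<le>card J. if u = nat k then complex_of_real (sumw J r u * (2 * pi * b)) else 0)"
      using True by (intro sum.cong) auto
    thus ?thesis using True sumw_eq_0[OF fin, of "nat k" r] by (auto simp: sumz_def not_le)
  next
    case False
    hence "(\<Sum>u\<le>card J. if int u = k then complex_of_real (sumw J r u * (2 * pi * b)) else 0) = 0"
      by (intro sum.neutral) auto
    thus ?thesis using False by (simp add: sumz_def)
  qed
  finally show ?thesis ..
qed

text \<open>The characteristic function of a Bernoulli variable with parameter \<open>r\<close>
  minus its mean.\<close>

definition psi :: "real \<Rightarrow> real \<Rightarrow> complex" where
  "psi r \<theta> = of_real (1 - r) * iexp (- (\<theta> * r)) + of_real r * iexp (\<theta> * (1 - r))"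

lemma psi_eq: "psi r \<theta> = (of_real (1 - r) + of_real r * iexp \<theta>) * iexp (- (\<theta> * r))"
  by (simp add: psi_def exp_add[symmetric] algebra_simps)

text \<open>On [0, 2] the cubic Taylor bound and y^2 \<le> 4 give sin y \<ge> y / 3; with y = |x| /
  2 and 1 - cos x = 2 sin^2 (x / 2) this produces the constant 18.\<close>

lemma one_minus_cos_ge:
  assumes "\<bar>x\<bar> \<le> pi" shows "x\<^sup>2 / 18 \<le> 1 - cos x"
proof -
  have sin: "y / 3 \<le> sin y" if "0 \<le> y" "y \<le> 2" for y :: real
  proof -
    have "\<bar>sin y - (\<Sum>m<3. sin_coeff m * y ^ m)\<bar> \<le> inverse (fact 3) * \<bar>y\<bar> ^ 3"
      by (rule Maclaurin_sin_bound)
    moreover have "(\<Sum>m<3. sin_coeff m * y ^ m) = y"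
      by (simp add: eval_nat_numeral sin_coeff_def)
    ultimately have "\<bar>sin y - y\<bar> \<le> y ^ 3 / 6" using that by (simp add: fact_numeral)
    hence "y - y ^ 3 / 6 \<le> sin y" by linarith
    moreover
    have "y ^ 3 \<le> 4 * y"
    proof -
      have "y\<^sup>2 \<le> 2\<^sup>2" by (rule power_mono) (use that in auto)
      thus ?thesis using that mult_right_mono[of "y\<^sup>2" 4 y] by (simp add: power3_eq_cube power2_eq_square)
    qed
    ultimately show ?thesis by simp
  qed
  have "\<bar>x\<bar> / 2 / 3 \<le> sin (\<bar>x\<bar> / 2)" using assms pi_less_4 by (intro sin) auto
  hence "(\<bar>x\<bar> / 6)\<^sup>2 \<le> (sin (\<bar>x\<bar> / 2))\<^sup>2" by (intro power_mono) auto
  moreover have "cos (2 * (\<bar>x\<bar> / 2)) = 1 - 2 * (sin (\<bar>x\<bar> / 2))\<^sup>2" by (rule cos_double_sin)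
  ultimately show ?thesis by (simp add: power_divide)
qed

text \<open>The squared modulus is 1 - 2 r (1 - r) (1 - cos \<theta>). A Gaussian bound on the whole
  period, not only near 0, is what dominates the inversion integral.\<close>

lemma norm_psi_le:
  assumes r: "0 < r" "r < 1" and "\<bar>\<theta>\<bar> \<le> pi"
  shows "norm (psi r \<theta>) \<le> exp (- (r * (1 - r) * \<theta>\<^sup>2 / 18))"
proof (rule power2_le_imp_le)
  have "(norm (psi r \<theta>))\<^sup>2 = (norm (of_real (1 - r) + of_real r * iexp \<theta>))\<^sup>2"
    by (simp add: psi_eq norm_mult)
  also have "\<dots> = (1 - r + r * cos \<theta>)\<^sup>2 + (r * sin \<theta>)\<^sup>2"
    by (simp add: cmod_power2 cis_conv_exp[symmetric])
  also have "\<dots> = (1 - r)\<^sup>2 + 2 * (1 - r) * r * cos \<theta> + r\<^sup>2 * ((cos \<theta>)\<^sup>2 + (sin \<theta>)\<^sup>2)"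
    by (simp only: power2_sum power_mult_distrib distrib_left)
  also have "\<dots> = (1 - r)\<^sup>2 + 2 * (1 - r) * r * cos \<theta> + r\<^sup>2"
    by (simp only: sin_cos_squared_add2 mult_1_right)
  also have "\<dots> = 1 - 2 * r * (1 - r) * (1 - cos \<theta>)"
    by (simp add: power2_eq_square algebra_simps)
  also have "\<dots> \<le> 1 - 2 * r * (1 - r) * (\<theta>\<^sup>2 / 18)"
    using one_minus_cos_ge[OF assms(3)] r by (simp add: mult_left_mono)
  also have "\<dots> \<le> exp (- (2 * r * (1 - r) * (\<theta>\<^sup>2 / 18)))"
    using exp_ge_add_one_self[of "- (2 * r * (1 - r) * (\<theta>\<^sup>2 / 18))"] by simp
  also have "\<dots> = (exp (- (r * (1 - r) * \<theta>\<^sup>2 / 18)))\<^sup>2"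
    by (simp add: exp_double[symmetric] field_simps)
  finally show "(norm (psi r \<theta>))\<^sup>2 \<le> (exp (- (r * (1 - r) * \<theta>\<^sup>2 / 18)))\<^sup>2" .
qed simp

lemma norm_psi_le_1:
  assumes "0 \<le> r" "r \<le> 1" shows "norm (psi r \<theta>) \<le> 1"
proof -
  have "norm (psi r \<theta>) \<le> norm (complex_of_real (1 - r) * iexp (- (\<theta> * r))) + norm (of_real r * iexp (\<theta> * (1 - r)))"
    unfolding psi_def by (rule norm_triangle_ineq)
  also have "\<dots> = (1 - r) + r"
    unfolding norm_mult norm_of_real norm_exp_i_times using assms by simp
  finally show ?thesis by simp
qed

text \<open>Averages the second order expansions of the two exponentials; the linear terms cancel
  because of the centring.\<close>

lemma psi_approx:
  assumes "0 \<le> r" "r \<le> 1"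
  shows "norm (psi r \<theta> - of_real (1 - r * (1 - r) * \<theta>\<^sup>2 / 2)) \<le> \<bar>\<theta>\<bar> ^ 3"
proof -
  define T where "T x = (\<Sum>k\<le>2. (\<i> * x)^k / fact k)" for x :: real
  have T: "T x = 1 + \<i> * x - x\<^sup>2 / 2" for x
    by (simp add: T_def eval_nat_numeral power2_eq_square algebra_simps)
  have err: "norm (iexp x - T x) \<le> \<bar>\<theta>\<bar> ^ 3" if "\<bar>x\<bar> \<le> \<bar>\<theta>\<bar>" for x
  proof -
    have three: "Suc 2 = 3" by simp
    have "norm (iexp x - T x) \<le> \<bar>x\<bar> ^ 3 / fact 3"
      unfolding T_def using iexp_approx1[of x 2] unfolding three .
    also have "\<dots> \<le> \<bar>x\<bar> ^ 3 / 1" by (intro divide_left_mono fact_ge_1) auto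
    also have "\<dots> = \<bar>x\<bar> ^ 3" by simp
    also have "\<dots> \<le> \<bar>\<theta>\<bar> ^ 3" using that by (auto intro: power_mono)
    finally show ?thesis .
  qed
  have "of_real (1 - r * (1 - r) * \<theta>\<^sup>2 / 2) = of_real (1 - r) * T (- (\<theta> * r)) + of_real r * T (\<theta> * (1 - r))"
    by (simp add: T power2_eq_square field_simps)
  hence "psi r \<theta> - of_real (1 - r * (1 - r) * \<theta>\<^sup>2 / 2) =
     of_real (1 - r) * (iexp (- (\<theta> * r)) - T (- (\<theta> * r))) + of_real r * (iexp (\<theta> * (1 - r)) - T (\<theta> * (1 - r)))"
    by (simp add: psi_def algebra_simps)
  also have "norm \<dots> \<le> norm (of_real (1 - r) * (iexp (- (\<theta> * r)) - T (- (\<theta> * r)))) +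
      norm (of_real r * (iexp (\<theta> * (1 - r)) - T (\<theta> * (1 - r))))"
    by (rule norm_triangle_ineq)
  also have "\<dots> = (1 - r) * norm (iexp (- (\<theta> * r)) - T (- (\<theta> * r))) + r * norm (iexp (\<theta> * (1 - r)) - T (\<theta> * (1 - r)))"
    unfolding norm_mult norm_of_real using assms by simp
  also have "\<dots> \<le> (1 - r) * \<bar>\<theta>\<bar> ^ 3 + r * \<bar>\<theta>\<bar> ^ 3"
    using assms by (intro add_mono mult_left_mono err) (auto simp: abs_mult mult_left_le)
  finally show ?thesis by (simp add: algebra_simps)
qed

text \<open>The powers of numbers of modulus at most 1 differ by at most \<open>m n\<close> times
  the difference of the bases. By \<open>psi_approx\<close> this is of order n times n^(-3/2), so
  \<open>psi\<close> may be replaced by its quadratic approximation \<open>w n\<close>.\<close>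

lemma psi_power_tendsto:
  fixes m :: "nat \<Rightarrow> nat"
  assumes r: "0 \<le> r" "r \<le> 1" and m: "(\<lambda>n. real (m n) / real n) \<longlonglongrightarrow> a"
  shows "(\<lambda>n. psi r (s / sqrt n) ^ m n) \<longlonglongrightarrow> of_real (exp (- (a * (r * (1 - r)) * s\<^sup>2 / 2)))"
proof -
  define w where "w n = 1 - r * (1 - r) * s\<^sup>2 / 2 / real n" for n
  define c where "c = r * (1 - r) * s\<^sup>2 / 2"
  have c: "0 \<le> c" using r by (simp add: c_def)
  have w: "w n = 1 - c / real n" for n by (simp add: w_def c_def)
  have "(\<lambda>n. c / real n) \<longlonglongrightarrow> 0" by (rule lim_const_over_n)
  hence ev: "eventually (\<lambda>n. c / real n < 1) sequentially" by (rule order_tendstoD) simp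
  have wlim: "(\<lambda>n. w n ^ m n) \<longlonglongrightarrow> exp (- (a * c))"
  proof (rule Lim_transform_eventually)
    have "(\<lambda>n. real n * ln (1 - c / real n)) \<longlonglongrightarrow> - c" by real_asymp
    hence "(\<lambda>n. exp (real (m n) / real n * (real n * ln (1 - c / real n)))) \<longlonglongrightarrow> exp (a * - c)"
      by (intro tendsto_intros m)
    thus "(\<lambda>n. exp (real (m n) / real n * (real n * ln (1 - c / real n)))) \<longlonglongrightarrow> exp (- (a * c))" by simp
    show "eventually (\<lambda>n. exp (real (m n) / real n * (real n * ln (1 - c / real n))) = w n ^ m n) sequentially"
      using ev eventually_gt_at_top[of 0]
    proof eventually_elim
      case (elim n)
      hence "w n ^ m n = exp (real (m n) * ln (w n))" by (simp add: w exp_of_nat_mult)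
      thus ?case using elim by (simp add: w)
    qed
  qed
  have "(\<lambda>n. psi r (s / sqrt n) ^ m n - of_real (w n) ^ m n) \<longlonglongrightarrow> 0"
  proof (rule Lim_null_comparison)
    show "eventually (\<lambda>n. norm (psi r (s / sqrt n) ^ m n - of_real (w n) ^ m n) \<le> real (m n) / real n * (\<bar>s\<bar> ^ 3 / sqrt n)) sequentially"
      using ev eventually_gt_at_top[of 0]
    proof eventually_elim
      case (elim n)
      have "norm (complex_of_real (w n)) \<le> 1" unfolding norm_of_real using elim c by (simp add: w)
      hence "norm (psi r (s / sqrt n) ^ m n - of_real (w n) ^ m n) \<le> real (m n) * norm (psi r (s / sqrt n) - of_real (w n))"
        by (intro norm_power_diff norm_psi_le_1 r)
      also have "\<dots> \<le> real (m n) * \<bar>s / sqrt n\<bar> ^ 3"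
      proof (rule mult_left_mono)
        have "w n = 1 - r * (1 - r) * (s / sqrt n)\<^sup>2 / 2"
          using elim by (simp add: w_def power_divide)
        thus "norm (psi r (s / sqrt n) - of_real (w n)) \<le> \<bar>s / sqrt n\<bar> ^ 3"
          using psi_approx[OF r, of "s / sqrt n"] by (simp only:)
      qed simp
      also have "\<dots> = real (m n) / real n * (\<bar>s\<bar> ^ 3 / sqrt n)"
        using elim by (simp add: abs_divide power_divide power3_eq_cube)
      finally show ?case .
    qed
    have "(\<lambda>n. \<bar>s\<bar> ^ 3 / sqrt (real n)) \<longlonglongrightarrow> 0" by real_asymp
    from tendsto_mult[OF m this] show "(\<lambda>n. real (m n) / real n * (\<bar>s\<bar> ^ 3 / sqrt n)) \<longlonglongrightarrow> 0" by simp
  qed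
  moreover have "(\<lambda>n. complex_of_real (w n) ^ m n) \<longlonglongrightarrow> of_real (exp (- (a * c)))"
    using tendsto_of_real[OF wlim, where 'a=complex] by simp
  ultimately have "(\<lambda>n. (psi r (s / sqrt n) ^ m n - of_real (w n) ^ m n) + of_real (w n) ^ m n) \<longlonglongrightarrow> 0 + of_real (exp (- (a * c)))"
    by (rule tendsto_add)
  thus ?thesis by (simp add: c_def algebra_simps)
qed

lemma integrable_exp_neg_square:
  assumes "0 < c" shows "integrable lborel (\<lambda>s::real. exp (- (c * s\<^sup>2)))"
proof -
  have eq: "exp (- (c * s\<^sup>2)) = sqrt (pi / c) * normal_density 0 (1 / sqrt (2 * c)) s" for s
  proof -
    have "(1 / sqrt (2 * c))\<^sup>2 = 1 / (2 * c)" using assms by (simp add: power_divide)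
    thus ?thesis using assms by (simp add: normal_density_def real_sqrt_divide real_sqrt_mult)
  qed
  show ?thesis unfolding eq by (intro integrable_mult_right integrable_normal_density) (use assms in simp)
qed

text \<open>The characteristic function of the standard normal law at \<open>- y / \<sigma>\<close>,
  after the substitution x = \<sigma> s.\<close>

lemma gaussian_fourier:
  assumes \<sigma>: "0 < \<sigma>"
  shows "(CLINT s|lborel. of_real (exp (- (\<sigma>\<^sup>2 * s\<^sup>2 / 2))) * iexp (- (s * y))) =
     complex_of_real (2 * pi * normal_density 0 \<sigma> y)"
proof -
  have "complex_of_real (exp (- ((- y / \<sigma>)\<^sup>2) / 2)) = (CLINT x|std_normal_distribution. iexp ((- y / \<sigma>) * x))"
    using fun_cong[OF char_std_normal_distribution, of "- y / \<sigma>"] unfolding char_def by (rule sym)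
  also have "\<dots> = (CLINT x|lborel. std_normal_density x *\<^sub>R iexp ((- y / \<sigma>) * x))"
    by (subst integral_density) auto
  also have "\<dots> = \<bar>\<sigma>\<bar> *\<^sub>R (CLINT s|lborel. std_normal_density (0 + \<sigma> * s) *\<^sub>R iexp ((- y / \<sigma>) * (0 + \<sigma> * s)))"
    by (rule lborel_integral_real_affine) (use \<sigma> in simp)
  also have "(\<lambda>s. std_normal_density (0 + \<sigma> * s) *\<^sub>R iexp ((- y / \<sigma>) * (0 + \<sigma> * s))) =
      (\<lambda>s. of_real (1 / sqrt (2 * pi)) * (of_real (exp (- (\<sigma>\<^sup>2 * s\<^sup>2 / 2))) * iexp (- (s * y))))"
    using \<sigma> by (auto simp: fun_eq_iff std_normal_density_def scaleR_conv_of_real power_mult_distrib mult.commute)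
  also have "\<bar>\<sigma>\<bar> *\<^sub>R (CLINT s|lborel. of_real (1 / sqrt (2 * pi)) * (of_real (exp (- (\<sigma>\<^sup>2 * s\<^sup>2 / 2))) * iexp (- (s * y)))) =
      of_real (\<sigma> / sqrt (2 * pi)) * (CLINT s|lborel. of_real (exp (- (\<sigma>\<^sup>2 * s\<^sup>2 / 2))) * iexp (- (s * y)))"
    unfolding integral_mult_right_zero using \<sigma> by (simp add: scaleR_conv_of_real)
  finally have "(CLINT s|lborel. of_real (exp (- (\<sigma>\<^sup>2 * s\<^sup>2 / 2))) * iexp (- (s * y))) =
     of_real (sqrt (2 * pi) / \<sigma>) * complex_of_real (exp (- ((- y / \<sigma>)\<^sup>2) / 2))"
    using \<sigma> by (simp add: field_simps)
  also have "\<dots> = complex_of_real (sqrt (2 * pi) / \<sigma> * exp (- ((- y / \<sigma>)\<^sup>2) / 2))" by simp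
  also have "sqrt (2 * pi) / \<sigma> * exp (- ((- y / \<sigma>)\<^sup>2) / 2) = 2 * pi * normal_density 0 \<sigma> y"
  proof -
    have "2 * pi = sqrt (2 * pi) * sqrt (2 * pi)" by simp
    thus ?thesis using \<sigma> by (simp add: normal_density_def power_divide real_sqrt_mult field_simps)
  qed
  finally show ?thesis .
qed

section \<open>Local and central limit theorems for block arrays\<close>

lemma prod_blocks:
  fixes f :: "nat \<Rightarrow> 'b :: comm_monoid_mult"
  assumes "finite A"
  shows "(\<Prod>j\<in>{j \<in> {1..n}. blk n j \<in> A}. f (blk n j)) = (\<Prod>i\<in>A. f i ^ block_size blk i n)"
proof -
  let ?J = "{j \<in> {1..n}. blk n j \<in> A}"
  have "(\<Prod>j\<in>?J. f (blk n j)) = (\<Prod>i\<in>A. \<Prod>j\<in>{j \<in> ?J. blk n j = i}. f (blk n j))"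
    by (rule prod.group[symmetric]) (auto simp: assms)
  also have "\<dots> = (\<Prod>i\<in>A. f i ^ block_size blk i n)"
  proof (rule prod.cong[OF refl])
    fix i assume "i \<in> A"
    hence "{j \<in> ?J. blk n j = i} = {j \<in> {1..n}. blk n j = i}" by auto
    thus "(\<Prod>j\<in>{j \<in> ?J. blk n j = i}. f (blk n j)) = f i ^ block_size blk i n"
      by (simp add: block_size_def)
  qed
  finally show ?thesis .
qed

lemma sum_blocks:
  fixes f :: "nat \<Rightarrow> real"
  assumes "finite A"
  shows "(\<Sum>j\<in>{j \<in> {1..n}. blk n j \<in> A}. f (blk n j)) = (\<Sum>i\<in>A. f i * real (block_size blk i n))"
proof -
  let ?J = "{j \<in> {1..n}. blk n j \<in> A}"
  have "(\<Sum>j\<in>?J. f (blk n j)) = (\<Sum>i\<in>A. \<Sum>j\<in>{j \<in> ?J. blk n j = i}. f (blk n j))"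
    by (rule sum.group[symmetric]) (auto simp: assms)
  also have "\<dots> = (\<Sum>i\<in>A. f i * real (block_size blk i n))"
  proof (rule sum.cong[OF refl])
    fix i assume "i \<in> A"
    hence "{j \<in> ?J. blk n j = i} = {j \<in> {1..n}. blk n j = i}" by auto
    thus "(\<Sum>j\<in>{j \<in> ?J. blk n j = i}. f (blk n j)) = f i * real (block_size blk i n)"
      by (simp add: block_size_def)
  qed
  finally show ?thesis .
qed

text \<open>Only the blocks with labels in \<open>L\<close> are seen. The locale is used three times
  in the critical window: for the blocks in \<open>I\<close>, for those off \<open>I\<close>, and
  for all of them.\<close>

locale block_array =
  fixes L :: "nat set" and blk :: "nat \<Rightarrow> nat \<Rightarrow> nat" and r a :: "nat \<Rightarrow> real"
  assumes finite_L: "finite L" and L_nonempty: "L \<noteq> {}"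
    and r: "\<And>i. i \<in> L \<Longrightarrow> 0 < r i \<and> r i < 1"
    and a: "\<And>i. i \<in> L \<Longrightarrow> 0 < a i"
    and block_lim: "\<And>i. i \<in> L \<Longrightarrow> (\<lambda>n. real (block_size blk i n) / real n) \<longlonglongrightarrow> a i"
begin

definition idx :: "nat \<Rightarrow> nat set" where
  "idx n = {j \<in> {1..n}. blk n j \<in> L}"

definition prb :: "nat \<Rightarrow> nat \<Rightarrow> real" where
  "prb n j = r (blk n j)"

definition mean :: "nat \<Rightarrow> real" where
  "mean n = (\<Sum>i\<in>L. r i * real (block_size blk i n))"

definition sd :: real where
  "sd = sqrt (\<Sum>i\<in>L. a i * (r i * (1 - r i)))"

lemma unit_probs_idx: "unit_probs (idx n) (prb n)"
  using r by (auto simp: unit_probs_def idx_def prb_def)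

lemma finite_idx [simp]: "finite (idx n)" by (simp add: idx_def)

lemma sd_square: "sd\<^sup>2 = (\<Sum>i\<in>L. a i * (r i * (1 - r i)))" and sd_pos: "0 < sd"
proof -
  have "0 < (\<Sum>i\<in>L. a i * (r i * (1 - r i)))"
    using finite_L L_nonempty a r by (intro sum_pos) auto
  thus "sd\<^sup>2 = (\<Sum>i\<in>L. a i * (r i * (1 - r i)))" "0 < sd" by (auto simp: sd_def)
qed

lemma prod_idx:
  fixes f :: "nat \<Rightarrow> 'b :: comm_monoid_mult"
  shows "(\<Prod>j\<in>idx n. f (blk n j)) = (\<Prod>i\<in>L. f i ^ block_size blk i n)"
  unfolding idx_def by (rule prod_blocks[OF finite_L])

lemma sum_prb: "(\<Sum>j\<in>idx n. prb n j) = mean n"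
  unfolding prb_def mean_def idx_def by (rule sum_blocks[OF finite_L])

text \<open>The characteristic function of the centred total over the square root of
  \<open>n\<close>; the standard deviation is left in the limit.\<close>

definition cf :: "nat \<Rightarrow> real \<Rightarrow> complex" where
  "cf n s = (\<Sum>u\<le>card (idx n). of_real (sumw (idx n) (prb n) u) * iexp (s * ((real u - mean n) / sqrt n)))"

lemma cf_eq_gen:
  "cf n s = (\<Sum>u\<le>card (idx n). of_real (sumw (idx n) (prb n) u) * iexp (s * (real u / sqrt n))) * iexp (- (s * (mean n / sqrt n)))"
proof -
  have "iexp (s * ((real u - mean n) / sqrt n)) = iexp (s * (real u / sqrt n)) * iexp (- (s * (mean n / sqrt n)))" for u
    by (simp add: exp_add[symmetric] diff_divide_distrib algebra_simps)
  thus ?thesis unfolding cf_def by (simp only: sum_distrib_right mult.assoc)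
qed

lemma cf_eq: "cf n s = (\<Prod>i\<in>L. psi (r i) (s / sqrt n) ^ block_size blk i n)"
proof -
  let ?\<theta> = "s / sqrt n"
  have "iexp (s * (real u / sqrt n)) = iexp ?\<theta> ^ u" for u
    by (simp add: exp_of_nat_mult[symmetric] mult_ac)
  hence "(\<Sum>u\<le>card (idx n). of_real (sumw (idx n) (prb n) u) * iexp (s * (real u / sqrt n))) =
     (\<Prod>j\<in>idx n. of_real (1 - prb n j) + of_real (prb n j) * iexp ?\<theta>)"
    by (simp only: sumw_generating_function[OF unit_probs_idx])
  also have "\<dots> = (\<Prod>i\<in>L. (of_real (1 - r i) + of_real (r i) * iexp ?\<theta>) ^ block_size blk i n)"
    unfolding prb_def by (rule prod_idx)
  finally have 1: "(\<Sum>u\<le>card (idx n). of_real (sumw (idx n) (prb n) u) * iexp (s * (real u / sqrt n))) = \<dots>" .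
  have "iexp (- (s * (mean n / sqrt n))) = exp (\<Sum>i\<in>L. of_nat (block_size blk i n) * (\<i> * complex_of_real (- (?\<theta> * r i))))"
    by (simp add: mean_def sum_distrib_left sum_divide_distrib sum_negf mult_ac)
  also have "\<dots> = (\<Prod>i\<in>L. iexp (- (?\<theta> * r i)) ^ block_size blk i n)"
    by (simp only: exp_sum[OF finite_L] exp_of_nat_mult)
  finally have 2: "iexp (- (s * (mean n / sqrt n))) = \<dots>" .
  show ?thesis
    unfolding cf_eq_gen 1 2 psi_eq power_mult_distrib prod.distrib ..
qed

lemma cf_tendsto: "(\<lambda>n. cf n s) \<longlonglongrightarrow> of_real (exp (- (sd\<^sup>2 * s\<^sup>2 / 2)))"
proof -
  have "(\<lambda>n. cf n s) \<longlonglongrightarrow> (\<Prod>i\<in>L. of_real (exp (- (a i * (r i * (1 - r i)) * s\<^sup>2 / 2))))"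
    unfolding cf_eq
  proof (rule tendsto_prod)
    fix i assume "i \<in> L"
    thus "(\<lambda>n. psi (r i) (s / sqrt n) ^ block_size blk i n) \<longlonglongrightarrow> of_real (exp (- (a i * (r i * (1 - r i)) * s\<^sup>2 / 2)))"
      using r[of i] by (intro psi_power_tendsto block_lim) auto
  qed
  also have "(\<Prod>i\<in>L. complex_of_real (exp (- (a i * (r i * (1 - r i)) * s\<^sup>2 / 2)))) =
      of_real (exp (\<Sum>i\<in>L. - (a i * (r i * (1 - r i)) * s\<^sup>2 / 2)))"
    by (simp only: exp_sum[OF finite_L] of_real_prod)
  also have "(\<Sum>i\<in>L. - (a i * (r i * (1 - r i)) * s\<^sup>2 / 2)) = - (sd\<^sup>2 * s\<^sup>2 / 2)"
    by (simp add: sd_square sum_negf sum_distrib_right sum_divide_distrib)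
  finally show ?thesis .
qed

text \<open>A single block with positive limiting proportion suffices, since all other factors have
  modulus at most 1. The constant combines the 18 of \<open>norm_psi_le\<close> with half the
  limiting proportion of that block, which its size eventually exceeds.\<close>

lemma cf_bound:
  obtains c where "0 < c"
    and "eventually (\<lambda>n. \<forall>s. \<bar>s\<bar> \<le> pi * sqrt n \<longrightarrow> norm (cf n s) \<le> exp (- (c * s\<^sup>2))) sequentially"
proof -
  obtain i where i: "i \<in> L" using L_nonempty by blast
  define c where "c = r i * (1 - r i) / 18 * (a i / 2)"
  have ri: "0 < r i" "r i < 1" and ai: "0 < a i" using r[OF i] a[OF i] by auto
  have half: "a i / 2 < a i" using ai by simp
  have "0 < c" using ri ai by (simp add: c_def)
  moreover have "eventually (\<lambda>n. \<forall>s. \<bar>s\<bar> \<le> pi * sqrt n \<longrightarrow> norm (cf n s) \<le> exp (- (c * s\<^sup>2))) sequentially"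
    using order_tendstoD(1)[OF block_lim[OF i] half] eventually_gt_at_top[of "0 :: nat"]
  proof (eventually_elim, intro allI impI)
    fix n :: nat and s :: real
    assume n: "a i / 2 < real (block_size blk i n) / real n" "0 < n" and s: "\<bar>s\<bar> \<le> pi * sqrt n"
    let ?\<theta> = "s / sqrt n" let ?m = "block_size blk i n"
    have \<theta>: "\<bar>?\<theta>\<bar> \<le> pi" using s n by (simp add: abs_divide divide_le_eq)
    have "norm (cf n s) = (\<Prod>i\<in>L. norm (psi (r i) ?\<theta>) ^ block_size blk i n)"
      by (simp add: cf_eq norm_power prod_norm[symmetric])
    also have "\<dots> = norm (psi (r i) ?\<theta>) ^ ?m * (\<Prod>i\<in>L-{i}. norm (psi (r i) ?\<theta>) ^ block_size blk i n)"
      by (rule prod.remove[OF finite_L i])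
    also have "\<dots> \<le> norm (psi (r i) ?\<theta>) ^ ?m * 1"
      using r by (intro mult_left_mono prod_le_1) (auto intro!: power_le_one norm_psi_le_1 simp: less_imp_le)
    also have "\<dots> \<le> exp (- (r i * (1 - r i) * ?\<theta>\<^sup>2 / 18)) ^ ?m"
      using norm_psi_le[OF ri \<theta>] by (simp add: power_mono)
    also have "\<dots> = exp (- (r i * (1 - r i) / 18 * (?m / n) * s\<^sup>2))"
      using n by (simp add: exp_of_nat_mult[symmetric] power_divide mult_ac)
    also have "\<dots> \<le> exp (- (c * s\<^sup>2))"
    proof -
      have "c \<le> r i * (1 - r i) / 18 * (?m / n)"
        unfolding c_def using n ri by (intro mult_left_mono) auto
      from mult_right_mono[OF this, of "s\<^sup>2"] show ?thesis by simp
    qed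
    finally show "norm (cf n s) \<le> exp (- (c * s\<^sup>2))" .
  qed
  ultimately show ?thesis by (rule that)
qed

text \<open>The inversion integrand, set to zero outside one period, so that dominated convergence
  applies on the whole line although the period grows with \<open>n\<close>.\<close>

definition fint :: "nat \<Rightarrow> int \<Rightarrow> real \<Rightarrow> complex" where
  "fint n k s = indicator {-(pi * sqrt n)..pi * sqrt n} s *\<^sub>R (cf n s * iexp (- (s * ((k - mean n) / sqrt n))))"

lemma sumz_eq_integral:
  assumes "0 < n"
  shows "complex_of_real (2 * pi * (sqrt n * sumz (idx n) (prb n) k)) = (CLINT s|lborel. fint n k s)"
proof -
  have "iexp (- (s * (mean n / sqrt n))) * iexp (- (s * ((k - mean n) / sqrt n))) = iexp (- (s * (k / sqrt n)))" for s
    by (simp add: exp_add[symmetric] diff_divide_distrib algebra_simps)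
  hence "fint n k s = indicator {-(pi * sqrt n)..pi * sqrt n} s *\<^sub>R
      ((\<Sum>u\<le>card (idx n). of_real (sumw (idx n) (prb n) u) * iexp (s * (u / sqrt n))) * iexp (- (s * (k / sqrt n))))" for s
    unfolding fint_def cf_eq_gen by (simp only: mult.assoc)
  thus ?thesis
    using sumz_fourier[OF unit_probs_idx, of "sqrt n" n k] assms by (simp add: mult.assoc)
qed

lemma fint_measurable [measurable]: "fint n k \<in> borel_measurable lborel"
  unfolding fint_def cf_def by measurable

lemma fint_bound:
  obtains c where "0 < c" and "eventually (\<lambda>n. \<forall>k s. norm (fint n k s) \<le> exp (- (c * s\<^sup>2))) sequentially"
proof -
  obtain c where c: "0 < c"
    "eventually (\<lambda>n. \<forall>s. \<bar>s\<bar> \<le> pi * sqrt n \<longrightarrow> norm (cf n s) \<le> exp (- (c * s\<^sup>2))) sequentially"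
    by (rule cf_bound)
  from c(2) have "eventually (\<lambda>n. \<forall>k s. norm (fint n k s) \<le> exp (- (c * s\<^sup>2))) sequentially"
  proof eventually_elim
    case (elim n)
    thus ?case by (auto simp: fint_def norm_mult indicator_def)
  qed
  with c(1) show ?thesis by (rule that)
qed

text \<open>A bound on the point probabilities that is uniform in \<open>k\<close>; it dominates the
  geometric series over point probabilities in the tail weights.\<close>

lemma sumz_bound:
  obtains C where "0 < C" and "eventually (\<lambda>n. \<forall>k. sqrt n * sumz (idx n) (prb n) k \<le> C) sequentially"
proof -
  obtain c where c: "0 < c" "eventually (\<lambda>n. \<forall>k s. norm (fint n k s) \<le> exp (- (c * s\<^sup>2))) sequentially"
    by (rule fint_bound)
  define C where "C = (LINT s|lborel. exp (- (c * s\<^sup>2))) / (2 * pi)"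
  have "eventually (\<lambda>n. \<forall>k. sqrt n * sumz (idx n) (prb n) k \<le> max 1 C) sequentially"
    using c(2) eventually_gt_at_top[of "0 :: nat"]
  proof (eventually_elim, intro allI)
    fix n :: nat and k :: int
    assume n: "\<forall>k s. norm (fint n k s) \<le> exp (- (c * s\<^sup>2))" "0 < n"
    have "2 * pi * (sqrt n * sumz (idx n) (prb n) k) \<le> norm (complex_of_real (2 * pi * (sqrt n * sumz (idx n) (prb n) k)))"
      unfolding norm_of_real by (rule abs_ge_self)
    also have "\<dots> \<le> (LINT s|lborel. norm (fint n k s))"
      unfolding sumz_eq_integral[OF n(2)] by (rule integral_norm_bound)
    also have "\<dots> \<le> (LINT s|lborel. exp (- (c * s\<^sup>2)))"
    proof (rule integral_mono)
      show int: "integrable lborel (\<lambda>s. exp (- (c * s\<^sup>2)))" by (rule integrable_exp_neg_square[OF c(1)])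
      show "integrable lborel (\<lambda>s. norm (fint n k s))"
        by (rule integrable_norm, rule Bochner_Integration.integrable_bound[OF int]) (use n in auto)
    qed (use n in auto)
    finally have "sqrt n * sumz (idx n) (prb n) k \<le> C" by (simp add: C_def field_simps)
    thus "sqrt n * sumz (idx n) (prb n) k \<le> max 1 C" by simp
  qed
  thus ?thesis by (intro that[of "max 1 C"]) auto
qed

text \<open>Dominated convergence in the inversion integral. The domination holds only from some
  index on, hence the shift of the sequences by \<open>N\<close>.\<close>

theorem local_limit:
  assumes k: "(\<lambda>n. (k n - mean n) / sqrt n) \<longlonglongrightarrow> y"
  shows "(\<lambda>n. sqrt n * sumz (idx n) (prb n) (k n)) \<longlonglongrightarrow> normal_density 0 sd y"
proof -
  obtain c where c: "0 < c" "eventually (\<lambda>n. \<forall>k s. norm (fint n k s) \<le> exp (- (c * s\<^sup>2))) sequentially"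
    by (rule fint_bound)
  then obtain N where N: "\<And>n k s. n \<ge> N \<Longrightarrow> norm (fint n k s) \<le> exp (- (c * s\<^sup>2))"
    by (auto simp: eventually_sequentially)
  have "(\<lambda>n. CLINT s|lborel. fint (n + N) (k (n + N)) s) \<longlonglongrightarrow>
      (CLINT s|lborel. of_real (exp (- (sd\<^sup>2 * s\<^sup>2 / 2))) * iexp (- (s * y)))"
  proof (rule integral_dominated_convergence[where w="\<lambda>s. exp (- (c * s\<^sup>2))"])
    show "integrable lborel (\<lambda>s. exp (- (c * s\<^sup>2)))" by (rule integrable_exp_neg_square[OF c(1)])
    show "AE s in lborel. (\<lambda>n. fint (n + N) (k (n + N)) s) \<longlonglongrightarrow> of_real (exp (- (sd\<^sup>2 * s\<^sup>2 / 2))) * iexp (- (s * y))"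
    proof (rule AE_I2)
      fix s :: real
      have "(\<lambda>n. cf n s * iexp (- (s * ((k n - mean n) / sqrt n)))) \<longlonglongrightarrow> of_real (exp (- (sd\<^sup>2 * s\<^sup>2 / 2))) * iexp (- (s * y))"
        by (intro tendsto_intros cf_tendsto k)
      moreover have "filterlim (\<lambda>n. pi * sqrt (real n)) at_top sequentially" by real_asymp
      hence "eventually (\<lambda>n. \<bar>s\<bar> < pi * sqrt (real n)) sequentially" by (simp add: filterlim_at_top_dense)
      hence "eventually (\<lambda>n. cf n s * iexp (- (s * ((k n - mean n) / sqrt n))) = fint n (k n) s) sequentially"
        by eventually_elim (auto simp: fint_def indicator_def abs_less_iff)
      ultimately have "(\<lambda>n. fint n (k n) s) \<longlonglongrightarrow> of_real (exp (- (sd\<^sup>2 * s\<^sup>2 / 2))) * iexp (- (s * y))"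
        by (rule Lim_transform_eventually)
      thus "(\<lambda>n. fint (n + N) (k (n + N)) s) \<longlonglongrightarrow> of_real (exp (- (sd\<^sup>2 * s\<^sup>2 / 2))) * iexp (- (s * y))"
        by (rule LIMSEQ_ignore_initial_segment)
    qed
    show "AE s in lborel. norm (fint (n + N) (k (n + N)) s) \<le> exp (- (c * s\<^sup>2))" for n
      by (rule AE_I2) (rule N, simp)
  qed measurable
  hence "(\<lambda>n. CLINT s|lborel. fint n (k n) s) \<longlonglongrightarrow> complex_of_real (2 * pi * normal_density 0 sd y)"
    unfolding gaussian_fourier[OF sd_pos] by (rule LIMSEQ_offset)
  moreover have "eventually (\<lambda>n. (CLINT s|lborel. fint n (k n) s) = complex_of_real (2 * pi * (sqrt n * sumz (idx n) (prb n) (k n)))) sequentially"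
    using eventually_gt_at_top[of "0 :: nat"] by eventually_elim (simp only: sumz_eq_integral)
  ultimately have "(\<lambda>n. complex_of_real (2 * pi * (sqrt n * sumz (idx n) (prb n) (k n)))) \<longlonglongrightarrow> complex_of_real (2 * pi * normal_density 0 sd y)"
    by (rule Lim_transform_eventually)
  hence "(\<lambda>n. 2 * pi * (sqrt n * sumz (idx n) (prb n) (k n))) \<longlonglongrightarrow> 2 * pi * normal_density 0 sd y"
    by (simp only: tendsto_of_real_iff)
  hence "(\<lambda>n. 2 * pi * (sqrt n * sumz (idx n) (prb n) (k n)) / (2 * pi)) \<longlonglongrightarrow> 2 * pi * normal_density 0 sd y / (2 * pi)"
    by (intro tendsto_divide tendsto_const) auto
  thus ?thesis by simp
qed

definition nrm :: "nat \<Rightarrow> (nat \<Rightarrow> bool) \<Rightarrow> real" where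
  "nrm n x = (real (tot (idx n) x) - mean n) / (sd * sqrt n)"

lemma expectation_tot:
  fixes f :: "nat \<Rightarrow> 'b :: {banach, second_countable_topology}"
  shows "measure_pmf.expectation (bvec (idx n) (prb n)) (\<lambda>x. f (tot (idx n) x)) =
    (\<Sum>u\<le>card (idx n). sumw (idx n) (prb n) u *\<^sub>R f u)"
proof -
  have "measure_pmf.expectation (bvec (idx n) (prb n)) (\<lambda>x. f (tot (idx n) x)) =
      measure_pmf.expectation (map_pmf (tot (idx n)) (bvec (idx n) (prb n))) f"
    by simp
  also have "\<dots> = (\<Sum>u\<le>card (idx n). sumw (idx n) (prb n) u *\<^sub>R f u)"
    unfolding sumw_def using tot_le_card[of "idx n"] by (intro integral_measure_pmf) auto
  finally show ?thesis .
qed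

definition distr_nrm :: "nat \<Rightarrow> real measure" where
  "distr_nrm n = distr (bvec (idx n) (prb n)) borel (nrm n)"

lemma real_distribution_nrm: "real_distribution (distr_nrm n)"
  unfolding distr_nrm_def by (rule prob_space.real_distribution_distr[OF measure_pmf.prob_space_axioms]) simp

theorem clt: "weak_conv_m distr_nrm std_normal_distribution"
proof (rule levy_continuity[OF real_distribution_nrm real_dist_normal_dist])
  fix t :: real
  have "char (distr_nrm n) t = cf n (t / sd)" for n
  proof -
    have "char (distr_nrm n) t = measure_pmf.expectation (bvec (idx n) (prb n)) (\<lambda>x. iexp (t * nrm n x))"
      unfolding char_def distr_nrm_def by (subst integral_distr) auto
    also have "\<dots> = (\<Sum>u\<le>card (idx n). sumw (idx n) (prb n) u *\<^sub>R iexp (t * ((real u - mean n) / (sd * sqrt n))))"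
      unfolding nrm_def by (rule expectation_tot)
    also have "\<dots> = cf n (t / sd)"
      by (simp add: cf_def scaleR_conv_of_real)
    finally show ?thesis .
  qed
  thus "(\<lambda>n. char (distr_nrm n) t) \<longlonglongrightarrow> char std_normal_distribution t"
    using cf_tendsto[of "t / sd"] sd_pos by (simp add: char_std_normal_distribution power_divide)
qed

end

section \<open>Geometrically weighted tails\<close>

lemma sum_sumw: "finite J \<Longrightarrow> (\<Sum>u\<le>card J. sumw J r u) = 1"
  unfolding sumw_def using tot_le_card[of J] by (intro sum_pmf_eq_1) auto

text \<open>
  For \<open>d \<ge> 0\<close> this is, up to a constant factor, \<open>\<beta>\<close> to the \<open>-d\<close> times the probability that the total
  of the vector tilted by \<open>\<beta>\<close> is at least \<open>d\<close>. With this normalisation it has a limit: as it is if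
  \<open>\<beta> = 1\<close>, and after multiplication by the square root of \<open>n\<close> if \<open>\<beta> < 1\<close>.
\<close>

definition tailw :: "'a set \<Rightarrow> ('a \<Rightarrow> real) \<Rightarrow> real \<Rightarrow> int \<Rightarrow> real" where
  "tailw J r \<beta> d = (\<Sum>s\<le>card J. sumw J r s * (if d \<le> int s then \<beta> ^ nat (int s - d) else 0))"

text \<open>Reindexes by the excess \<open>l\<close> of the total over \<open>d\<close>. For \<beta>
  < 1 the weights \<open>\<beta> ^ l\<close> are summable, so limits can be taken term by
  term.\<close>

lemma tailw_sums:
  assumes "finite J"
  shows "(\<lambda>l. \<beta> ^ l * sumz J r (d + int l)) sums tailw J r \<beta> d"
proof -
  let ?S = "{s. s \<le> card J \<and> d \<le> int s}" let ?f = "\<lambda>s. nat (int s - d)"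
  have "(\<lambda>l. \<beta> ^ l * sumz J r (d + int l)) sums (\<Sum>l\<in>?f ` ?S. \<beta> ^ l * sumz J r (d + int l))"
  proof (rule sums_finite)
    fix l assume l: "l \<notin> ?f ` ?S"
    show "\<beta> ^ l * sumz J r (d + int l) = 0"
    proof (cases "0 \<le> d + int l")
      case True
      have "card J < nat (d + int l)"
      proof (rule ccontr)
        assume "\<not> ?thesis"
        hence "nat (d + int l) \<in> ?S" using True by auto
        moreover have "l = ?f (nat (d + int l))" using True by simp
        ultimately show False using l by blast
      qed
      thus ?thesis using sumw_eq_0[OF assms] by (simp add: sumz_def)
    qed (simp add: sumz_def)
  qed simp
  also have "(\<Sum>l\<in>?f ` ?S. \<beta> ^ l * sumz J r (d + int l)) = (\<Sum>s\<in>?S. \<beta> ^ ?f s * sumz J r (d + int (?f s)))"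
    by (subst sum.reindex) (auto intro!: inj_onI)
  also have "\<dots> = (\<Sum>s\<in>?S. sumw J r s * \<beta> ^ nat (int s - d))"
    by (intro sum.cong) (auto simp: sumz_def)
  also have "\<dots> = (\<Sum>s\<le>card J. if d \<le> int s then sumw J r s * \<beta> ^ nat (int s - d) else 0)"
    by (subst sum.inter_filter[symmetric]) (auto intro!: sum.cong)
  also have "\<dots> = tailw J r \<beta> d" unfolding tailw_def by (intro sum.cong) auto
  finally show ?thesis .
qed

lemma Phi_eq_integral: "Phi z = (LINT x|std_normal_distribution. (if x \<le> z then 1 else 0))"
proof -
  have "Phi z = (LINT x|std_normal_distribution. indicator {..z} x)"
    by (simp add: cdf_def)
  also have "\<dots> = (LINT x|std_normal_distribution. (if x \<le> z then 1 else 0))"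
    by (intro Bochner_Integration.integral_cong) (auto simp: indicator_def)
  finally show ?thesis .
qed

lemma std_normal_singleton: "emeasure std_normal_distribution {x} = 0"
  by (subst emeasure_density) (auto simp: nn_integral_indicator_singleton)

lemma isCont_Phi: "isCont Phi x"
proof -
  interpret real_distribution std_normal_distribution by (rule real_dist_normal_dist)
  show ?thesis using std_normal_singleton[of x] by (simp add: isCont_cdf measure_def)
qed

lemma Phi_measurable [measurable]: "Phi \<in> borel_measurable borel"
  by (intro borel_measurable_continuous_onI continuous_at_imp_continuous_on) (simp add: isCont_Phi)

context block_array begin

text \<open>The weights \<open>g n\<close> vary with \<open>n\<close> and converge only along
  sequences of integers, so weak convergence against a fixed test function does not apply directly.
  A Skorohod representation turns it into pointwise convergence, after which \<open>g\<close>
  applies at each sample point and bounded convergence finishes.\<close>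

theorem weighted_clt:
  fixes g :: "nat \<Rightarrow> int \<Rightarrow> real"
  assumes g: "\<And>u v. (\<lambda>n. (real_of_int (u n) - mean n) / sqrt n) \<longlonglongrightarrow> v \<Longrightarrow> (\<lambda>n. g n (u n)) \<longlonglongrightarrow> G v"
    and bound: "eventually (\<lambda>n. \<forall>u. \<bar>g n u\<bar> \<le> C) sequentially"
    and z: "(\<lambda>n. (zs n - mean n) / sqrt n) \<longlonglongrightarrow> z"
    and [measurable]: "G \<in> borel_measurable borel"
  shows "(\<lambda>n. \<Sum>u\<le>card (idx n). sumw (idx n) (prb n) u * (if real u \<le> zs n then g n (int u) else 0))
    \<longlonglongrightarrow> (LINT x|std_normal_distribution. (if x \<le> z / sd then G (sd * x) else 0))"
proof -
  obtain \<Omega> :: "real measure" and Ys Y where \<Omega>: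
    "prob_space \<Omega>" "\<And>n. Ys n \<in> borel_measurable \<Omega>" "\<And>n. distr \<Omega> borel (Ys n) = distr_nrm n"
    "Y \<in> measurable \<Omega> lborel" "distr \<Omega> borel Y = std_normal_distribution"
    "\<And>\<omega>. \<omega> \<in> space \<Omega> \<Longrightarrow> (\<lambda>n. Ys n \<omega>) \<longlonglongrightarrow> Y \<omega>"
    using Skorohod[OF real_distribution_nrm real_dist_normal_dist clt] by blast
  interpret prob_space \<Omega> by fact
  have [measurable]: "Y \<in> borel_measurable \<Omega>" using \<Omega>(4) by simp
  note [measurable] = \<Omega>(2)
  \<comment> \<open>Inverts \<open>nrm\<close> by rounding to the nearest integer. The variables
    \<open>Ys n\<close> need not take lattice values at every sample point, while \<open>g n\<close>
    is defined only at integers.\<close>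
  define U where "U n v = \<lfloor>mean n + sd * sqrt n * v + 1 / 2\<rfloor>" for n :: nat and v
  define f where "f n v = (if v \<le> (zs n - mean n) / sqrt n / sd then g n (U n v) else 0)" for n :: nat and v
  have [measurable]: "f n \<in> borel_measurable borel" for n
    unfolding f_def U_def by measurable
  have U_nrm: "U n (nrm n x) = int (tot (idx n) x)" if "0 < n" for n x
    using that sd_pos by (simp add: U_def nrm_def floor_eq_iff)
  have le_nrm: "nrm n x \<le> (zs n - mean n) / sqrt n / sd \<longleftrightarrow> real (tot (idx n) x) \<le> zs n" if "0 < n" for n x
    using that sd_pos by (simp add: nrm_def field_simps)
  have eq: "(\<Sum>u\<le>card (idx n). sumw (idx n) (prb n) u * (if real u \<le> zs n then g n (int u) else 0)) =
     (LINT \<omega>|\<Omega>. f n (Ys n \<omega>))" if "0 < n" for n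
  proof -
    have "(\<Sum>u\<le>card (idx n). sumw (idx n) (prb n) u * (if real u \<le> zs n then g n (int u) else 0)) =
        measure_pmf.expectation (bvec (idx n) (prb n)) (\<lambda>x. if real (tot (idx n) x) \<le> zs n then g n (int (tot (idx n) x)) else 0)"
      by (subst expectation_tot[where f="\<lambda>u. if real u \<le> zs n then g n (int u) else 0"]) simp
    also have "\<dots> = measure_pmf.expectation (bvec (idx n) (prb n)) (\<lambda>x. f n (nrm n x))"
      unfolding f_def le_nrm[OF that] U_nrm[OF that] ..
    also have "\<dots> = (LINT v|distr_nrm n. f n v)"
      unfolding distr_nrm_def by (subst integral_distr) auto
    also have "\<dots> = (LINT \<omega>|\<Omega>. f n (Ys n \<omega>))"
      unfolding \<Omega>(3)[symmetric] by (subst integral_distr) auto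
    finally show ?thesis .
  qed
  obtain N where N: "\<And>n u. n \<ge> N \<Longrightarrow> \<bar>g n u\<bar> \<le> C"
    using bound by (auto simp: eventually_sequentially)
  have C: "0 \<le> C" using N[of N 0] by simp
  let ?F = "\<lambda>x. if x \<le> z / sd then G (sd * x) else 0"
  have "(\<lambda>n. LINT \<omega>|\<Omega>. f (n + N) (Ys (n + N) \<omega>)) \<longlonglongrightarrow> (LINT \<omega>|\<Omega>. ?F (Y \<omega>))"
  proof (rule integral_dominated_convergence[where w="\<lambda>_. C"])
    \<comment> \<open>The cut-off indicator jumps at \<open>z / sd\<close>; the limit variable
      avoids this point almost surely.\<close>
    have "emeasure \<Omega> (Y -` {z / sd} \<inter> space \<Omega>) = emeasure std_normal_distribution {z / sd}"
      unfolding \<Omega>(5)[symmetric] by (subst emeasure_distr) auto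
    hence "AE \<omega> in \<Omega>. Y \<omega> \<noteq> z / sd"
      by (intro AE_I[of _ _ "Y -` {z / sd} \<inter> space \<Omega>"]) (auto simp: std_normal_singleton)
    thus "AE \<omega> in \<Omega>. (\<lambda>n. f (n + N) (Ys (n + N) \<omega>)) \<longlonglongrightarrow> ?F (Y \<omega>)"
    proof (rule AE_mp, intro AE_I2 impI)
      fix \<omega> assume \<omega>: "\<omega> \<in> space \<Omega>" and ne: "Y \<omega> \<noteq> z / sd"
      note lim = \<Omega>(6)[OF \<omega>]
      have zlim: "(\<lambda>n. (zs n - mean n) / sqrt n / sd) \<longlonglongrightarrow> z / sd"
        using sd_pos by (intro tendsto_divide z tendsto_const) auto
      have "(\<lambda>n. f n (Ys n \<omega>)) \<longlonglongrightarrow> ?F (Y \<omega>)"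
      proof (cases "Y \<omega> < z / sd")
        case True
        have "(\<lambda>n. (zs n - mean n) / sqrt n / sd - Ys n \<omega>) \<longlonglongrightarrow> z / sd - Y \<omega>" by (intro tendsto_diff zlim lim)
        hence "eventually (\<lambda>n. 0 < (zs n - mean n) / sqrt n / sd - Ys n \<omega>) sequentially"
          by (rule order_tendstoD) (use True in simp)
        hence ev: "eventually (\<lambda>n. g n (U n (Ys n \<omega>)) = f n (Ys n \<omega>)) sequentially"
          by eventually_elim (auto simp: f_def)
        have "(\<lambda>n. g n (U n (Ys n \<omega>))) \<longlonglongrightarrow> G (sd * Y \<omega>)"
        proof (rule g)
          have "(\<lambda>n. (real_of_int (U n (Ys n \<omega>)) - mean n) / sqrt n - sd * Ys n \<omega>) \<longlonglongrightarrow> 0"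
          proof (rule Lim_null_comparison)
            show "eventually (\<lambda>n. norm ((real_of_int (U n (Ys n \<omega>)) - mean n) / sqrt n - sd * Ys n \<omega>) \<le> 1 / sqrt n) sequentially"
              using eventually_gt_at_top[of "0 :: nat"]
            proof eventually_elim
              case (elim n)
              let ?y = "mean n + sd * sqrt n * Ys n \<omega>"
              have "(real_of_int (U n (Ys n \<omega>)) - mean n) / sqrt n - sd * Ys n \<omega> = (real_of_int \<lfloor>?y + 1 / 2\<rfloor> - ?y) / sqrt n"
                using elim by (simp add: U_def field_simps)
              moreover have "\<bar>real_of_int \<lfloor>?y + 1 / 2\<rfloor> - ?y\<bar> \<le> 1" by linarith
              ultimately show ?case by (simp add: abs_divide divide_right_mono)
            qed
            show "(\<lambda>n. 1 / sqrt (real n)) \<longlonglongrightarrow> 0" by real_asymp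
          qed
          from tendsto_add[OF this tendsto_mult_left[OF lim, of sd]]
          show "(\<lambda>n. (real_of_int (U n (Ys n \<omega>)) - mean n) / sqrt n) \<longlonglongrightarrow> sd * Y \<omega>" by simp
        qed
        with ev show ?thesis using True by (simp add: Lim_transform_eventually)
      next
        case False
        have "(\<lambda>n. (zs n - mean n) / sqrt n / sd - Ys n \<omega>) \<longlonglongrightarrow> z / sd - Y \<omega>" by (intro tendsto_diff zlim lim)
        hence "eventually (\<lambda>n. (zs n - mean n) / sqrt n / sd - Ys n \<omega> < 0) sequentially"
          by (rule order_tendstoD) (use False ne in simp)
        hence "eventually (\<lambda>n. 0 = f n (Ys n \<omega>)) sequentially"
          by eventually_elim (auto simp: f_def)
        hence "(\<lambda>n. f n (Ys n \<omega>)) \<longlonglongrightarrow> 0" by (rule Lim_transform_eventually[OF tendsto_const])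
        thus ?thesis using False ne by simp
      qed
      thus "(\<lambda>n. f (n + N) (Ys (n + N) \<omega>)) \<longlonglongrightarrow> ?F (Y \<omega>)"
        by (rule LIMSEQ_ignore_initial_segment)
    qed
    show "AE \<omega> in \<Omega>. norm (f (n + N) (Ys (n + N) \<omega>)) \<le> C" for n
      using N[of "n + N"] C by (intro AE_I2) (auto simp: f_def)
  qed simp_all
  hence "(\<lambda>n. LINT \<omega>|\<Omega>. f n (Ys n \<omega>)) \<longlonglongrightarrow> (LINT \<omega>|\<Omega>. ?F (Y \<omega>))"
    by (rule LIMSEQ_offset)
  moreover have "eventually (\<lambda>n. (LINT \<omega>|\<Omega>. f n (Ys n \<omega>)) =
      (\<Sum>u\<le>card (idx n). sumw (idx n) (prb n) u * (if real u \<le> zs n then g n (int u) else 0))) sequentially"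
    using eventually_gt_at_top[of "0 :: nat"] by eventually_elim (simp only: eq)
  ultimately have "(\<lambda>n. \<Sum>u\<le>card (idx n). sumw (idx n) (prb n) u * (if real u \<le> zs n then g n (int u) else 0))
      \<longlonglongrightarrow> (LINT \<omega>|\<Omega>. ?F (Y \<omega>))"
    by (rule Lim_transform_eventually)
  also have "(LINT \<omega>|\<Omega>. ?F (Y \<omega>)) = (LINT x|std_normal_distribution. ?F x)"
    unfolding \<Omega>(5)[symmetric] by (subst integral_distr) auto
  finally show ?thesis .
qed

lemma sum_le_eq_prob:
  "(\<Sum>u\<le>card (idx n). sumw (idx n) (prb n) u * (if real u \<le> z then 1 else 0)) =
     Pr (bvec (idx n) (prb n)) {x. real (tot (idx n) x) \<le> z}"
proof -
  have "Pr (bvec (idx n) (prb n)) {x. real (tot (idx n) x) \<le> z} =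
      measure_pmf.expectation (bvec (idx n) (prb n)) (indicator {x. real (tot (idx n) x) \<le> z})" by simp
  also have "indicator {x. real (tot (idx n) x) \<le> z} = (\<lambda>x. if real (tot (idx n) x) \<le> z then 1 else 0 :: real)"
    by (auto simp: indicator_def)
  also have "measure_pmf.expectation (bvec (idx n) (prb n)) \<dots> =
      (\<Sum>u\<le>card (idx n). sumw (idx n) (prb n) u * (if real u \<le> z then 1 else 0))"
    by (subst expectation_tot[where f="\<lambda>u. if real u \<le> z then 1 else 0"]) simp
  finally show ?thesis ..
qed

lemma prob_tot_tendsto:
  assumes "(\<lambda>n. (zs n - mean n) / sqrt n) \<longlonglongrightarrow> z"
  shows "(\<lambda>n. Pr (bvec (idx n) (prb n)) {x. real (tot (idx n) x) \<le> zs n}) \<longlonglongrightarrow> Phi (z / sd)"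
  unfolding sum_le_eq_prob[symmetric] Phi_eq_integral
  by (rule weighted_clt[where G="\<lambda>_. 1" and C=1]) (use assms in auto)

lemma tailw_1:
  "tailw (idx n) (prb n) 1 d =
     1 - Pr (bvec (idx n) (prb n)) {x. real (tot (idx n) x) \<le> of_int d - 1}"
proof -
  have "tailw (idx n) (prb n) 1 d = (\<Sum>s\<le>card (idx n). sumw (idx n) (prb n) s -
      sumw (idx n) (prb n) s * (if real s \<le> of_int d - 1 then 1 else 0))"
    unfolding tailw_def
  proof (intro sum.cong refl)
    fix s
    have "d \<le> int s \<longleftrightarrow> \<not> real s \<le> of_int d - 1" by linarith
    thus "sumw (idx n) (prb n) s * (if d \<le> int s then 1 ^ nat (int s - d) else 0) =
      sumw (idx n) (prb n) s - sumw (idx n) (prb n) s * (if real s \<le> of_int d - 1 then 1 else 0)" by simp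
  qed
  thus ?thesis by (simp only: sum_subtractf sum_sumw[OF finite_idx] sum_le_eq_prob)
qed

lemma tailw_1_tendsto:
  assumes "(\<lambda>n. (real_of_int (d n) - mean n) / sqrt n) \<longlonglongrightarrow> y"
  shows "(\<lambda>n. tailw (idx n) (prb n) 1 (d n)) \<longlonglongrightarrow> 1 - Phi (y / sd)"
  unfolding tailw_1
proof (intro tendsto_diff tendsto_const prob_tot_tendsto)
  \<comment> \<open>The complement of \<open>d \<le> s\<close> among integers is
    \<open>s \<le> d - 1\<close>; the shift by one vanishes on the scale of the square root of
    \<open>n\<close>.\<close>
  have "(\<lambda>n. 1 / sqrt (real n)) \<longlonglongrightarrow> 0" by real_asymp
  from tendsto_diff[OF assms this] show "(\<lambda>n. (real_of_int (d n) - 1 - mean n) / sqrt n) \<longlonglongrightarrow> y"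
    by (simp add: diff_divide_distrib add_divide_distrib algebra_simps)
qed

lemma tailw_1_bound: "\<bar>tailw (idx n) (prb n) 1 d\<bar> \<le> 1"
  unfolding tailw_1 by simp

lemma tailw_less_1_bound:
  assumes \<beta>: "0 < \<beta>" "\<beta> < 1"
  obtains C where "eventually (\<lambda>n. \<forall>d. \<bar>sqrt n * tailw (idx n) (prb n) \<beta> d\<bar> \<le> C) sequentially"
proof -
  obtain C where C: "0 < C" "eventually (\<lambda>n. \<forall>k. sqrt n * sumz (idx n) (prb n) k \<le> C) sequentially"
    by (rule sumz_bound)
  from C(2) have "eventually (\<lambda>n. \<forall>d. \<bar>sqrt n * tailw (idx n) (prb n) \<beta> d\<bar> \<le> C / (1 - \<beta>)) sequentially"
  proof (eventually_elim, intro allI)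
    fix n d assume n: "\<forall>k. sqrt n * sumz (idx n) (prb n) k \<le> C"
    have s1: "(\<lambda>l. sqrt n * (\<beta> ^ l * sumz (idx n) (prb n) (d + int l))) sums (sqrt n * tailw (idx n) (prb n) \<beta> d)"
      by (intro sums_mult tailw_sums) simp
    have s2: "(\<lambda>l. C * \<beta> ^ l) sums (C * (1 / (1 - \<beta>)))"
      using \<beta> by (intro sums_mult geometric_sums) auto
    have "sqrt n * tailw (idx n) (prb n) \<beta> d \<le> C * (1 / (1 - \<beta>))"
    proof (rule sums_le[OF _ s1 s2])
      fix l
      have "\<beta> ^ l * (sqrt n * sumz (idx n) (prb n) (d + int l)) \<le> \<beta> ^ l * C"
        using n \<beta> by (intro mult_left_mono) auto
      thus "sqrt n * (\<beta> ^ l * sumz (idx n) (prb n) (d + int l)) \<le> C * \<beta> ^ l" by (simp add: mult_ac)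
    qed
    moreover have "0 \<le> tailw (idx n) (prb n) \<beta> d"
      unfolding tailw_def using \<beta> by (intro sum_nonneg mult_nonneg_nonneg sumw_nonneg) auto
    ultimately show "\<bar>sqrt n * tailw (idx n) (prb n) \<beta> d\<bar> \<le> C / (1 - \<beta>)" by simp
  qed
  thus ?thesis by (rule that)
qed

text \<open>For a fixed excess \<open>l\<close> the shift by \<open>l\<close> is invisible on the
  scale of the square root of \<open>n\<close>, so each term has the same local limit up to the
  factor \<open>\<beta> ^ l\<close>. Tannery's theorem sums the terms, and the geometric series
  gives \<open>1 / (1 - \<beta>)\<close>.\<close>

lemma tailw_less_1_tendsto:
  assumes \<beta>: "0 < \<beta>" "\<beta> < 1" and d: "(\<lambda>n. (real_of_int (d n) - mean n) / sqrt n) \<longlonglongrightarrow> y"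
  shows "(\<lambda>n. sqrt n * tailw (idx n) (prb n) \<beta> (d n)) \<longlonglongrightarrow> normal_density 0 sd y / (1 - \<beta>)"
proof -
  obtain C where C: "0 < C" "eventually (\<lambda>n. \<forall>k. sqrt n * sumz (idx n) (prb n) k \<le> C) sequentially"
    by (rule sumz_bound)
  have nonneg: "0 \<le> sumz J r k" for J :: "nat set" and r k by (simp add: sumz_def sumw_nonneg)
  let ?a = "\<lambda>l n. \<beta> ^ l * (sqrt n * sumz (idx n) (prb n) (d n + int l))"
  have "(\<lambda>n. \<Sum>l. ?a l n) \<longlonglongrightarrow> (\<Sum>l. \<beta> ^ l * normal_density 0 sd y)"
  proof (rule tannerys_theorem[where M = "\<lambda>l. \<beta> ^ l * C", THEN conjunct2, THEN conjunct2])
    fix l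
    have "(\<lambda>n. real l / sqrt (real n)) \<longlonglongrightarrow> 0" by real_asymp
    from tendsto_add[OF d this] have "(\<lambda>n. (real_of_int (d n + int l) - mean n) / sqrt n) \<longlonglongrightarrow> y"
      by (simp add: add_divide_distrib diff_divide_distrib algebra_simps)
    thus "(\<lambda>n. ?a l n) \<longlonglongrightarrow> \<beta> ^ l * normal_density 0 sd y"
      by (intro tendsto_mult tendsto_const local_limit)
  next
    show "eventually (\<lambda>(l, n). norm (?a l n) \<le> \<beta> ^ l * C) (at_top \<times>\<^sub>F sequentially)"
    proof -
      have "eventually (\<lambda>x. True \<and> (\<forall>k. sqrt (snd x) * sumz (idx (snd x)) (prb (snd x)) k \<le> C))
          ((at_top :: nat filter) \<times>\<^sub>F sequentially)"
        by (rule eventually_prodI[OF _ C(2)]) simp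
      thus ?thesis
        by eventually_elim (use \<beta> nonneg in \<open>auto simp: case_prod_unfold abs_mult\<close>)
    qed
    show "summable (\<lambda>l. \<beta> ^ l * C)" using \<beta> by (intro summable_mult2 summable_geometric) auto
  qed simp
  moreover have "(\<Sum>l. ?a l n) = sqrt n * tailw (idx n) (prb n) \<beta> (d n)" for n
  proof -
    have "(\<lambda>l. sqrt n * (\<beta> ^ l * sumz (idx n) (prb n) (d n + int l))) sums (sqrt n * tailw (idx n) (prb n) \<beta> (d n))"
      by (intro sums_mult tailw_sums) simp
    thus ?thesis by (simp add: sums_iff mult_ac)
  qed
  moreover have "(\<Sum>l. \<beta> ^ l * normal_density 0 sd y) = normal_density 0 sd y / (1 - \<beta>)"
    using \<beta> by (subst suminf_mult2[symmetric]) (auto simp: suminf_geometric)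
  ultimately show ?thesis by simp
qed

end

section \<open>Splitting the index set\<close>

definition glue :: "'a set \<Rightarrow> ('a \<Rightarrow> bool) \<Rightarrow> ('a \<Rightarrow> bool) \<Rightarrow> 'a \<Rightarrow> bool" where
  "glue I f g = (\<lambda>x. if x \<in> I then f x else g x)"

lemma glue_mono: "f \<le> f' \<Longrightarrow> g \<le> g' \<Longrightarrow> glue I f g \<le> glue I f' g'"
  by (auto simp: glue_def le_fun_def)

lemma tot_glue:
  "tot I (glue I f g) = tot I f" "I \<inter> I' = {} \<Longrightarrow> tot I' (glue I f g) = tot I' g"
  by (auto simp: tot_def glue_def intro!: arg_cong[where f=card])

lemma tot_Un:
  assumes "finite I" "finite I'" "I \<inter> I' = {}"
  shows "tot (I \<union> I') x = tot I x + tot I' x"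
  using assms by (simp add: tot_eq_sum sum.union_disjoint del: sum_of_bool_eq)

lemma bvec_Un:
  assumes "finite I" "finite I'" "I \<inter> I' = {}"
  shows "bvec (I \<union> I') r = map_pmf (\<lambda>(f, g). glue I f g) (pair_pmf (bvec I r) (bvec I' r))"
  unfolding bvec_def glue_def by (rule Pi_pmf_union[OF assms])

lemma prob_reweight:
  assumes "\<And>x. pmf \<mu> x = f x * pmf \<nu> x"
  shows "Pr \<mu> S = measure_pmf.expectation \<nu> (\<lambda>x. f x * indicator S x)"
  unfolding pmf_expectation_eq_infsetsum measure_pmf_conv_infsetsum
  by (rule infsetsum_cong_neutral) (auto simp: assms indicator_def)

lemma expectation_two_tots:
  fixes F :: "nat \<Rightarrow> nat \<Rightarrow> real"
  assumes "finite I" "finite I'" "I \<inter> I' = {}"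
  shows "measure_pmf.expectation (bvec (I \<union> I') r) (\<lambda>x. F (tot I x) (tot I' x)) =
    (\<Sum>u\<le>card I. \<Sum>s\<le>card I'. sumw I r u * sumw I' r s * F u s)"
proof -
  have "measure_pmf.expectation (bvec (I \<union> I') r) (\<lambda>x. F (tot I x) (tot I' x)) =
      measure_pmf.expectation (pair_pmf (bvec I r) (bvec I' r)) (\<lambda>(f, g). F (tot I f) (tot I' g))"
    using assms(3) by (simp add: bvec_Un[OF assms] case_prod_unfold tot_glue)
  also have "\<dots> = measure_pmf.expectation (map_pmf (\<lambda>(f, g). (tot I f, tot I' g)) (pair_pmf (bvec I r) (bvec I' r))) (\<lambda>(u, s). F u s)"
    by (simp add: case_prod_unfold)
  also have "map_pmf (\<lambda>(f, g). (tot I f, tot I' g)) (pair_pmf (bvec I r) (bvec I' r)) =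
      pair_pmf (map_pmf (tot I) (bvec I r)) (map_pmf (tot I') (bvec I' r))"
    by (rule map_pair)
  also have "measure_pmf.expectation \<dots> (\<lambda>(u, s). F u s) =
      (\<Sum>(u, s)\<in>{..card I} \<times> {..card I'}. sumw I r u * sumw I' r s * F u s)"
    using tot_le_card[OF assms(1)] tot_le_card[OF assms(2)]
    by (subst integral_measure_pmf[of "{..card I} \<times> {..card I'}"])
       (auto simp: pmf_pair sumw_def intro!: sum.cong)
  finally show ?thesis by (simp add: sum.cartesian_product)
qed

text \<open>An exact formula free of exponentially small quantities: on the conditioning event
  \<beta> to the total is \<open>\<beta> ^ k\<close> times \<beta> to the excess over
  \<open>k\<close>, and both \<open>\<beta> ^ k\<close> and the normalisation \<open>Z\<close> of
  the tilt cancel in the quotient. Independence then splits the excess weight into the total over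
  \<open>I\<close> and a tail over \<open>I'\<close>.\<close>

lemma prob_cond_tot_le:
  assumes J: "unit_probs (I \<union> I') r" "I \<inter> I' = {}" and \<beta>: "0 < \<beta>" and k: "k \<le> card (I \<union> I')"
  shows "Pr (cond_pmf (bvec (I \<union> I') (\<lambda>j. tilt \<beta> (r j))) (at_least (I \<union> I') k)) {x. real (tot I x) \<le> z} =
    (\<Sum>u\<le>card I. sumw I r u * (if real u \<le> z then tailw I' r \<beta> (int k - int u) else 0)) /
      tailw (I \<union> I') r \<beta> (int k)"
proof -
  let ?J = "I \<union> I'"
  have fin: "finite I" "finite I'" using unit_probs_finite[OF J(1)] by auto
  define Z where "Z = (\<Prod>j\<in>?J. 1 - r j + \<beta> * r j)"
  have Z: "0 < Z" unfolding Z_def by (rule prod_denom_pos[OF J(1) \<beta>])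
  define w where "w d = (if (k::nat) \<le> d then \<beta> ^ (d - k) else 0)" for d
  have reweight: "Pr (bvec ?J (\<lambda>j. tilt \<beta> (r j))) (at_least ?J k \<inter> S) =
      \<beta> ^ k / Z * measure_pmf.expectation (bvec ?J r) (\<lambda>x. w (tot ?J x) * indicator S x)" for S
  proof -
    have "Pr (bvec ?J (\<lambda>j. tilt \<beta> (r j))) (at_least ?J k \<inter> S) =
        measure_pmf.expectation (bvec ?J r) (\<lambda>x. \<beta> ^ tot ?J x / Z * indicator (at_least ?J k \<inter> S) x)"
      by (rule prob_reweight) (simp add: pmf_bvec_tilt[OF J(1) \<beta>] Z_def)
    also have "(\<lambda>x. \<beta> ^ tot ?J x / Z * indicator (at_least ?J k \<inter> S) x) = (\<lambda>x. \<beta> ^ k / Z * (w (tot ?J x) * indicator S x))"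
      by (auto simp: w_def at_least_def indicator_def fun_eq_iff simp flip: power_add)
    finally show ?thesis by simp
  qed
  have "measure_pmf.expectation (bvec ?J r) (\<lambda>x. w (tot ?J x) * indicator {x. real (tot I x) \<le> z} x) =
      measure_pmf.expectation (bvec ?J r) (\<lambda>x. if real (tot I x) \<le> z then w (tot I x + tot I' x) else 0)"
    by (intro Bochner_Integration.integral_cong) (auto simp: tot_Un[OF fin J(2)] indicator_def)
  also have "\<dots> = (\<Sum>u\<le>card I. \<Sum>s\<le>card I'. sumw I r u * sumw I' r s * (if real u \<le> z then w (u + s) else 0))"
    by (rule expectation_two_tots[OF fin J(2)])
  also have "\<dots> = (\<Sum>u\<le>card I. sumw I r u * (if real u \<le> z then tailw I' r \<beta> (int k - int u) else 0))"
  proof (intro sum.cong refl)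
    fix u
    have "w (u + s) = (if int k - int u \<le> int s then \<beta> ^ nat (int s - (int k - int u)) else 0)" for s
    proof -
      have "nat (int s - (int k - int u)) = u + s - k" by linarith
      thus ?thesis by (simp add: w_def)
    qed
    thus "(\<Sum>s\<le>card I'. sumw I r u * sumw I' r s * (if real u \<le> z then w (u + s) else 0)) =
      sumw I r u * (if real u \<le> z then tailw I' r \<beta> (int k - int u) else 0)"
      by (simp add: tailw_def sum_distrib_left mult.assoc)
  qed
  finally have num: "measure_pmf.expectation (bvec ?J r) (\<lambda>x. w (tot ?J x) * indicator {x. real (tot I x) \<le> z} x) = \<dots>" .
  have "measure_pmf.expectation (bvec ?J r) (\<lambda>x. w (tot ?J x) * indicator UNIV x) =
      measure_pmf.expectation (map_pmf (tot ?J) (bvec ?J r)) w" by simp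
  also have "\<dots> = (\<Sum>s\<le>card ?J. sumw ?J r s * w s)"
    using tot_le_card[of ?J] fin by (subst integral_measure_pmf[of "{..card ?J}"]) (auto simp: sumw_def)
  also have "\<dots> = tailw ?J r \<beta> (int k)"
    unfolding tailw_def by (intro sum.cong refl) (simp add: w_def nat_diff_distrib)
  finally have den: "measure_pmf.expectation (bvec ?J r) (\<lambda>x. w (tot ?J x) * indicator UNIV x) = \<dots>" .
  have ne: "set_pmf (bvec ?J (\<lambda>j. tilt \<beta> (r j))) \<inter> at_least ?J k \<noteq> {}"
    by (rule at_least_nonempty[OF unit_probs_tilt[OF J(1) \<beta>] k])
  show ?thesis
    unfolding prob_cond_pmf[OF ne] reweight num using reweight[of UNIV] den Z \<beta>
    by simp
qed

section \<open>Coupling through the totals over \<open>I\<close>\<close>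

lemma level_tilt:
  assumes J: "unit_probs J q" "0 < \<beta>" "\<And>j. j \<in> J \<Longrightarrow> p j = tilt \<beta> (q j)" and u: "u \<le> card J"
  shows "level J p u = level J q u"
proof -
  have eq: "bvec J p = bvec J (\<lambda>j. tilt \<beta> (q j))"
    unfolding bvec_def using assms(3) by (intro Pi_pmf_cong) auto
  show ?thesis
    unfolding level_def eq
  proof (rule cond_pmf_eqI)
    show "set_pmf (bvec J (\<lambda>j. tilt \<beta> (q j))) \<inter> {x. tot J x = u} \<noteq> {}"
      by (rule level_nonempty[OF unit_probs_tilt[OF J(1,2)] u])
    show "set_pmf (bvec J q) \<inter> {x. tot J x = u} \<noteq> {}"
      by (rule level_nonempty[OF J(1) u])
    show "pmf (bvec J (\<lambda>j. tilt \<beta> (q j))) x = \<beta> ^ u / (\<Prod>j\<in>J. 1 - q j + \<beta> * q j) * pmf (bvec J q) x"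
      if "x \<in> {x. tot J x = u}" for x
      using that by (simp add: pmf_bvec_tilt[OF J(1,2)])
  qed
qed

lemma bind_map_tot_level:
  assumes "unit_probs J r" shows "bvec J r = bind_pmf (map_pmf (tot J) (bvec J r)) (level J r)"
  by (rule bind_level[OF assms, of _ "\<lambda>_. 1"]) simp

lemma map_tot_bvec_Un:
  assumes "finite I" "finite I'" "I \<inter> I' = {}"
  shows "map_pmf (tot I) (bvec (I \<union> I') r) = map_pmf (tot I) (bvec I r)"
proof -
  have "map_pmf (tot I) (bvec (I \<union> I') r) = map_pmf (tot I) (map_pmf fst (pair_pmf (bvec I r) (bvec I' r)))"
    unfolding bvec_Un[OF assms] by (simp only: pmf.map_comp) (simp add: o_def case_prod_unfold tot_glue)
  thus ?thesis by (simp add: map_fst_pair_pmf)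
qed

text \<open>Given total \<open>u\<close> over \<open>I\<close>, the two parts are independent and
  the event only asks for \<open>k - u\<close> successes in \<open>I'\<close>. Subtraction on
  naturals is truncated, which is right here: for \<open>u \<ge> k\<close> no restriction
  remains.\<close>

lemma cond_at_least_decompose:
  assumes J: "unit_probs (I \<union> I') r" "I \<inter> I' = {}" and k: "k \<le> card (I \<union> I')"
  defines "\<mu> \<equiv> cond_pmf (bvec (I \<union> I') r) (at_least (I \<union> I') k)"
  shows "\<mu> = bind_pmf (map_pmf (tot I) \<mu>)
     (\<lambda>u. map_pmf (\<lambda>(f, g). glue I f g) (pair_pmf (level I r u) (cond_pmf (bvec I' r) (at_least I' (k - u)))))"
proof -
  let ?J = "I \<union> I'"
  have fin: "finite I" "finite I'" using unit_probs_finite[OF J(1)] by auto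
  note ne = at_least_nonempty[OF J(1) k]
  have "\<mu> = bind_pmf (map_pmf (tot I) \<mu>) (\<lambda>u. cond_pmf \<mu> {x. tot I x = u})"
    by (rule bind_cond_pmf_disintegrate)
  also have "\<dots> = bind_pmf (map_pmf (tot I) \<mu>)
     (\<lambda>u. map_pmf (\<lambda>(f, g). glue I f g) (pair_pmf (level I r u) (cond_pmf (bvec I' r) (at_least I' (k - u)))))"
  proof (rule bind_pmf_cong[OF refl])
    fix u assume "u \<in> set_pmf (map_pmf (tot I) \<mu>)"
    then obtain x where x: "x \<in> set_pmf (bvec ?J r)" "x \<in> at_least ?J k" "tot I x = u"
      using ne by (auto simp: \<mu>_def)
    let ?P = "pair_pmf (bvec I r) (bvec I' r)" and ?h = "\<lambda>(f, g). glue I f g"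
    let ?S = "at_least ?J k \<inter> {x. tot I x = u}"
    have B: "bvec ?J r = map_pmf ?h ?P" by (rule bvec_Un[OF fin J(2)])
    have vim: "?h -` ?S = {f. tot I f = u} \<times> at_least I' (k - u)"
      by (auto simp: tot_glue tot_Un[OF fin J(2)] J(2) at_least_def)
    have "\<exists>y\<in>set_pmf ?P. ?h y \<in> ?S" using x B by auto
    hence neP: "set_pmf ?P \<inter> ?h -` ?S \<noteq> {}" by blast
    hence ne2: "set_pmf (bvec I r) \<inter> {f. tot I f = u} \<noteq> {}" "set_pmf (bvec I' r) \<inter> at_least I' (k - u) \<noteq> {}"
      unfolding vim by auto
    have "cond_pmf \<mu> {x. tot I x = u} = cond_pmf (bvec ?J r) ?S"
      unfolding \<mu>_def by (rule cond_cond_pmf[OF ne]) (use x in blast)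
    also have "\<dots> = map_pmf ?h (cond_pmf ?P (?h -` ?S))"
      unfolding B by (rule cond_map_pmf[OF neP])
    also have "cond_pmf ?P (?h -` ?S) = pair_pmf (level I r u) (cond_pmf (bvec I' r) (at_least I' (k - u)))"
      unfolding vim level_def by (rule cond_pmf_pair_pmf[OF ne2])
    finally show "cond_pmf \<mu> {x. tot I x = u} = map_pmf ?h \<dots>" .
  qed
  finally show ?thesis .
qed

lemma coup_map:
  assumes "coup s A B" "\<And>x y. x \<le> y \<Longrightarrow> f x \<le> g y"
  shows "coup s (map_pmf f A) (map_pmf g B)"
proof -
  obtain w where w: "map_pmf fst w = A" "map_pmf snd w = B" "s \<le> Pr w {(u, v). u \<le> v}"
    using assms(1) by (auto simp: coup_def couplings_def)
  let ?w = "map_pmf (\<lambda>(x, y). (f x, g y)) w"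
  have "?w \<in> couplings (map_pmf f A) (map_pmf g B)"
    unfolding couplings_def w(1,2)[symmetric] by (simp add: pmf.map_comp o_def case_prod_unfold)
  moreover have "Pr w {(u, v). u \<le> v} \<le> Pr ?w {(u, v). u \<le> v}"
    unfolding measure_map_pmf using assms(2) by (intro measure_pmf.finite_measure_mono) auto
  ultimately show ?thesis using w(3) unfolding coup_def by (meson order_trans)
qed

text \<open>The parts on \<open>I\<close> can be ordered surely, so the failure probability comes
  from the other parts alone.\<close>

lemma coup_glue_pair:
  assumes L: "rel_pmf (\<le>) L L'" and s: "coup s A B" "0 \<le> s"
  shows "coup s (map_pmf (\<lambda>(f, g). glue I f g) (pair_pmf L A)) (map_pmf (\<lambda>(f, g). glue I f g) (pair_pmf L' B))"
proof -
  have eq: "map_pmf (\<lambda>(f, g). glue I f g) (pair_pmf L A) = bind_pmf L (\<lambda>f. map_pmf (glue I f) A)" for L A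
    by (simp add: pair_pmf_def map_bind_pmf map_pmf_def bind_assoc_pmf bind_return_pmf)
  obtain w where w: "\<And>x y. (x, y) \<in> set_pmf w \<Longrightarrow> x \<le> y" "map_pmf fst w = L" "map_pmf snd w = L'"
    using L by (cases rule: rel_pmf.cases) auto
  have "coup (s * Pr w UNIV) (bind_pmf L (\<lambda>f. map_pmf (glue I f) A)) (bind_pmf L' (\<lambda>f. map_pmf (glue I f) B))"
  proof (rule coup_bind[OF w(2,3) _ s(2)])
    fix u v assume "(u, v) \<in> set_pmf w"
    thus "coup s (map_pmf (glue I u) A) (map_pmf (glue I v) B)"
      by (intro coup_map[OF s(1)] glue_mono w(1)[of u v])
  qed
  thus ?thesis by (simp add: eq)
qed

text \<open>
  Couple the totals over \<open>I\<close> first. Given these, the parts in \<open>I\<close> have laws in the same monotone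
  family \<^const>\<open>level\<close>, and the parts in \<open>I'\<close> can be ordered with a probability close to 1.
\<close>

lemma coup_split:
  assumes J: "unit_probs (I \<union> I') p" "unit_probs (I \<union> I') q" "I \<inter> I' = {}"
    and \<beta>: "0 < \<beta>" "\<And>j. j \<in> I \<Longrightarrow> p j = tilt \<beta> (q j)"
    and t: "1 \<le> t" "\<And>j. j \<in> I' \<Longrightarrow> tilt t (p j) \<le> q j"
    and k: "k \<le> card (I \<union> I')" and d: "0 \<le> d" "d \<le> 1"
  defines "\<mu> \<equiv> cond_pmf (bvec (I \<union> I') p) (at_least (I \<union> I') k)"
  assumes cdf: "\<And>z. Pr (bvec I q) {x. tot I x \<le> z} \<le> Pr \<mu> {x. tot I x \<le> z} + d"
  shows "coup (Pr (bvec I' (\<lambda>j. tilt t (p j))) (at_least I' (k - m)) *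
      (1 - d - Pr \<mu> {x. tot I x < m})) \<mu> (bvec (I \<union> I') q)"
proof -
  let ?J = "I \<union> I'" and ?h = "\<lambda>(f, g). glue I f g"
  have fin: "finite I" "finite I'" using unit_probs_finite[OF J(1)] by auto
  have I: "unit_probs I p" "unit_probs I q" "unit_probs I' p" "unit_probs I' q"
    using unit_probs_subset[OF J(1)] unit_probs_subset[OF J(2)] by auto
  define s where "s = Pr (bvec I' (\<lambda>j. tilt t (p j))) (at_least I' (k - m))"
  have "coup (1 - d) (map_pmf (tot I) \<mu>) (map_pmf (tot I) (bvec I q))"
    using cdf d tot_le_card[OF fin(1)]
    by (intro coup_nat[of d _ "card I"]) (auto simp: vimage_def)
  then obtain w where w: "map_pmf fst w = map_pmf (tot I) \<mu>" "map_pmf snd w = map_pmf (tot I) (bvec I q)"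
      "1 - d \<le> Pr w {(u, v). u \<le> v}"
    by (auto simp: coup_def couplings_def)
  \<comment> \<open>The cut-off \<open>m \<le> u\<close> keeps the requirement \<open>k - u\<close>
    on \<open>I'\<close> below \<open>k - m\<close>, which makes the success probability
    \<open>s\<close> uniform over the good pairs.\<close>
  let ?G = "{(u, v). u \<le> v \<and> m \<le> u}"
  note ne = at_least_nonempty[OF J(1) k]
  have coup: "coup (s * Pr w ?G)
     (bind_pmf (map_pmf (tot I) \<mu>) (\<lambda>u. map_pmf ?h (pair_pmf (level I p u) (cond_pmf (bvec I' p) (at_least I' (k - u))))))
     (bind_pmf (map_pmf (tot I) (bvec I q)) (\<lambda>v. map_pmf ?h (pair_pmf (level I q v) (bvec I' q))))"
  proof (rule coup_bind[OF w(1,2)])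
    fix u v assume uv: "(u, v) \<in> set_pmf w" "(u, v) \<in> ?G"
    have "u \<in> set_pmf (map_pmf fst w)" "v \<in> set_pmf (map_pmf snd w)" using uv(1) by force+
    then obtain x y where x: "x \<in> at_least ?J k" "tot I x = u" and y: "tot I y = v"
      unfolding w(1,2) \<mu>_def by (auto simp: set_cond_pmf[OF ne])
    have u: "u \<le> card I" and v: "v \<le> card I" using x y tot_le_card[OF fin(1)] by auto
    have ku: "k - u \<le> card I'"
      using x tot_le_card[OF fin(2), of x] by (auto simp: at_least_def tot_Un[OF fin J(3)])
    show "coup s (map_pmf ?h (pair_pmf (level I p u) (cond_pmf (bvec I' p) (at_least I' (k - u)))))
        (map_pmf ?h (pair_pmf (level I q v) (bvec I' q)))"
    proof (rule coup_glue_pair)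
      show "rel_pmf (\<le>) (level I p u) (level I q v)"
        using rel_pmf_level[OF I(2) _ v, of u] uv(2) by (simp add: level_tilt[OF I(2) \<beta> u])
      have "coup (Pr (bvec I' (\<lambda>j. tilt t (p j))) (at_least I' (k - u)))
          (cond_pmf (bvec I' p) (at_least I' (k - u))) (bvec I' q)"
        by (rule coup_at_least_tilt[OF I(3,4) t(1) ku t(2)])
      moreover have "s \<le> Pr (bvec I' (\<lambda>j. tilt t (p j))) (at_least I' (k - u))"
        unfolding s_def using uv(2) by (intro measure_pmf.finite_measure_mono) (auto simp: at_least_def)
      ultimately show "coup s (cond_pmf (bvec I' p) (at_least I' (k - u))) (bvec I' q)"
        by (rule coup_weaken)
    qed (simp add: s_def)
  qed (simp add: s_def)
  have eq1: "bind_pmf (map_pmf (tot I) \<mu>) (\<lambda>u. map_pmf ?h (pair_pmf (level I p u) (cond_pmf (bvec I' p) (at_least I' (k - u))))) = \<mu>"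
    unfolding \<mu>_def by (rule cond_at_least_decompose[OF J(1,3) k, symmetric])
  have eq2: "bind_pmf (map_pmf (tot I) (bvec I q)) (\<lambda>v. map_pmf ?h (pair_pmf (level I q v) (bvec I' q))) = bvec ?J q"
  proof -
    have "bvec ?J q = map_pmf ?h (pair_pmf (bind_pmf (map_pmf (tot I) (bvec I q)) (level I q)) (bvec I' q))"
      using bvec_Un[OF fin J(3), of q] bind_map_tot_level[OF I(2)] by simp
    also have "\<dots> = bind_pmf (map_pmf (tot I) (bvec I q)) (\<lambda>v. map_pmf ?h (pair_pmf (level I q v) (bvec I' q)))"
      by (simp add: pair_pmf_def map_bind_pmf bind_assoc_pmf)
    finally show ?thesis ..
  qed
  have le: "s * (1 - d - Pr \<mu> {x. tot I x < m}) \<le> s * Pr w ?G"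
  proof (rule mult_left_mono)
    have "Pr w {(u, v). u \<le> v} \<le> Pr w (?G \<union> {x. fst x < m})"
      by (intro measure_pmf.finite_measure_mono) auto
    also have "\<dots> \<le> Pr w ?G + Pr w {x. fst x < m}"
      by (rule measure_Un_le) auto
    also have "Pr w {x. fst x < m} = Pr (map_pmf fst w) {..<m}"
      by (simp add: vimage_def)
    also have "\<dots> = Pr \<mu> {x. tot I x < m}"
      unfolding w(1) by (simp add: vimage_def)
    finally show "1 - d - Pr \<mu> {x. tot I x < m} \<le> Pr w ?G" using w(3) by simp
  qed (simp add: s_def)
  show ?thesis
    using coup_weaken[OF coup le] unfolding eq1 eq2 unfolding s_def .
qed

section \<open>The limiting distribution functions\<close>

interpretation std_normal: real_distribution std_normal_distribution
  by (rule real_dist_normal_dist)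

lemma measure_std_normal_singleton: "measure std_normal_distribution {x} = 0"
  by (simp add: measure_def std_normal_singleton)

lemma integral_std_normal_indicator:
  fixes f :: "real \<Rightarrow> real"
  assumes [measurable]: "f \<in> borel_measurable borel"
  shows "(LINT x|std_normal_distribution. (if x \<le> w then f x else 0)) =
     (LINT x|lborel. indicator {..w} x * (std_normal_density x * f x))"
  by (subst integral_density) (auto intro!: Bochner_Integration.integral_cong simp: indicator_def)

lemma normal_cdf:
  assumes \<sigma>: "0 < \<sigma>"
  shows "(LINT x|lborel. indicator {..w} x * normal_density \<mu> \<sigma> x) = Phi ((w - \<mu>) / \<sigma>)"
proof -
  have "(LINT x|lborel. indicator {..w} x * normal_density \<mu> \<sigma> x) =
      \<bar>\<sigma>\<bar> *\<^sub>R (LINT x|lborel. indicator {..w} (\<mu> + \<sigma> * x) * normal_density \<mu> \<sigma> (\<mu> + \<sigma> * x))"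
    by (rule lborel_integral_real_affine) (use \<sigma> in simp)
  also have "\<dots> = (LINT x|lborel. \<sigma> * (indicator {..w} (\<mu> + \<sigma> * x) * normal_density \<mu> \<sigma> (\<mu> + \<sigma> * x)))"
    using \<sigma> by simp
  also have "\<dots> = (LINT x|lborel. indicator {..(w - \<mu>) / \<sigma>} x * (std_normal_density x * 1))"
  proof (intro Bochner_Integration.integral_cong refl)
    fix x
    have "indicator {..w} (\<mu> + \<sigma> * x) = (indicator {..(w - \<mu>) / \<sigma>} x :: real)"
      using \<sigma> by (auto simp: indicator_def field_simps)
    moreover have "\<sigma> * normal_density \<mu> \<sigma> (\<mu> + \<sigma> * x) = std_normal_density x"
      using \<sigma> by (simp add: normal_density_def power_mult_distrib real_sqrt_mult)
    ultimately show "\<sigma> * (indicator {..w} (\<mu> + \<sigma> * x) * normal_density \<mu> \<sigma> (\<mu> + \<sigma> * x)) =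
        indicator {..(w - \<mu>) / \<sigma>} x * (std_normal_density x * 1)"
      by (simp add: mult.left_commute)
  qed
  also have "\<dots> = Phi ((w - \<mu>) / \<sigma>)"
    unfolding Phi_eq_integral by (rule integral_std_normal_indicator[symmetric]) simp
  finally show ?thesis .
qed

lemma Phi_eq_lborel: "Phi w = (LINT x|lborel. indicator {..w} x * std_normal_density x)"
  using normal_cdf[where \<sigma> = 1 and w = w and \<mu> = 0] by simp

lemma Phi_minus: "Phi (- w) = 1 - Phi w"
proof -
  have "Phi (- w) = \<bar>- 1\<bar> *\<^sub>R (LINT x|lborel. indicator {..- w} (0 + - 1 * x) * std_normal_density (0 + - 1 * x))"
    unfolding Phi_eq_lborel by (rule lborel_integral_real_affine) simp
  also have "\<dots> = (LINT x|lborel. std_normal_density x *\<^sub>R indicator {w..} x)"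
    by (simp, intro Bochner_Integration.integral_cong) (auto simp: indicator_def std_normal_density_def)
  also have "\<dots> = (LINT x|std_normal_distribution. indicator {w..} x)"
    by (subst integral_density) auto
  also have "\<dots> = measure std_normal_distribution (space std_normal_distribution - {..<w})"
    by (simp add: Compl_eq_Diff_UNIV[symmetric] not_less Compl_lessThan)
  also have "\<dots> = 1 - measure std_normal_distribution {..<w}"
    by (rule std_normal.prob_compl) simp
  also have "measure std_normal_distribution {..<w} = Phi w"
  proof -
    have "measure std_normal_distribution ({..<w} \<union> {w}) = measure std_normal_distribution {..<w} + measure std_normal_distribution {w}"
      by (rule std_normal.finite_measure_Union) auto
    also have "{..<w} \<union> {w} = {..w}" by auto
    finally show ?thesis by (simp add: cdf_def measure_std_normal_singleton)
  qed
  finally show ?thesis .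
qed

lemma Phi_pos: "0 < Phi w"
proof -
  define m where "m = std_normal_density (\<bar>w\<bar> + 1)"
  have "0 < m" unfolding m_def by (rule normal_density_pos) simp
  also have "m = (LINT x|lborel. indicator {w - 1..w} x * m)" by simp
  also have "\<dots> \<le> (LINT x|lborel. indicator {..w} x * std_normal_density x)"
  proof (rule integral_mono)
    show "integrable lborel (\<lambda>x. indicator {..w} x * std_normal_density x)"
      by (rule Bochner_Integration.integrable_bound[OF integrable_normal_density[where \<mu> = 0 and \<sigma> = 1]]) (auto simp: indicator_def)
    fix x :: real
    have "m \<le> std_normal_density x" if "x \<in> {w - 1..w}"
    proof -
      have "\<bar>x\<bar> \<le> \<bar>\<bar>w\<bar> + 1\<bar>" using that by auto
      hence "x\<^sup>2 \<le> (\<bar>w\<bar> + 1)\<^sup>2" by (simp only: abs_le_square_iff)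
      thus ?thesis by (simp add: m_def std_normal_density_def divide_right_mono)
    qed
    thus "indicator {w - 1..w} x * m \<le> indicator {..w} x * std_normal_density x"
      by (auto simp: indicator_def)
  qed simp
  finally show ?thesis by (simp add: Phi_eq_lborel)
qed

lemma Phi_less_1: "Phi w < 1"
  using Phi_pos[of "- w"] by (simp add: Phi_minus)

lemma Phi_mono: "v \<le> w \<Longrightarrow> Phi v \<le> Phi w"
  by (rule std_normal.cdf_nondecreasing)

lemma ex_Phi_eq:
  assumes "0 < y" "y < 1" obtains w where "Phi w = y"
proof -
  have "eventually (\<lambda>w. Phi w < y) at_bot"
    using std_normal.cdf_lim_at_bot by (rule order_tendstoD) (rule assms)
  then obtain v where v: "Phi v < y" by (auto dest!: eventually_happens)
  have "eventually (\<lambda>w. y < Phi w) at_top"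
    using std_normal.cdf_lim_at_top_prob by (rule order_tendstoD) (rule assms)
  then obtain w where w: "y < Phi w" by (auto dest!: eventually_happens)
  have "v \<le> w" using v w Phi_mono[of w v] by (cases "v \<le> w") auto
  with v w have "\<exists>x. v \<le> x \<and> x \<le> w \<and> Phi x = y"
    by (intro IVT) (auto simp: isCont_Phi)
  thus ?thesis using that by blast
qed

text \<open>A one-sided form of Polya's theorem, needed because coupling the totals compares
  distribution functions at all points at once. Monotonicity reduces the claim to the quantiles of
  \<open>Phi\<close> at multiples of \<open>1 / N\<close>, and \<open>N > 3 / \<epsilon>\<close>
  makes the error between neighbours less than \<open>\<epsilon> / 3\<close>.\<close>

lemma eventually_cdf_le:
  fixes F E :: "nat \<Rightarrow> real \<Rightarrow> real"
  assumes mono: "\<And>n. mono (F n)" "\<And>n. mono (E n)"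
    and F1: "\<And>n w. F n w \<le> 1" and E0: "\<And>n w. 0 \<le> E n w"
    and F: "\<And>w. (\<lambda>n. F n w) \<longlonglongrightarrow> Phi w" and E: "\<And>w. (\<lambda>n. E n w) \<longlonglongrightarrow> H w"
    and d: "\<And>w. Phi w - H w \<le> d" "0 \<le> d" and \<epsilon>: "0 < \<epsilon>"
  shows "eventually (\<lambda>n. \<forall>w. F n w \<le> E n w + d + \<epsilon>) sequentially"
proof -
  obtain N :: nat where N: "3 / \<epsilon> < N" using reals_Archimedean2 by blast
  have N0: "0 < N"
  proof -
    have "0 < 3 / \<epsilon>" using \<epsilon> by simp
    with N have "0 < real N" by linarith
    thus ?thesis by simp
  qed
  have N1: "1 / N < \<epsilon> / 3" using N N0 \<epsilon> by (simp add: field_simps)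
  have "\<exists>w. 0 < i \<longrightarrow> i < N \<longrightarrow> Phi w = real i / N" for i
    using ex_Phi_eq[of "real i / N"] by (metis N0 divide_less_eq_1_pos divide_pos_pos of_nat_0_less_iff of_nat_less_iff)
  then obtain ws where ws: "\<And>i. 0 < i \<Longrightarrow> i < N \<Longrightarrow> Phi (ws i) = real i / N" by metis
  have "eventually (\<lambda>n. \<forall>i\<in>{..<N}. F n (ws i) < Phi (ws i) + \<epsilon> / 3 \<and> H (ws i) - \<epsilon> / 3 < E n (ws i)) sequentially"
  proof (rule eventually_ball_finite)
    show "\<forall>i\<in>{..<N}. eventually (\<lambda>n. F n (ws i) < Phi (ws i) + \<epsilon> / 3 \<and> H (ws i) - \<epsilon> / 3 < E n (ws i)) sequentially"
    proof
      fix i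
      show "eventually (\<lambda>n. F n (ws i) < Phi (ws i) + \<epsilon> / 3 \<and> H (ws i) - \<epsilon> / 3 < E n (ws i)) sequentially"
        using order_tendstoD(2)[OF F, of "ws i" "Phi (ws i) + \<epsilon> / 3"] order_tendstoD(1)[OF E, of "H (ws i) - \<epsilon> / 3" "ws i"] \<epsilon>
        by (simp add: eventually_conj_iff)
    qed
  qed simp
  thus ?thesis
  proof (eventually_elim, intro allI)
    fix n w
    assume n: "\<forall>i\<in>{..<N}. F n (ws i) < Phi (ws i) + \<epsilon> / 3 \<and> H (ws i) - \<epsilon> / 3 < E n (ws i)"
    \<comment> \<open>The first grid point beyond \<open>w\<close>. The value \<open>N\<close>
      stands for plus infinity, where \<open>F \<le> 1\<close> is used; \<open>j = 1\<close> leaves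
      no grid point below \<open>w\<close>, where \<open>E \<ge> 0\<close> is used.\<close>
    define j where "j = (LEAST j. 0 < j \<and> (j = N \<or> w < ws j))"
    have j: "0 < j \<and> (j = N \<or> w < ws j)" unfolding j_def by (rule LeastI[of _ N]) (use N0 in auto)
    have jN: "j \<le> N" unfolding j_def by (rule Least_le) (use N0 in auto)
    have below: "\<not> (0 < i \<and> (i = N \<or> w < ws i))" if "i < j" for i
      using that unfolding j_def by (rule not_less_Least)
    have Fw: "F n w \<le> real j / N + \<epsilon> / 3"
    proof (cases "j = N")
      case True
      thus ?thesis using F1[of n w] N0 \<epsilon> by simp
    next
      case False
      hence "F n w \<le> F n (ws j)" using j by (intro monoD[OF mono(1)]) auto
      also have "\<dots> \<le> real j / N + \<epsilon> / 3"
      proof -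
        have "j \<in> {..<N}" "Phi (ws j) = real j / N" using ws[of j] j jN False by auto
        thus ?thesis using bspec[OF n, of j] by simp
      qed
      finally show ?thesis .
    qed
    have "real j / N = real (j - 1) / N + 1 / N" using j by (cases j) (auto simp: add_divide_distrib)
    moreover have "real (j - 1) / N \<le> E n w + d + \<epsilon> / 3"
    proof (cases "j = 1")
      case True
      thus ?thesis using E0[of n w] d(2) \<epsilon> by simp
    next
      case False
      hence i: "0 < j - 1" "j - 1 < j" "j - 1 < N" using j jN by auto
      hence "ws (j - 1) \<le> w" using below[of "j - 1"] by auto
      hence "E n (ws (j - 1)) \<le> E n w" by (intro monoD[OF mono(2)])
      moreover have "real (j - 1) / N - H (ws (j - 1)) \<le> d" using d(1)[of "ws (j - 1)"] ws[of "j - 1"] i by simp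
      moreover have "H (ws (j - 1)) - \<epsilon> / 3 < E n (ws (j - 1))" using n i by auto
      ultimately show ?thesis by simp
    qed
    ultimately show "F n w \<le> E n w + d + \<epsilon>" using Fw N1 by simp
  qed
qed

section \<open>The maximal gap between the limiting distribution functions\<close>

lemma integrable_std_normal_bounded:
  fixes f :: "real \<Rightarrow> real"
  assumes [measurable]: "f \<in> borel_measurable borel" and "\<And>x. \<bar>f x\<bar> \<le> C"
  shows "integrable std_normal_distribution f"
  by (rule std_normal.integrable_const_bound[of _ C]) (use assms in auto)

text \<open>Pointwise: cutting off at \<open>w'\<close> keeps what is nonnegative and discards what
  is nonpositive up to \<open>w\<close>.\<close>

lemma maximiser_sign_change:
  fixes g :: "real \<Rightarrow> real"
  assumes [measurable]: "g \<in> borel_measurable borel" and "\<And>x. \<bar>g x\<bar> \<le> C"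
    and "\<And>x. x \<le> w' \<Longrightarrow> 0 \<le> g x" "\<And>x. w' \<le> x \<Longrightarrow> x \<le> w \<Longrightarrow> g x \<le> 0"
  shows "(LINT x|std_normal_distribution. (if x \<le> w then g x else 0)) \<le>
     (LINT x|std_normal_distribution. (if x \<le> w' then g x else 0))"
proof (rule integral_mono)
  have C: "0 \<le> C" using assms(2)[of 0] by linarith
  have int: "integrable std_normal_distribution (\<lambda>x. if x \<le> v then g x else 0)" for v
    using assms(2) C by (intro integrable_std_normal_bounded[of _ C]) auto
  show "integrable std_normal_distribution (\<lambda>x. if x \<le> w then g x else 0)"
    and "integrable std_normal_distribution (\<lambda>x. if x \<le> w' then g x else 0)" by (rule int)+
  show "(if x \<le> w then g x else 0) \<le> (if x \<le> w' then g x else 0)" for x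
    using assms(3,4)[of x] by auto
qed

text \<open>The shape of the limit of the conditioned total over \<open>I\<close>:
  \<open>G x\<close> is the limiting tail weight off \<open>I\<close> when the normalised total over
  \<open>I\<close> is \<open>x\<close>, and \<open>D\<close> is the limit of the weight of the whole
  conditioning event.\<close>

definition scaled_cdf :: "(real \<Rightarrow> real) \<Rightarrow> real \<Rightarrow> real \<Rightarrow> real" where
  "scaled_cdf G D w = (LINT x|std_normal_distribution. (if x \<le> w then G x else 0)) / D"

lemma Phi_minus_scaled_cdf:
  assumes [measurable]: "G \<in> borel_measurable borel" and G: "\<And>x. \<bar>G x\<bar> \<le> C"
  shows "Phi w - scaled_cdf G D w = (LINT x|std_normal_distribution. (if x \<le> w then 1 - G x / D else 0))"
proof -
  have C: "0 \<le> C" using G[of 0] by linarith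
  have int: "integrable std_normal_distribution (\<lambda>x. if x \<le> w then 1 else 0 :: real)"
    "integrable std_normal_distribution (\<lambda>x. (if x \<le> w then G x else 0) / D)"
  proof -
    show "integrable std_normal_distribution (\<lambda>x. if x \<le> w then 1 else 0 :: real)"
      by (rule integrable_std_normal_bounded[of _ 1]) auto
    show "integrable std_normal_distribution (\<lambda>x. (if x \<le> w then G x else 0) / D)"
      using G C by (intro integrable_divide integrable_std_normal_bounded[of _ C]) auto
  qed
  have "Phi w - scaled_cdf G D w = (LINT x|std_normal_distribution. (if x \<le> w then 1 else 0) - (if x \<le> w then G x else 0) / D)"
    unfolding scaled_cdf_def Phi_eq_integral using int by simp
  also have "\<dots> = (LINT x|std_normal_distribution. (if x \<le> w then 1 - G x / D else 0))"
    by (intro Bochner_Integration.integral_cong) auto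
  finally show ?thesis .
qed

lemma scaled_cdf_tendsto_at_bot:
  assumes [measurable]: "G \<in> borel_measurable borel" and G: "\<And>x. \<bar>G x\<bar> \<le> C"
  shows "(scaled_cdf G D \<longlongrightarrow> 0) at_bot"
proof (rule Lim_null_comparison)
  have C: "0 \<le> C" using G[of 0] by linarith
  have "\<bar>scaled_cdf G D w\<bar> \<le> C / \<bar>D\<bar> * Phi w" for w
  proof -
    have "\<bar>LINT x|std_normal_distribution. (if x \<le> w then G x else 0)\<bar> \<le>
        (LINT x|std_normal_distribution. C * (if x \<le> w then 1 else 0))"
    proof (rule order_trans[OF integral_abs_bound integral_mono])
      show "integrable std_normal_distribution (\<lambda>x. \<bar>if x \<le> w then G x else 0\<bar>)"
        using G C by (intro integrable_std_normal_bounded[of _ C]) auto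
      show "integrable std_normal_distribution (\<lambda>x. C * (if x \<le> w then 1 else 0))"
        using C by (intro integrable_std_normal_bounded[of _ C]) auto
    qed (use G C in auto)
    also have "\<dots> = C * Phi w" by (simp add: Phi_eq_integral)
    finally show ?thesis by (simp add: scaled_cdf_def abs_divide divide_right_mono)
  qed
  thus "eventually (\<lambda>w. norm (scaled_cdf G D w) \<le> C / \<bar>D\<bar> * Phi w) at_bot" by simp
  show "((\<lambda>w. C / \<bar>D\<bar> * Phi w) \<longlongrightarrow> 0) at_bot"
    using tendsto_mult_left[OF std_normal.cdf_lim_at_bot, of "C / \<bar>D\<bar>"] by simp
qed

text \<open>The integrand \<open>1 - G x / D\<close> of the gap changes sign once, from nonnegative
  to nonpositive, where \<open>(K - a * x) / b = K / c\<close>. Solving for \<open>x\<close> gives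
  \<open>w'\<close>.\<close>

lemma conditioned_tail_maximiser:
  fixes a b c K :: real
  assumes pos: "0 < a" "0 < b" "0 < c"
  defines "G \<equiv> \<lambda>x. 1 - Phi ((K - a * x) / b)" and "D \<equiv> 1 - Phi (K / c)" and "w' \<equiv> (c - b) / (a * c) * K"
  shows "Phi w - scaled_cdf G D w \<le> Phi w' - scaled_cdf G D w'"
    and "0 \<le> Phi w' - scaled_cdf G D w'"
    and "Phi w' - scaled_cdf G D w' = (LINT z:{..w'}|lborel. exp (- z\<^sup>2 / 2) / sqrt (2 * pi) *
                     ((Phi ((K - a * z) / b) - Phi (K / c)) / (1 - Phi (K / c))))"
proof -
  have [measurable]: "G \<in> borel_measurable borel" unfolding G_def by measurable
  have D: "0 < D" using Phi_less_1[of "K / c"] by (simp add: D_def)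
  have G1: "0 \<le> G x" "G x \<le> 1" for x
    using Phi_less_1[of "(K - a * x) / b"] Phi_pos[of "(K - a * x) / b"] by (auto simp: G_def)
  hence G: "\<bar>G x\<bar> \<le> 1" for x by simp
  define g where "g x = 1 - G x / D" for x
  have g: "g x = (Phi ((K - a * x) / b) - Phi (K / c)) / (1 - Phi (K / c))" for x
    using D by (simp add: g_def G_def D_def field_simps)
  have [measurable]: "g \<in> borel_measurable borel" unfolding g_def by measurable
  have bound: "\<bar>g x\<bar> \<le> 1 + 1 / D" for x
  proof -
    have "0 \<le> G x / D" "G x / D \<le> 1 / D" using G1[of x] D by (auto simp: divide_right_mono)
    moreover have "0 \<le> 1 / D" using D by simp
    ultimately show ?thesis unfolding g_def by linarith
  qed
  have arg: "K / c \<le> (K - a * x) / b \<longleftrightarrow> x \<le> w'" "(K - a * x) / b \<le> K / c \<longleftrightarrow> w' \<le> x" for x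
    using pos by (auto simp: w'_def field_simps)
  have pos_g: "0 \<le> g x" if "x \<le> w'" for x
    using Phi_mono[of "K / c" "(K - a * x) / b"] that arg D by (simp add: g D_def)
  have neg_g: "g x \<le> 0" if "w' \<le> x" for x
    using Phi_mono[of "(K - a * x) / b" "K / c"] that arg D by (simp add: g D_def divide_nonpos_pos)
  have eq: "Phi w - scaled_cdf G D w = (LINT x|std_normal_distribution. (if x \<le> w then g x else 0))" for w
    unfolding g_def by (rule Phi_minus_scaled_cdf[OF _ G]) simp
  show "Phi w - scaled_cdf G D w \<le> Phi w' - scaled_cdf G D w'"
    unfolding eq by (rule maximiser_sign_change[OF _ bound pos_g neg_g]) auto
  show "0 \<le> Phi w' - scaled_cdf G D w'"
    unfolding eq using pos_g by (intro integral_nonneg_AE) auto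
  show "Phi w' - scaled_cdf G D w' = (LINT z:{..w'}|lborel. exp (- z\<^sup>2 / 2) / sqrt (2 * pi) *
                     ((Phi ((K - a * z) / b) - Phi (K / c)) / (1 - Phi (K / c))))"
    unfolding eq by (subst integral_std_normal_indicator)
      (auto simp: set_lebesgue_integral_def g std_normal_density_def)
qed

text \<open>Completing the square shows that \<open>G / D\<close> times the standard normal density
  is again a normal density: the law of the normalised total over \<open>I\<close> when the limiting
  total is pinned at \<open>K\<close>. Its ratio to the standard normal density crosses 1 at the
  roots \<open>w' \<le> w0\<close> of a quadratic, so the gap of the distribution functions rises up
  to \<open>w'\<close>, falls up to \<open>w0\<close> and then rises back to 0. Hence the lower root
  is the maximiser.\<close>

lemma conditioned_local_maximiser:
  fixes a b c K \<kappa> :: real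
  assumes pos: "0 < a" "0 < b" "0 < c" and c: "c\<^sup>2 = a\<^sup>2 + b\<^sup>2" and \<kappa>: "0 < \<kappa>"
  defines "G \<equiv> \<lambda>x. normal_density 0 b (K - a * x) / \<kappa>" and "D \<equiv> normal_density 0 c K / \<kappa>"
    and "R \<equiv> sqrt (K\<^sup>2 + c\<^sup>2 * ln (c\<^sup>2 / b\<^sup>2))"
  defines "w' \<equiv> K / a - b / (a * c) * R"
  shows "Phi w - scaled_cdf G D w \<le> Phi w' - scaled_cdf G D w'"
    and "0 \<le> Phi w' - scaled_cdf G D w'"
    and "1 - (Phi w' - scaled_cdf G D w') = Phi (b * K / (a * c) - 1 / a * R) + Phi (- (K / a) + b / (a * c) * R)"
proof -
  have [measurable]: "G \<in> borel_measurable borel" unfolding G_def by measurable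
  have D: "0 < D" unfolding D_def using pos \<kappa> by (simp add: normal_density_pos)
  define B where "B = normal_density 0 b 0 / \<kappa>"
  have G: "\<bar>G x\<bar> \<le> B" for x
    using \<kappa> pos by (auto simp: G_def B_def normal_density_def intro!: divide_right_mono)
  define \<mu> where "\<mu> = a * K / c\<^sup>2"
  define \<sigma> where "\<sigma> = b / c"
  have \<sigma>: "0 < \<sigma>" using pos by (simp add: \<sigma>_def)
  have dens: "std_normal_density x * (G x / D) = normal_density \<mu> \<sigma> x" for x
  proof -
    have e: "- x\<^sup>2 / 2 + - (K - a * x)\<^sup>2 / (2 * b\<^sup>2) - - K\<^sup>2 / (2 * c\<^sup>2) = - (x - \<mu>)\<^sup>2 / (2 * \<sigma>\<^sup>2)"
    proof -
      have "c\<^sup>2 * (- x\<^sup>2 / 2 + - (K - a * x)\<^sup>2 / (2 * b\<^sup>2) - - K\<^sup>2 / (2 * c\<^sup>2)) * (2 * b\<^sup>2) =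
         - (x\<^sup>2 * b\<^sup>2 * c\<^sup>2) - c\<^sup>2 * (K - a * x)\<^sup>2 + K\<^sup>2 * b\<^sup>2"
        using pos by (simp add: field_simps)
      also have "\<dots> = - (c\<^sup>2 * x)\<^sup>2 + 2 * (c\<^sup>2 * x) * (a * K) - (a * K)\<^sup>2"
      proof -
        have "x\<^sup>2 * b\<^sup>2 * c\<^sup>2 = x\<^sup>2 * (c\<^sup>2 - a\<^sup>2) * c\<^sup>2" "K\<^sup>2 * b\<^sup>2 = K\<^sup>2 * (c\<^sup>2 - a\<^sup>2)" using c by auto
        thus ?thesis by (simp add: power2_eq_square algebra_simps)
      qed
      also have "\<dots> = - (c\<^sup>2 * x - a * K)\<^sup>2" by (simp add: power2_eq_square algebra_simps)
      also have "\<dots> = c\<^sup>2 * (- (x - \<mu>)\<^sup>2 / (2 * \<sigma>\<^sup>2)) * (2 * b\<^sup>2)"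
      proof -
        have "c\<^sup>2 * x - a * K = c\<^sup>2 * (x - \<mu>)" using pos by (simp add: \<mu>_def field_simps)
        thus ?thesis using pos by (simp add: \<sigma>_def power_mult_distrib power_divide power2_eq_square)
      qed
      finally have "c\<^sup>2 * (- x\<^sup>2 / 2 + - (K - a * x)\<^sup>2 / (2 * b\<^sup>2) - - K\<^sup>2 / (2 * c\<^sup>2)) * (2 * b\<^sup>2) =
          c\<^sup>2 * (- (x - \<mu>)\<^sup>2 / (2 * \<sigma>\<^sup>2)) * (2 * b\<^sup>2)" .
      moreover have "c\<^sup>2 \<noteq> 0" "2 * b\<^sup>2 \<noteq> 0" using pos by auto
      ultimately show ?thesis by (simp only: mult_cancel_left mult_cancel_right) blast
    qed
    have "std_normal_density x * (G x / D) =
        (1 / sqrt (2 * pi)) * (1 / sqrt (2 * pi * b\<^sup>2)) / (1 / sqrt (2 * pi * c\<^sup>2)) *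
        (exp (- x\<^sup>2 / 2) * exp (- (K - a * x)\<^sup>2 / (2 * b\<^sup>2)) / exp (- K\<^sup>2 / (2 * c\<^sup>2)))"
      using \<kappa> by (simp add: G_def D_def normal_density_def mult_ac)
    also have "(1 / sqrt (2 * pi)) * (1 / sqrt (2 * pi * b\<^sup>2)) / (1 / sqrt (2 * pi * c\<^sup>2)) = 1 / sqrt (2 * pi * \<sigma>\<^sup>2)"
      using pos by (simp add: \<sigma>_def real_sqrt_mult real_sqrt_divide power_divide)
    also have "exp (- x\<^sup>2 / 2) * exp (- (K - a * x)\<^sup>2 / (2 * b\<^sup>2)) / exp (- K\<^sup>2 / (2 * c\<^sup>2)) = exp (- (x - \<mu>)\<^sup>2 / (2 * \<sigma>\<^sup>2))"
      unfolding e[symmetric] by (simp only: exp_add exp_diff)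
    finally show ?thesis by (simp add: normal_density_def)
  qed
  have nd: "normal_density \<mu> \<sigma> x = exp (- (c\<^sup>2 * (x - \<mu>)\<^sup>2 / b\<^sup>2 / 2)) / (sqrt (2 * pi) * \<sigma>)" for x
  proof -
    have "sqrt (2 * pi * \<sigma>\<^sup>2) = sqrt (2 * pi) * \<sigma>" using \<sigma> by (simp add: real_sqrt_mult)
    moreover have "- (x - \<mu>)\<^sup>2 / (2 * \<sigma>\<^sup>2) = - (c\<^sup>2 * (x - \<mu>)\<^sup>2 / b\<^sup>2 / 2)"
      using pos by (simp add: \<sigma>_def power_divide mult.commute)
    ultimately show ?thesis unfolding normal_density_def by simp
  qed
  have H: "scaled_cdf G D w = Phi ((w - \<mu>) / \<sigma>)" for w
  proof -
    have "scaled_cdf G D w = (LINT x|lborel. indicator {..w} x * (std_normal_density x * G x)) / D"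
      unfolding scaled_cdf_def by (subst integral_std_normal_indicator) auto
    also have "\<dots> = (LINT x|lborel. indicator {..w} x * (std_normal_density x * G x) / D)" by simp
    also have "\<dots> = (LINT x|lborel. indicator {..w} x * normal_density \<mu> \<sigma> x)"
      unfolding dens[symmetric] by (simp add: mult.assoc)
    finally show ?thesis by (simp add: normal_cdf[OF \<sigma>])
  qed
  define g where "g x = 1 - G x / D" for x
  have [measurable]: "g \<in> borel_measurable borel" unfolding g_def by measurable
  have bound: "\<bar>g x\<bar> \<le> 1 + B / D" for x
  proof -
    have "\<bar>G x / D\<bar> \<le> B / D" using G[of x] D by (simp add: abs_divide divide_right_mono)
    thus ?thesis unfolding g_def by linarith
  qed
  have eq: "Phi w - scaled_cdf G D w = (LINT x|std_normal_distribution. (if x \<le> w then g x else 0))" for w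
    unfolding g_def by (rule Phi_minus_scaled_cdf[OF _ G]) simp
  have ln_pos: "0 \<le> ln (c\<^sup>2 / b\<^sup>2)" using c pos by (intro ln_ge_zero) simp
  have R2: "R\<^sup>2 = K\<^sup>2 + c\<^sup>2 * ln (c\<^sup>2 / b\<^sup>2)" and R0: "0 \<le> R"
    using ln_pos by (auto simp: R_def)
  define w0 where "w0 = K / a + b / (a * c) * R"
  have w'w0: "w' \<le> w0" using pos R0 by (simp add: w'_def w0_def)
  \<comment> \<open>Twice the logarithm of the standard normal density over
    \<open>normal_density \<mu> \<sigma>\<close>, factored over its roots.\<close>
  have quad: "c\<^sup>2 * (x - \<mu>)\<^sup>2 / b\<^sup>2 - x\<^sup>2 - ln (c\<^sup>2 / b\<^sup>2) = a\<^sup>2 / b\<^sup>2 * ((x - w') * (x - w0))" for x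
  proof -
    have "(x - w') * (x - w0) = (x - K / a)\<^sup>2 - (b / (a * c) * R)\<^sup>2"
      by (simp add: w'_def w0_def power2_eq_square algebra_simps)
    also have "(b / (a * c) * R)\<^sup>2 = b\<^sup>2 / (a\<^sup>2 * c\<^sup>2) * (K\<^sup>2 + c\<^sup>2 * ln (c\<^sup>2 / b\<^sup>2))"
      by (simp add: power_mult_distrib power_divide R2)
    finally have 1: "a\<^sup>2 / b\<^sup>2 * ((x - w') * (x - w0)) = a\<^sup>2 / b\<^sup>2 * (x - K / a)\<^sup>2 - K\<^sup>2 / c\<^sup>2 - ln (c\<^sup>2 / b\<^sup>2)"
      using pos by (simp add: right_diff_distrib distrib_left)
    have "a\<^sup>2 / b\<^sup>2 * (x - K / a)\<^sup>2 = (a * x - K)\<^sup>2 / b\<^sup>2"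
    proof -
      have "a * x - K = a * (x - K / a)" using pos by (simp add: right_diff_distrib)
      thus ?thesis by (simp add: power_mult_distrib)
    qed
    moreover have "c\<^sup>2 * (x - \<mu>)\<^sup>2 / b\<^sup>2 = (c\<^sup>2 * x - a * K)\<^sup>2 / (b\<^sup>2 * c\<^sup>2)"
    proof -
      have "c\<^sup>2 * x - a * K = c\<^sup>2 * (x - \<mu>)" using pos by (simp add: \<mu>_def field_simps)
      thus ?thesis using pos by (simp add: power_mult_distrib power2_eq_square)
    qed
    moreover have "(c\<^sup>2 * x - a * K)\<^sup>2 / (b\<^sup>2 * c\<^sup>2) - x\<^sup>2 = (a * x - K)\<^sup>2 / b\<^sup>2 - K\<^sup>2 / c\<^sup>2"
    proof -
      have "(c\<^sup>2 * x - a * K)\<^sup>2 - x\<^sup>2 * b\<^sup>2 * c\<^sup>2 = c\<^sup>2 * (a * x - K)\<^sup>2 - K\<^sup>2 * b\<^sup>2"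
      proof -
        have "x\<^sup>2 * b\<^sup>2 * c\<^sup>2 = x\<^sup>2 * (c\<^sup>2 - a\<^sup>2) * c\<^sup>2" "K\<^sup>2 * b\<^sup>2 = K\<^sup>2 * (c\<^sup>2 - a\<^sup>2)" using c by auto
        thus ?thesis by (simp add: power2_eq_square algebra_simps)
      qed
      thus ?thesis using pos by (simp add: field_simps)
    qed
    ultimately show ?thesis using 1 by linarith
  qed
  have log_compare: "- A - - L / 2 - Q / 2 \<le> - A - X / 2 \<longleftrightarrow> 0 \<le> Q - X - L" for A L Q X :: real
    by auto
  have sign: "0 \<le> g x \<longleftrightarrow> 0 \<le> (x - w') * (x - w0)" for x
  proof -
    have sd: "0 < std_normal_density x" by (rule normal_density_pos) simp
    have "0 \<le> g x \<longleftrightarrow> std_normal_density x * (G x / D) \<le> std_normal_density x * 1"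
      by (simp only: mult_le_cancel_left_pos[OF sd]) (simp add: g_def)
    also have "\<dots> \<longleftrightarrow> normal_density \<mu> \<sigma> x \<le> std_normal_density x"
      unfolding dens by simp
    also have "\<dots> \<longleftrightarrow> ln (normal_density \<mu> \<sigma> x) \<le> ln (std_normal_density x)"
      using \<sigma> by (simp add: normal_density_pos)
    also have "ln (std_normal_density x) = - ln (sqrt (2 * pi)) - x\<^sup>2 / 2"
      by (simp add: std_normal_density_def ln_div)
    also have "ln (normal_density \<mu> \<sigma> x) = - ln (sqrt (2 * pi)) - ln \<sigma> - c\<^sup>2 * (x - \<mu>)\<^sup>2 / b\<^sup>2 / 2"
      unfolding nd using \<sigma> by (simp add: ln_div ln_mult)
    also have "ln \<sigma> = - ln (c\<^sup>2 / b\<^sup>2) / 2"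
      using pos by (simp add: \<sigma>_def ln_div ln_realpow)
    also have "- ln (sqrt (2 * pi)) - - ln (c\<^sup>2 / b\<^sup>2) / 2 - c\<^sup>2 * (x - \<mu>)\<^sup>2 / b\<^sup>2 / 2 \<le> - ln (sqrt (2 * pi)) - x\<^sup>2 / 2
       \<longleftrightarrow> 0 \<le> c\<^sup>2 * (x - \<mu>)\<^sup>2 / b\<^sup>2 - x\<^sup>2 - ln (c\<^sup>2 / b\<^sup>2)"
      by (rule log_compare)
    also have "\<dots> \<longleftrightarrow> 0 \<le> (x - w') * (x - w0)"
    proof -
      have "0 < a\<^sup>2 / b\<^sup>2" using pos by simp
      hence "0 \<le> a\<^sup>2 / b\<^sup>2 * z \<longleftrightarrow> 0 \<le> z" for z by (simp only: zero_le_mult_iff) linarith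
      thus ?thesis unfolding quad .
    qed
    finally show ?thesis .
  qed
  have pos_g: "0 \<le> g x" if "x \<le> w'" for x
    unfolding sign using that w'w0 by (simp add: mult_nonpos_nonpos)
  have pos_g0: "0 \<le> g x" if "w0 \<le> x" for x
    unfolding sign using that w'w0 by simp
  have neg_g: "g x \<le> 0" if "w' \<le> x" "x \<le> w0" for x
  proof (cases "x = w' \<or> x = w0")
    case True
    \<comment> \<open>At the roots \<open>sign\<close> only yields \<open>0 \<le> g x\<close>, so
      equality of the densities has to be read off the quadratic itself.\<close>
    have q0: "normal_density \<mu> \<sigma> x = std_normal_density x"
    proof -
      have "c\<^sup>2 * (x - \<mu>)\<^sup>2 / b\<^sup>2 - x\<^sup>2 - ln (c\<^sup>2 / b\<^sup>2) = 0" unfolding quad using True by auto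
      hence "c\<^sup>2 * (x - \<mu>)\<^sup>2 / b\<^sup>2 / 2 = x\<^sup>2 / 2 + ln (c / b)"
        using pos by (simp add: ln_div ln_realpow)
      hence "normal_density \<mu> \<sigma> x = exp (- (x\<^sup>2 / 2) - ln (c / b)) / (sqrt (2 * pi) * \<sigma>)"
        by (simp add: nd)
      also have "\<dots> = std_normal_density x"
        using pos by (simp add: exp_diff \<sigma>_def std_normal_density_def)
      finally show ?thesis .
    qed
    have "std_normal_density x * (G x / D) = std_normal_density x * 1" using q0 dens[of x] by simp
    moreover have "std_normal_density x \<noteq> 0" using normal_density_pos[of 1 0 x] by simp
    ultimately have "G x / D = 1" using mult_cancel_left by blast
    thus ?thesis by (simp add: g_def)
  next
    case False
    hence "(x - w') * (x - w0) < 0" using that by (simp add: mult_pos_neg)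
    thus ?thesis using sign[of x] by linarith
  qed
  show nonneg: "0 \<le> Phi w' - scaled_cdf G D w'"
    unfolding eq using pos_g by (intro integral_nonneg_AE) auto
  show "Phi w - scaled_cdf G D w \<le> Phi w' - scaled_cdf G D w'"
  proof (cases "w \<le> w0")
    case True
    thus ?thesis
      unfolding eq by (intro maximiser_sign_change[OF _ bound pos_g neg_g]) auto
  next
    case False
    have int: "integrable std_normal_distribution g" by (rule integrable_std_normal_bounded[OF _ bound]) simp
    \<comment> \<open>Both densities have mass 1, so the full integral vanishes. Beyond
      \<open>w0\<close> the integrand is nonnegative, so the gap at \<open>w\<close> is at most this
      total.\<close>
    have total: "(LINT x|std_normal_distribution. g x) = 0"
    proof -
      have "(LINT x|std_normal_distribution. g x) = (LINT x|lborel. std_normal_density x *\<^sub>R g x)"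
        by (rule integral_density) auto
      also have "\<dots> = (LINT x|lborel. std_normal_density x - normal_density \<mu> \<sigma> x)"
        unfolding dens[symmetric] by (simp add: g_def right_diff_distrib)
      also have "\<dots> = 0" using \<sigma> by simp
      finally show ?thesis .
    qed
    have "(LINT x|std_normal_distribution. (if x \<le> w then g x else 0)) \<le> (LINT x|std_normal_distribution. g x)"
    proof (rule integral_mono)
      show "integrable std_normal_distribution (\<lambda>x. if x \<le> w then g x else 0)"
        using bound by (intro integrable_std_normal_bounded[of _ "1 + B / D"]) (auto intro: order_trans[OF abs_ge_zero])
      show "(if x \<le> w then g x else 0) \<le> g x" for x using pos_g0[of x] False by auto
    qed (rule int)
    thus ?thesis using nonneg unfolding eq total by linarith
  qed
  show "1 - (Phi w' - scaled_cdf G D w') = Phi (b * K / (a * c) - 1 / a * R) + Phi (- (K / a) + b / (a * c) * R)"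
  proof -
    have "(w' - \<mu>) / \<sigma> = K / (a * c) * (c\<^sup>2 - a\<^sup>2) / b - R / a"
      using pos by (simp add: w'_def \<mu>_def \<sigma>_def field_simps power2_eq_square)
    also have "\<dots> = b * K / (a * c) - 1 / a * R"
      using pos c by (simp add: power2_eq_square)
    finally have "scaled_cdf G D w' = Phi (b * K / (a * c) - 1 / a * R)" by (simp add: H)
    moreover have "1 - Phi w' = Phi (- (K / a) + b / (a * c) * R)"
      by (simp add: Phi_minus[symmetric] w'_def)
    ultimately show ?thesis by simp
  qed
qed

section \<open>The three regimes\<close>

lemma cond_bernoulli_vec_eq:
  "cond_bernoulli_vec blk r k n = cond_pmf (bvec {1..n} (\<lambda>j. r (blk n j))) (at_least {1..n} k)"
  by (simp add: cond_bernoulli_vec_def bernoulli_vec_def bvec_def at_least_def tot_def successes_def)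

lemma prob_tot_le:
  fixes n :: nat
  assumes J: "unit_probs {1..n} r" and A: "A \<subseteq> {1..n}" and n: "0 < n" and \<epsilon>: "0 < \<epsilon>"
    and z: "\<epsilon> * sqrt n \<le> (\<Sum>j\<in>A. r j) - z"
  shows "Pr (bvec {1..n} r) {x. real (tot A x) \<le> z} \<le> 2 * exp (- 2 * \<epsilon>\<^sup>2)"
proof -
  have "Pr (bvec {1..n} r) {x. real (tot A x) \<le> z} \<le>
     Pr (bvec {1..n} r) {x. \<epsilon> * sqrt n \<le> \<bar>real (tot A x) - (\<Sum>j\<in>A. r j)\<bar>}"
    using z by (intro measure_pmf.finite_measure_mono) auto
  also have "\<dots> \<le> 2 * exp (- 2 * (\<epsilon> * sqrt n)\<^sup>2 / real n)"
    using card_mono[OF _ A] \<epsilon> n by (intro prob_tot_deviation J A) auto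
  also have "\<dots> = 2 * exp (- 2 * \<epsilon>\<^sup>2)" using n by (simp add: power_mult_distrib)
  finally show ?thesis .
qed

lemma prob_tot_ge:
  fixes n :: nat
  assumes J: "unit_probs {1..n} r" and A: "A \<subseteq> {1..n}" and n: "0 < n" and \<epsilon>: "0 < \<epsilon>"
    and z: "\<epsilon> * sqrt n \<le> z - (\<Sum>j\<in>A. r j)"
  shows "Pr (bvec {1..n} r) {x. z \<le> real (tot A x)} \<le> 2 * exp (- 2 * \<epsilon>\<^sup>2)"
proof -
  have "Pr (bvec {1..n} r) {x. z \<le> real (tot A x)} \<le>
     Pr (bvec {1..n} r) {x. \<epsilon> * sqrt n \<le> \<bar>real (tot A x) - (\<Sum>j\<in>A. r j)\<bar>}"
    using z by (intro measure_pmf.finite_measure_mono) auto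
  also have "\<dots> \<le> 2 * exp (- 2 * (\<epsilon> * sqrt n)\<^sup>2 / real n)"
    using card_mono[OF _ A] \<epsilon> n by (intro prob_tot_deviation J A) auto
  also have "\<dots> = 2 * exp (- 2 * \<epsilon>\<^sup>2)" using n by (simp add: power_mult_distrib)
  finally show ?thesis .
qed

lemma prob_at_least_ge:
  "1 - Pr \<mu> {x. real (tot J x) \<le> real k} \<le> Pr \<mu> (at_least J k)"
proof -
  have "Pr \<mu> (UNIV - {x. real (tot J x) \<le> real k}) \<le> Pr \<mu> (at_least J k)"
    by (intro measure_pmf.finite_measure_mono) (auto simp: at_least_def)
  thus ?thesis using measure_pmf.prob_compl[of "{x. real (tot J x) \<le> real k}" \<mu>] by simp
qed

lemma prob_at_most_ge:
  "1 - Pr \<mu> {x. real k \<le> real (tot J x)} \<le> Pr \<mu> (at_most J k)"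
proof -
  have "Pr \<mu> (UNIV - {x. real k \<le> real (tot J x)}) \<le> Pr \<mu> (at_most J k)"
    by (intro measure_pmf.finite_measure_mono) (auto simp: at_most_def)
  thus ?thesis using measure_pmf.prob_compl[of "{x. real k \<le> real (tot J x)}" \<mu>] by simp
qed

lemma exp_neg_square_tendsto_0:
  assumes "filterlim f at_top F"
  shows "((\<lambda>n. 2 * exp (- 2 * (f n)\<^sup>2)) \<longlongrightarrow> (0 :: real)) F"
proof -
  have "((\<lambda>x::real. 2 * exp (- 2 * x\<^sup>2)) \<longlongrightarrow> 0) at_top" by real_asymp
  thus ?thesis using assms by (rule filterlim_compose)
qed

section \<open>The setting, the case of equal ratios and the lower regime\<close>

locale bernoulli_setting =
  fixes M :: nat and \<alpha>s :: "nat \<Rightarrow> real" and \<alpha> :: real and p q :: "nat \<Rightarrow> real"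
    and blk :: "nat \<Rightarrow> nat \<Rightarrow> nat" and k :: "nat \<Rightarrow> nat"
  assumes M: "M \<ge> 1"
    and \<alpha>s: "\<And>i. i \<in> {1..M} \<Longrightarrow> 0 < \<alpha>s i"
    and \<alpha>s_sum: "(\<Sum>i = 1..M. \<alpha>s i) = 1"
    and \<alpha>: "0 < \<alpha>" "\<alpha> < 1"
    and pq: "\<And>i. i \<in> {1..M} \<Longrightarrow> 0 < p i \<and> p i \<le> q i \<and> q i < 1"
    and blk: "\<And>n j. n \<ge> 1 \<Longrightarrow> j \<in> {1..n} \<Longrightarrow> blk n j \<in> {1..M}"
    and block_lim: "\<And>i. i \<in> {1..M} \<Longrightarrow> (\<lambda>n. real (block_size blk i n) / real n) \<longlonglongrightarrow> \<alpha>s i"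
    and k_le: "\<And>n. n \<ge> 1 \<Longrightarrow> k n \<le> n"
    and k_lim: "(\<lambda>n. real (k n) / real n) \<longlonglongrightarrow> \<alpha>"
begin

definition \<beta> :: real where "\<beta> = beta_max M p q"

definition I :: "nat set" where "I = max_blocks M p q"

definition blocks :: "nat set \<Rightarrow> nat \<Rightarrow> nat set" where
  "blocks A n = {j \<in> {1..n}. blk n j \<in> A}"

definition pvec :: "(nat \<Rightarrow> real) \<Rightarrow> nat \<Rightarrow> (nat \<Rightarrow> bool) pmf" where
  "pvec f n = bvec {1..n} (\<lambda>j. f (blk n j))"

definition X :: "nat \<Rightarrow> (nat \<Rightarrow> bool) pmf" where
  "X n = cond_pmf (pvec p n) (at_least {1..n} (k n))"

definition Y :: "nat \<Rightarrow> (nat \<Rightarrow> bool) pmf" where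
  "Y n = cond_pmf (pvec q n) (at_least {1..n} (k n))"

definition S :: "nat \<Rightarrow> real" where
  "S n = sup_prob_le (X n) (Y n)"

definition D :: "nat \<Rightarrow> real" where
  "D n = (real (k n) - k_hat M blk p q n) / sqrt (real n)"

lemma I_subset: "I \<subseteq> {1..M}" by (auto simp: I_def max_blocks_def)

lemma p01: "i \<in> {1..M} \<Longrightarrow> 0 < p i \<and> p i < 1" and q01: "i \<in> {1..M} \<Longrightarrow> 0 < q i \<and> q i < 1"
  using pq[of i] by auto

lemma odds_pos: "i \<in> {1..M} \<Longrightarrow> 0 < odds_ratio p q i"
  using p01[of i] q01[of i] by (auto simp: odds_ratio_def)

lemma odds_le_1: "i \<in> {1..M} \<Longrightarrow> odds_ratio p q i \<le> 1"
proof -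
  assume i: "i \<in> {1..M}"
  have "p i * (1 - q i) \<le> q i * (1 - p i)" using pq[OF i] by (simp add: algebra_simps)
  thus ?thesis using p01[OF i] q01[OF i] by (simp add: odds_ratio_def divide_le_eq mult.commute)
qed

lemma odds_le_\<beta>: "i \<in> {1..M} \<Longrightarrow> odds_ratio p q i \<le> \<beta>"
  unfolding \<beta>_def beta_max_def by (rule Max_ge) auto

lemma I_iff: "i \<in> I \<longleftrightarrow> i \<in> {1..M} \<and> odds_ratio p q i = \<beta>"
  by (simp add: I_def max_blocks_def \<beta>_def)

lemma ex_\<beta>: "\<exists>i\<in>{1..M}. odds_ratio p q i = \<beta>"
proof -
  have "\<beta> \<in> odds_ratio p q ` {1..M}" unfolding \<beta>_def beta_max_def using M by (intro Max_in) auto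
  thus ?thesis by auto
qed

lemma I_nonempty: "I \<noteq> {}" using ex_\<beta> I_iff by blast

lemma \<beta>_pos: "0 < \<beta>" and \<beta>_le_1: "\<beta> \<le> 1"
proof -
  obtain i where "i \<in> {1..M}" "odds_ratio p q i = \<beta>" using ex_\<beta> by blast
  thus "0 < \<beta>" "\<beta> \<le> 1" using odds_pos[of i] odds_le_1[of i] by simp_all
qed

text \<open>\<open>odds_ratio\<close> is the odds of \<open>p i\<close> divided by the odds of
  \<open>q i\<close>, so its inverse is the factor that carries the former to the latter.\<close>

lemma q_eq_tilt: "i \<in> {1..M} \<Longrightarrow> q i = tilt (1 / odds_ratio p q i) (p i)"
proof -
  assume i: "i \<in> {1..M}"
  note b = p01[OF i] q01[OF i]
  have t: "1 / odds_ratio p q i * p i = (1 - p i) * q i / (1 - q i)"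
    using b by (simp add: odds_ratio_def)
  have "tilt (1 / odds_ratio p q i) (p i) = ((1 - p i) * q i / (1 - q i)) / ((1 - p i) / (1 - q i))"
    unfolding tilt_def t using b by (simp add: field_simps)
  also have "\<dots> = q i" using b by simp
  finally show ?thesis ..
qed

lemma tilt_q: "i \<in> {1..M} \<Longrightarrow> 0 < u \<Longrightarrow> tilt u (q i) = tilt (u / odds_ratio p q i) (p i)"
  using q_eq_tilt[of i] p01[of i] odds_pos[of i] by (simp add: tilt_tilt)

text \<open>Stated for a further tilt \<open>u\<close> of both vectors: \<open>u = 1\<close> is
  \<open>Y\<close> without conditioning, and larger \<open>u\<close> is needed when conditioning
  moves \<open>Y\<close> at linear scale.\<close>

lemma tilt_p_q_I: "i \<in> I \<Longrightarrow> 0 < u \<Longrightarrow> tilt (u / \<beta>) (p i) = tilt u (q i)"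
  using tilt_q[of i u] by (simp add: I_iff)

lemma tilt_p_le_q: "i \<in> {1..M} \<Longrightarrow> 0 < u \<Longrightarrow> tilt (u / \<beta>) (p i) \<le> tilt u (q i)"
  unfolding tilt_q using \<beta>_pos odds_pos[of i] odds_le_\<beta>[of i] p01[of i]
  by (auto intro!: tilt_le divide_left_mono)

lemma tilt_p_less_q: "i \<in> {1..M} - I \<Longrightarrow> 0 < u \<Longrightarrow> tilt (u / \<beta>) (p i) < tilt u (q i)"
proof -
  assume i: "i \<in> {1..M} - I" and u: "0 < u"
  hence "odds_ratio p q i < \<beta>" using odds_le_\<beta>[of i] by (auto simp: I_iff)
  hence "tilt (u / \<beta>) (p i) < tilt (u / odds_ratio p q i) (p i)"
    using i u odds_pos[of i] p01[of i] \<beta>_pos by (intro tilt_less divide_strict_left_mono) auto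
  thus ?thesis using i u by (simp add: tilt_q)
qed

lemma blocks_subset: "blocks A n \<subseteq> {1..n}" by (auto simp: blocks_def)

lemma blk_in: "j \<in> {1..n} \<Longrightarrow> blk n j \<in> {1..M}"
  by (rule blk) simp_all

lemma blocks_all: "blocks {1..M} n = {1..n}"
  unfolding blocks_def using blk_in by blast

lemma sum_blocks': "A \<subseteq> {1..M} \<Longrightarrow> (\<Sum>j\<in>blocks A n. f (blk n j)) = (\<Sum>i\<in>A. f i * real (block_size blk i n))"
  unfolding blocks_def by (rule sum_blocks) (rule finite_subset[OF _ finite_atLeastAtMost])

lemma unit_probs_pvec:
  assumes "\<And>i. i \<in> {1..M} \<Longrightarrow> 0 < f i \<and> f i < 1"
  shows "unit_probs {1..n} (\<lambda>j. f (blk n j))"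
  unfolding unit_probs_def using assms[OF blk_in] by blast

lemma unit_tilt_p: "0 < t \<Longrightarrow> i \<in> {1..M} \<Longrightarrow> 0 < tilt t (p i) \<and> tilt t (p i) < 1"
  and unit_tilt_q: "0 < t \<Longrightarrow> i \<in> {1..M} \<Longrightarrow> 0 < tilt t (q i) \<and> tilt t (q i) < 1"
  using p01[of i] q01[of i] by (auto simp: tilt_pos tilt_less_1)

lemma k_le_card: "n \<ge> 1 \<Longrightarrow> k n \<le> card {1..n}" using k_le by simp

lemma S_bounds: "0 \<le> S n" "S n \<le> 1"
  by (auto simp: S_def sup_prob_le_nonneg sup_prob_le_le_1)

lemma rel_pvec_q_Y: "n \<ge> 1 \<Longrightarrow> rel_pmf (\<le>) (pvec q n) (Y n)"
  unfolding Y_def pvec_def by (intro rel_pmf_bvec_at_least unit_probs_pvec q01 k_le_card)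

text \<open>Conditioning \<open>Y\<close> on a large total only raises it, so lower bounds may be
  proved against the unconditioned vector.\<close>

lemma S_ge_coup: "n \<ge> 1 \<Longrightarrow> coup s (X n) (pvec q n) \<Longrightarrow> s \<le> S n"
  unfolding S_def by (rule sup_prob_le_ge, rule coup_mono[OF _ _ rel_pvec_q_Y]) (auto intro: rel_pmf_reflI)

text \<open>The conditioned \<open>Y\<close> is dominated by its upward tilt under the same
  conditioning; \<open>u\<close> is chosen so that the event in the denominator is not rare.\<close>

lemma S_le_threshold:
  assumes "0 < t" "1 \<le> u" "n \<ge> 1"
  shows "S n \<le> Pr (X n) {x. real (tot (blocks A n) x) \<le> z} +
     Pr (pvec (\<lambda>i. tilt u (q i)) n) {x. z < real (tot (blocks A n) x)} /
       Pr (pvec (\<lambda>i. tilt u (q i)) n) (at_least {1..n} (k n))"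
proof -
  have mono: "mono (\<lambda>x. real (tot (blocks A n) x))"
    using tot_mono[of "blocks A n"] finite_subset[OF blocks_subset] by (auto simp: mono_def)
  have "S n \<le> Pr (X n) {x. real (tot (blocks A n) x) \<le> z} + Pr (Y n) {x. z < real (tot (blocks A n) x)}"
    unfolding S_def by (rule sup_prob_le_threshold[OF mono])
  also have "Pr (Y n) {x. z < real (tot (blocks A n) x)} \<le>
     Pr (pvec (\<lambda>i. tilt u (q i)) n) {x. z < real (tot (blocks A n) x)} /
       Pr (pvec (\<lambda>i. tilt u (q i)) n) (at_least {1..n} (k n))"
    unfolding Y_def pvec_def using assms
    by (intro prob_at_least_gt_le mono unit_probs_pvec q01 k_le_card) auto
  finally show ?thesis by simp
qed

lemma X_prob_le:
  assumes "0 < t" "n \<ge> 1"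
  shows "Pr (X n) {x. real (tot (blocks A n) x) \<le> z} \<le>
     Pr (pvec (\<lambda>i. tilt t (p i)) n) {x. real (tot (blocks A n) x) \<le> z} /
       Pr (pvec (\<lambda>i. tilt t (p i)) n) (at_most {1..n} (k n))"
proof -
  have mono: "mono (\<lambda>x. real (tot (blocks A n) x))"
    using tot_mono[of "blocks A n"] finite_subset[OF blocks_subset] by (auto simp: mono_def)
  show ?thesis
    unfolding X_def pvec_def using assms
    by (intro prob_at_least_le_le mono unit_probs_pvec p01 k_le_card) auto
qed

text \<open>With a single ratio, the vector with probabilities \<open>q\<close> is the tilt by
  \<open>1 / \<beta> \<ge> 1\<close> of the one with probabilities \<open>p\<close>, and
  conditioning both on the same event keeps the order.\<close>

theorem all_equal_case:
  assumes eq: "\<forall>i\<in>{1..M}. \<forall>j\<in>{1..M}. odds_ratio p q i = odds_ratio p q j" and n: "n \<ge> 1"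
  shows "S n = 1"
proof -
  have odds: "odds_ratio p q i = \<beta>" if "i \<in> {1..M}" for i
    using ex_\<beta> bspec[OF bspec[OF eq that]] by metis
  have "bvec {1..n} (\<lambda>j. q (blk n j)) = bvec {1..n} (\<lambda>j. tilt (1 / \<beta>) (p (blk n j)))"
    unfolding bvec_def using blk[OF n] q_eq_tilt odds by (intro Pi_pmf_cong) auto
  moreover have "rel_pmf (\<le>) (X n) (cond_pmf (bvec {1..n} (\<lambda>j. tilt (1 / \<beta>) (p (blk n j)))) (at_least {1..n} (k n)))"
    unfolding X_def pvec_def using \<beta>_pos \<beta>_le_1
    by (intro rel_pmf_at_least_tilt unit_probs_pvec p01 k_le_card n) auto
  ultimately have "coup 1 (X n) (Y n)" by (intro coup_1I) (simp add: Y_def pvec_def)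
  hence "1 \<le> S n" unfolding S_def by (rule sup_prob_le_ge)
  thus ?thesis using S_bounds(2)[of n] by simp
qed

lemma k_hat_eq: "k_hat M blk p q n = (\<Sum>j\<in>{1..n}. tilt (1 / \<beta>) (p (blk n j)))"
proof -
  have "tilt (1 / \<beta>) (p i) = p i / (p i + \<beta> * (1 - p i))" if "i \<in> {1..M}" for i
  proof -
    have "p i / \<beta> / ((\<beta> * (1 - p i) + p i) / \<beta>) = p i / (p i + \<beta> * (1 - p i))"
      using \<beta>_pos by (simp add: add.commute)
    thus ?thesis using \<beta>_pos by (simp add: tilt_def add_divide_distrib)
  qed
  moreover have "(\<Sum>j\<in>{1..n}. tilt (1 / \<beta>) (p (blk n j))) = (\<Sum>i=1..M. tilt (1 / \<beta>) (p i) * real (block_size blk i n))"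
    unfolding blocks_all[of n, symmetric] by (rule sum_blocks') simp
  ultimately show ?thesis
    by (auto simp: k_hat_def \<beta>_def[symmetric] intro!: sum.cong)
qed

text \<open>The tilt \<open>1 / \<beta>\<close> is the largest that stays below \<open>q\<close> in
  every block. The tilted total has mean \<open>k_hat\<close>, so \<open>- D n\<close> is the
  distance from the threshold up to this mean in units of the square root of \<open>n\<close>, and
  Hoeffding's bound applies with it.\<close>

theorem case_minus_infinity:
  assumes D: "filterlim D at_bot sequentially"
  shows "S \<longlonglongrightarrow> 1"
proof (rule tendsto_sandwich)
  have D': "filterlim (\<lambda>n. - D n) at_top sequentially"
    using D by (simp add: filterlim_uminus_at_top)
  show "eventually (\<lambda>n. 1 - 2 * exp (- 2 * (- D n)\<^sup>2) \<le> S n) sequentially"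
    using filterlim_at_top_dense[THEN iffD1, OF D', rule_format, of 0] eventually_ge_at_top[of 1]
  proof eventually_elim
    case (elim n)
    let ?r = "\<lambda>j. tilt (1 / \<beta>) (p (blk n j))"
    have t: "1 \<le> 1 / \<beta>" "0 < 1 / \<beta>" using \<beta>_pos \<beta>_le_1 by auto
    have "coup (Pr (bvec {1..n} ?r) (at_least {1..n} (k n))) (X n) (pvec q n)"
      unfolding X_def pvec_def
    proof (intro coup_at_least_tilt unit_probs_pvec p01 q01 k_le_card t(1) elim)
      fix j assume "j \<in> {1..n}"
      thus "tilt (1 / \<beta>) (p (blk n j)) \<le> q (blk n j)"
        using tilt_p_le_q[of "blk n j" 1] blk[OF elim(2)] by simp
    qed auto
    hence "Pr (bvec {1..n} ?r) (at_least {1..n} (k n)) \<le> S n"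
      by (rule S_ge_coup[OF elim(2)])
    moreover have "Pr (bvec {1..n} ?r) {x. real (tot {1..n} x) \<le> real (k n)} \<le> 2 * exp (- 2 * (- D n)\<^sup>2)"
    proof (rule prob_tot_le)
      show "unit_probs {1..n} ?r" using unit_tilt_p[OF t(2)] by (rule unit_probs_pvec)
      show "- D n * sqrt n \<le> (\<Sum>j\<in>{1..n}. ?r j) - real (k n)"
        using elim by (simp add: D_def k_hat_eq)
    qed (use elim in auto)
    ultimately show ?case using prob_at_least_ge[of "bvec {1..n} ?r" "{1..n}" "k n"] by linarith
  qed
  have "(\<lambda>n. 1 - 2 * exp (- 2 * (- D n)\<^sup>2)) \<longlonglongrightarrow> 1 - 0"
    by (intro tendsto_diff tendsto_const exp_neg_square_tendsto_0 D')
  thus "(\<lambda>n. 1 - 2 * exp (- 2 * (- D n)\<^sup>2)) \<longlonglongrightarrow> 1" by simp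
qed (use S_bounds in auto)

section \<open>Deviations at linear scale\<close>

lemma mean_lim:
  assumes "A \<subseteq> {1..M}"
  shows "(\<lambda>n. (\<Sum>j\<in>blocks A n. f (blk n j)) / real n) \<longlonglongrightarrow> (\<Sum>i\<in>A. f i * \<alpha>s i)"
proof -
  have "(\<lambda>n. \<Sum>i\<in>A. f i * (real (block_size blk i n) / real n)) \<longlonglongrightarrow> (\<Sum>i\<in>A. f i * \<alpha>s i)"
    using assms by (intro tendsto_sum tendsto_mult tendsto_const block_lim) auto
  thus ?thesis unfolding sum_blocks'[OF assms] by (simp add: sum_divide_distrib)
qed

text \<open>Half the limiting slope, split as \<open>l / 2 * sqrt n\<close> times
  \<open>sqrt n\<close> to match the form in which Hoeffding's bound is used.\<close>

lemma linear_gap: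
  assumes "(\<lambda>n. f n / real n) \<longlonglongrightarrow> l" "0 < l"
  shows "eventually (\<lambda>n. l / 2 * sqrt n * sqrt n \<le> f n \<and> 0 < l / 2 * sqrt n) sequentially"
proof -
  have "l / 2 < l" using assms(2) by simp
  from order_tendstoD(1)[OF assms(1) this] eventually_gt_at_top[of "0 :: nat"] show ?thesis
    by eventually_elim (use assms(2) in \<open>auto simp: field_simps\<close>)
qed

lemma linear_tail: "0 < l \<Longrightarrow> (\<lambda>n. 2 * exp (- 2 * (l / 2 * sqrt (real n))\<^sup>2)) \<longlonglongrightarrow> 0"
proof -
  assume "0 < l"
  hence "filterlim (\<lambda>n. l / 2 * sqrt (real n)) at_top sequentially" by real_asymp
  thus ?thesis by (rule exp_neg_square_tendsto_0)
qed

lemma prob_le_tendsto_0: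
  assumes A: "A \<subseteq> {1..M}" and f: "\<And>i. i \<in> {1..M} \<Longrightarrow> 0 < f i \<and> f i < 1"
    and z: "(\<lambda>n. z n / real n) \<longlonglongrightarrow> \<zeta>" "\<zeta> < (\<Sum>i\<in>A. f i * \<alpha>s i)"
  shows "(\<lambda>n. Pr (pvec f n) {x. real (tot (blocks A n) x) \<le> z n}) \<longlonglongrightarrow> 0"
proof (rule tendsto_sandwich[OF _ _ tendsto_const linear_tail])
  let ?l = "(\<Sum>i\<in>A. f i * \<alpha>s i) - \<zeta>"
  show "0 < ?l" using z(2) by simp
  have "(\<lambda>n. ((\<Sum>j\<in>blocks A n. f (blk n j)) - z n) / real n) \<longlonglongrightarrow> ?l"
    unfolding diff_divide_distrib by (intro tendsto_diff mean_lim A z(1))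
  from linear_gap[OF this \<open>0 < ?l\<close>] eventually_gt_at_top[of "0 :: nat"]
  show "eventually (\<lambda>n. Pr (pvec f n) {x. real (tot (blocks A n) x) \<le> z n} \<le>
      2 * exp (- 2 * (?l / 2 * sqrt (real n))\<^sup>2)) sequentially"
  proof eventually_elim
    case (elim n)
    thus ?case unfolding pvec_def by (intro prob_tot_le unit_probs_pvec f blocks_subset) auto
  qed
qed simp

lemma prob_ge_tendsto_0:
  assumes A: "A \<subseteq> {1..M}" and f: "\<And>i. i \<in> {1..M} \<Longrightarrow> 0 < f i \<and> f i < 1"
    and z: "(\<lambda>n. z n / real n) \<longlonglongrightarrow> \<zeta>" "(\<Sum>i\<in>A. f i * \<alpha>s i) < \<zeta>"
  shows "(\<lambda>n. Pr (pvec f n) {x. z n \<le> real (tot (blocks A n) x)}) \<longlonglongrightarrow> 0"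
proof (rule tendsto_sandwich[OF _ _ tendsto_const linear_tail])
  let ?l = "\<zeta> - (\<Sum>i\<in>A. f i * \<alpha>s i)"
  show "0 < ?l" using z(2) by simp
  have "(\<lambda>n. (z n - (\<Sum>j\<in>blocks A n. f (blk n j))) / real n) \<longlonglongrightarrow> ?l"
    unfolding diff_divide_distrib by (intro tendsto_diff mean_lim A z(1))
  from linear_gap[OF this \<open>0 < ?l\<close>] eventually_gt_at_top[of "0 :: nat"]
  show "eventually (\<lambda>n. Pr (pvec f n) {x. z n \<le> real (tot (blocks A n) x)} \<le>
      2 * exp (- 2 * (?l / 2 * sqrt (real n))\<^sup>2)) sequentially"
  proof eventually_elim
    case (elim n)
    thus ?case unfolding pvec_def by (intro prob_tot_ge unit_probs_pvec f blocks_subset) auto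
  qed
qed simp

lemma prob_at_least_tendsto_1:
  assumes f: "\<And>i. i \<in> {1..M} \<Longrightarrow> 0 < f i \<and> f i < 1" and "\<alpha> < (\<Sum>i=1..M. f i * \<alpha>s i)"
  shows "(\<lambda>n. Pr (pvec f n) (at_least {1..n} (k n))) \<longlonglongrightarrow> 1"
proof (rule tendsto_sandwich[OF _ _ _ tendsto_const[of 1]])
  have "(\<lambda>n. 1 - Pr (pvec f n) {x. real (tot (blocks {1..M} n) x) \<le> real (k n)}) \<longlonglongrightarrow> 1 - 0"
    by (intro tendsto_diff tendsto_const prob_le_tendsto_0[OF _ f k_lim assms(2)]) auto
  thus "(\<lambda>n. 1 - Pr (pvec f n) {x. real (tot {1..n} x) \<le> real (k n)}) \<longlonglongrightarrow> 1"
    by (simp only: blocks_all diff_0_right)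
qed (use prob_at_least_ge in \<open>auto intro!: always_eventually\<close>)

lemma prob_at_most_tendsto_1:
  assumes f: "\<And>i. i \<in> {1..M} \<Longrightarrow> 0 < f i \<and> f i < 1" and "(\<Sum>i=1..M. f i * \<alpha>s i) < \<alpha>"
  shows "(\<lambda>n. Pr (pvec f n) (at_most {1..n} (k n))) \<longlonglongrightarrow> 1"
proof (rule tendsto_sandwich[OF _ _ _ tendsto_const[of 1]])
  have "(\<lambda>n. 1 - Pr (pvec f n) {x. real (k n) \<le> real (tot (blocks {1..M} n) x)}) \<longlonglongrightarrow> 1 - 0"
    by (intro tendsto_diff tendsto_const prob_ge_tendsto_0[OF _ f k_lim assms(2)]) auto
  thus "(\<lambda>n. 1 - Pr (pvec f n) {x. real (k n) \<le> real (tot {1..n} x)}) \<longlonglongrightarrow> 1"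
    by (simp only: blocks_all diff_0_right)
qed (use prob_at_most_ge in \<open>auto intro!: always_eventually\<close>)

end

section \<open>The upper regime\<close>

lemma tilt_diff:
  assumes "0 < t" "0 < s" "0 < r" "r < 1"
  shows "tilt t r - tilt s r = (t - s) * (r * (1 - r)) / ((1 - r + t * r) * (1 - r + s * r))"
  unfolding tilt_def using tilt_denom_pos[of t r] tilt_denom_pos[of s r] assms
  by (simp add: diff_frac_eq) (simp add: algebra_simps)

lemma tilt_tendsto_1: "0 < r \<Longrightarrow> ((\<lambda>t. tilt t r) \<longlongrightarrow> 1) at_top"
  unfolding tilt_def by real_asymp

lemma isCont_tilt: "0 < t \<Longrightarrow> 0 < r \<Longrightarrow> r < 1 \<Longrightarrow> isCont (\<lambda>t. tilt t r) t"
  unfolding tilt_def using tilt_denom_pos[of t r] by (intro continuous_intros) auto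

text \<open>The factor of \<open>s\<close> in the limit is the derivative of \<open>tilt t r\<close>
  with respect to ln t, which is also the variance of a Bernoulli variable with parameter
  \<open>tilt t r\<close>.\<close>

lemma tilt_scaled_tendsto:
  assumes t: "0 < t" and r: "0 < r" "r < 1" and s: "0 < s"
  shows "(\<lambda>n. sqrt (real n) * (tilt (t * (1 + s / sqrt (real n))) r - tilt t r)) \<longlonglongrightarrow>
     s * (t * (r * (1 - r)) / (1 - r + t * r)\<^sup>2)"
proof (rule Lim_transform_eventually)
  let ?t = "\<lambda>n. t * (1 + s / sqrt (real n))"
  have 0: "(\<lambda>n. s / sqrt (real n)) \<longlonglongrightarrow> 0" by real_asymp
  hence "?t \<longlonglongrightarrow> t * (1 + 0)" by (intro tendsto_intros)
  hence "(\<lambda>n. s * (t * (r * (1 - r))) / ((1 - r + ?t n * r) * (1 - r + t * r))) \<longlonglongrightarrow>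
      s * (t * (r * (1 - r))) / ((1 - r + t * (1 + 0) * r) * (1 - r + t * r))"
    using tilt_denom_pos[OF t r] by (intro tendsto_intros 0) auto
  thus "(\<lambda>n. s * (t * (r * (1 - r))) / ((1 - r + ?t n * r) * (1 - r + t * r))) \<longlonglongrightarrow>
      s * (t * (r * (1 - r)) / (1 - r + t * r)\<^sup>2)"
    by (simp add: power2_eq_square)
  show "eventually (\<lambda>n. s * (t * (r * (1 - r))) / ((1 - r + ?t n * r) * (1 - r + t * r)) =
      sqrt (real n) * (tilt (?t n) r - tilt t r)) sequentially"
    using eventually_gt_at_top[of "0 :: nat"]
  proof eventually_elim
    case (elim n)
    have "0 < ?t n" using t s by (simp add: add_pos_nonneg)
    hence eq: "tilt (?t n) r - tilt t r = (?t n - t) * (r * (1 - r)) / ((1 - r + ?t n * r) * (1 - r + t * r))"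
      by (rule tilt_diff[OF _ t r])
    have "sqrt (real n) * (tilt (?t n) r - tilt t r) =
        sqrt (real n) * (?t n - t) * (r * (1 - r)) / ((1 - r + ?t n * r) * (1 - r + t * r))"
      unfolding eq by (simp only: mult.assoc times_divide_eq_right)
    also have "sqrt (real n) * (?t n - t) = s * t" using elim by (simp add: algebra_simps)
    finally show ?case by (simp only: mult.assoc)
  qed
qed

context bernoulli_setting begin

definition mean_p :: "real \<Rightarrow> real" where "mean_p t = (\<Sum>i=1..M. tilt t (p i) * \<alpha>s i)"
definition mean_q :: "real \<Rightarrow> real" where "mean_q u = (\<Sum>i=1..M. tilt u (q i) * \<alpha>s i)"

lemma isCont_mean_p: "0 < t \<Longrightarrow> isCont mean_p t"
  unfolding mean_p_def using p01 by (intro continuous_intros isCont_tilt) auto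

lemma isCont_mean_q: "0 < t \<Longrightarrow> isCont mean_q t"
  unfolding mean_q_def using q01 by (intro continuous_intros isCont_tilt) auto

lemma mean_q_less: "0 < t \<Longrightarrow> t < u \<Longrightarrow> mean_q t < mean_q u"
  unfolding mean_q_def using M q01 \<alpha>s by (intro sum_strict_mono mult_strict_right_mono tilt_less) auto

lemma mean_p_less_mean_q:
  assumes ne: "I \<noteq> {1..M}" and u: "0 < u"
  shows "mean_p (u / \<beta>) < mean_q u"
  unfolding mean_p_def mean_q_def
proof (rule sum_strict_mono_ex1)
  show "\<forall>i\<in>{1..M}. tilt (u / \<beta>) (p i) * \<alpha>s i \<le> tilt u (q i) * \<alpha>s i"
    using tilt_p_le_q[OF _ u] \<alpha>s by (auto intro!: mult_right_mono simp: less_imp_le)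
  obtain i where "i \<in> {1..M} - I" using ne I_subset by blast
  thus "\<exists>i\<in>{1..M}. tilt (u / \<beta>) (p i) * \<alpha>s i < tilt u (q i) * \<alpha>s i"
    using tilt_p_less_q[OF _ u, of i] \<alpha>s[of i] by (intro bexI[of _ i] mult_strict_right_mono) auto
qed simp

text \<open>As the tilt grows every success probability tends to 1, and with it
  \<open>mean_q\<close>; as \<alpha> < 1, the intermediate value theorem applies.\<close>

lemma mean_q_reaches:
  assumes "mean_q 1 \<le> \<alpha>" obtains u where "1 \<le> u" "mean_q u = \<alpha>"
proof -
  have "(mean_q \<longlongrightarrow> (\<Sum>i=1..M. 1 * \<alpha>s i)) at_top"
    unfolding mean_q_def using q01 by (intro tendsto_intros tilt_tendsto_1) auto
  hence "(mean_q \<longlongrightarrow> 1) at_top" using \<alpha>s_sum by simp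
  hence "eventually (\<lambda>u. \<alpha> < mean_q u) at_top" by (rule order_tendstoD) (rule \<alpha>)
  hence "eventually (\<lambda>u. \<alpha> < mean_q u \<and> 1 \<le> u) at_top" using eventually_ge_at_top by (rule eventually_conj)
  then obtain v where v: "\<alpha> < mean_q v" "1 \<le> v" by (auto dest!: eventually_happens)
  have "\<exists>u. 1 \<le> u \<and> u \<le> v \<and> mean_q u = \<alpha>"
    using assms v by (intro IVT) (auto intro!: isCont_mean_q)
  thus ?thesis using that by blast
qed

text \<open>
  If \<open>\<alpha>\<close> is at least the limiting mean of \<open>Y\<close>, conditioning changes \<open>Y\<close> at linear scale. Then the
  parameters \<open>t\<close> and \<open>u\<close> are chosen with the mean of the tilted \<open>X\<close> below \<open>\<alpha>\<close>, the mean of the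
  tilted \<open>Y\<close> above \<open>\<alpha>\<close>, and \<open>t > u / \<beta>\<close>, so that the tilted \<open>X\<close> still wins on \<open>I\<close>.
\<close>

lemma case_plus_infinity_linear:
  assumes ne: "I \<noteq> {1..M}" and \<alpha>q: "mean_q 1 \<le> \<alpha>"
  shows "S \<longlonglongrightarrow> 0"
proof -
  \<comment> \<open>At linear scale, conditioning moves \<open>Y\<close> to its tilt by
    \<open>v\<close>, whose limiting mean is exactly \<alpha>.\<close>
  obtain v where v: "1 \<le> v" "mean_q v = \<alpha>" by (rule mean_q_reaches[OF \<alpha>q])
  have v\<beta>: "0 < v / \<beta>" using v \<beta>_pos by simp
  have "mean_p (v / \<beta>) < \<alpha>" using mean_p_less_mean_q[OF ne, of v] v by simp
  hence "eventually (\<lambda>t. mean_p t < \<alpha>) (nhds (v / \<beta>))"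
    using isCont_mean_p[OF v\<beta>] by (intro order_tendstoD) (simp_all add: tendsto_at_iff_tendsto_nhds isCont_def)
  then obtain d where d: "0 < d" "\<And>t. dist t (v / \<beta>) < d \<Longrightarrow> mean_p t < \<alpha>"
    by (auto simp: eventually_nhds_metric)
  \<comment> \<open>The strict inequality between the means at \<open>v / \<beta>\<close> and
    \<open>v\<close> leaves room \<open>d\<close>. Here \<open>t\<close> exceeds
    \<open>v / \<beta>\<close> by \<open>d / 2\<close> and \<open>u / \<beta>\<close> exceeds it by
    \<open>d / 4\<close>, so the order \<open>u / \<beta> < t\<close> holds while the mean at
    \<open>t\<close> stays below \<alpha>.\<close>
  define t where "t = v / \<beta> + d / 2"
  define u where "u = v + \<beta> * (d / 4)"
  have t: "0 < t" "mean_p t < \<alpha>" using v\<beta> d by (auto simp: t_def dist_real_def)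
  have u: "1 \<le> u" "0 < u" "\<alpha> < mean_q u"
  proof -
    have "v < u" using d \<beta>_pos by (simp add: u_def)
    thus "1 \<le> u" "0 < u" "\<alpha> < mean_q u" using v mean_q_less[of v u] by auto
  qed
  have ut: "u / \<beta> < t" using d \<beta>_pos by (simp add: u_def t_def add_divide_distrib)
  define A where "A = (\<Sum>i\<in>I. tilt t (p i) * \<alpha>s i)"
  define B where "B = (\<Sum>i\<in>I. tilt u (q i) * \<alpha>s i)"
  have "B < A"
    unfolding A_def B_def
  proof (rule sum_strict_mono)
    fix i assume i: "i \<in> I"
    hence iM: "i \<in> {1..M}" using I_subset by auto
    have "tilt u (q i) = tilt (u / \<beta>) (p i)" using tilt_p_q_I[OF i u(2)] by simp
    also have "\<dots> < tilt t (p i)" using p01[OF iM] ut u \<beta>_pos by (intro tilt_less) auto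
    finally show "tilt u (q i) * \<alpha>s i < tilt t (p i) * \<alpha>s i" using \<alpha>s[OF iM] by simp
  qed (use I_nonempty finite_subset[OF I_subset] in auto)
  define \<zeta> where "\<zeta> = (A + B) / 2"
  have \<zeta>: "B < \<zeta>" "\<zeta> < A" using \<open>B < A\<close> by (auto simp: \<zeta>_def)
  have z: "(\<lambda>n. \<zeta> * real n / real n) \<longlonglongrightarrow> \<zeta>"
    by (rule Lim_transform_eventually[OF tendsto_const]) (use eventually_gt_at_top[of "0 :: nat"] in eventually_elim, simp)
  note ft = unit_tilt_p[OF t(1)] and fu = unit_tilt_q[OF u(2)]
  let ?P1 = "\<lambda>n. Pr (pvec (\<lambda>i. tilt t (p i)) n) {x. real (tot (blocks I n) x) \<le> \<zeta> * real n}"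
  let ?Q1 = "\<lambda>n. Pr (pvec (\<lambda>i. tilt t (p i)) n) (at_most {1..n} (k n))"
  let ?P2 = "\<lambda>n. Pr (pvec (\<lambda>i. tilt u (q i)) n) {x. \<zeta> * real n \<le> real (tot (blocks I n) x)}"
  let ?Q2 = "\<lambda>n. Pr (pvec (\<lambda>i. tilt u (q i)) n) (at_least {1..n} (k n))"
  have P1: "?P1 \<longlonglongrightarrow> 0"
    using \<zeta>(2) unfolding A_def by (intro prob_le_tendsto_0[OF I_subset ft z])
  have P2: "?P2 \<longlonglongrightarrow> 0"
    using \<zeta>(1) unfolding B_def by (intro prob_ge_tendsto_0[OF I_subset fu z])
  have Q1: "?Q1 \<longlonglongrightarrow> 1" using t(2) unfolding mean_p_def by (intro prob_at_most_tendsto_1[OF ft])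
  have Q2: "?Q2 \<longlonglongrightarrow> 1" using u(3) unfolding mean_q_def by (intro prob_at_least_tendsto_1[OF fu])
  have lim: "(\<lambda>n. ?P1 n / ?Q1 n + ?P2 n / ?Q2 n) \<longlonglongrightarrow> 0 / 1 + 0 / 1"
    by (intro tendsto_intros P1 P2 Q1 Q2) auto
  show ?thesis
  proof (rule tendsto_sandwich[OF _ _ tendsto_const])
    show "(\<lambda>n. ?P1 n / ?Q1 n + ?P2 n / ?Q2 n) \<longlonglongrightarrow> 0" using lim by simp
    show "eventually (\<lambda>n. S n \<le> ?P1 n / ?Q1 n + ?P2 n / ?Q2 n) sequentially"
      using eventually_ge_at_top[of 1]
    proof eventually_elim
      case (elim n)
      have "Pr (pvec (\<lambda>i. tilt u (q i)) n) {x. \<zeta> * real n < real (tot (blocks I n) x)} / ?Q2 n \<le> ?P2 n / ?Q2 n"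
        by (intro divide_right_mono measure_pmf.finite_measure_mono) auto
      thus ?case
        using S_le_threshold[OF t(1) u(1) elim, where A = I and z = "\<zeta> * real n"]
          X_prob_le[OF t(1) elim, where A = I and z = "\<zeta> * real n"] by linarith
    qed
  qed (use S_bounds in auto)
qed

text \<open>The rate at which the limiting mean over the blocks in \<open>A\<close> reacts to a
  relative change of the tilt \<open>1 / \<beta>\<close>; it equals the limiting variance of their
  total per index of the whole vector.\<close>

definition \<kappa> :: "nat set \<Rightarrow> real" where
  "\<kappa> A = (\<Sum>i\<in>A. \<alpha>s i * (1 / \<beta> * (p i * (1 - p i)) / (1 - p i + 1 / \<beta> * p i)\<^sup>2))"

lemma \<kappa>_I_pos: "0 < \<kappa> I"
  unfolding \<kappa>_def
proof (rule sum_pos)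
  fix i assume "i \<in> I"
  hence i: "i \<in> {1..M}" using I_subset by auto
  show "0 < \<alpha>s i * (1 / \<beta> * (p i * (1 - p i)) / (1 - p i + 1 / \<beta> * p i)\<^sup>2)"
    using \<alpha>s[OF i] p01[OF i] \<beta>_pos tilt_denom_pos[of "1 / \<beta>" "p i"] by simp
qed (use I_nonempty finite_subset[OF I_subset] in auto)

lemma mean_shift:
  assumes A: "A \<subseteq> {1..M}" and s: "0 < s"
  shows "(\<lambda>n. ((\<Sum>j\<in>blocks A n. tilt (1 / \<beta> * (1 + s / sqrt (real n))) (p (blk n j))) -
      (\<Sum>j\<in>blocks A n. tilt (1 / \<beta>) (p (blk n j)))) / sqrt (real n)) \<longlonglongrightarrow> s * \<kappa> A"
proof (rule Lim_transform_eventually)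
  let ?d = "\<lambda>n i. tilt (1 / \<beta> * (1 + s / sqrt (real n))) (p i) - tilt (1 / \<beta>) (p i)"
  have "(\<lambda>n. \<Sum>i\<in>A. (real (block_size blk i n) / real n) * (sqrt (real n) * ?d n i)) \<longlonglongrightarrow>
     (\<Sum>i\<in>A. \<alpha>s i * (s * (1 / \<beta> * (p i * (1 - p i)) / (1 - p i + 1 / \<beta> * p i)\<^sup>2)))"
    using A \<beta>_pos p01 s by (intro tendsto_sum tendsto_mult block_lim tilt_scaled_tendsto) auto
  also have "(\<Sum>i\<in>A. \<alpha>s i * (s * (1 / \<beta> * (p i * (1 - p i)) / (1 - p i + 1 / \<beta> * p i)\<^sup>2))) = s * \<kappa> A"
    by (simp add: \<kappa>_def sum_distrib_left mult.left_commute)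
  finally show "(\<lambda>n. \<Sum>i\<in>A. (real (block_size blk i n) / real n) * (sqrt (real n) * ?d n i)) \<longlonglongrightarrow> s * \<kappa> A" .
  show "eventually (\<lambda>n. (\<Sum>i\<in>A. (real (block_size blk i n) / real n) * (sqrt (real n) * ?d n i)) =
     ((\<Sum>j\<in>blocks A n. tilt (1 / \<beta> * (1 + s / sqrt (real n))) (p (blk n j))) -
      (\<Sum>j\<in>blocks A n. tilt (1 / \<beta>) (p (blk n j)))) / sqrt (real n)) sequentially"
    using eventually_gt_at_top[of "0 :: nat"]
  proof eventually_elim
    case (elim n)
    have n: "sqrt (real n) / real n = 1 / sqrt (real n)"
      using elim by (simp add: real_div_sqrt divide_simps)
    have "((\<Sum>j\<in>blocks A n. tilt (1 / \<beta> * (1 + s / sqrt (real n))) (p (blk n j))) -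
      (\<Sum>j\<in>blocks A n. tilt (1 / \<beta>) (p (blk n j)))) / sqrt (real n) =
      (\<Sum>i\<in>A. ?d n i * real (block_size blk i n)) * (1 / sqrt (real n))"
      using sum_blocks'[OF A, where f = "?d n" and n = n] by (simp only: sum_subtractf times_divide_eq_right mult_1_right)
    also have "\<dots> = (\<Sum>i\<in>A. (real (block_size blk i n) / real n) * (sqrt (real n) * ?d n i))"
      unfolding n[symmetric] sum_distrib_right by (intro sum.cong) (auto simp: mult_ac)
    finally show ?case ..
  qed
qed

text \<open>
  A relative change of the tilt by \<open>s\<close> over the square root of \<open>n\<close> moves the mean over \<open>I\<close> by a multiple
  of \<open>s\<close> standard deviations, which the conditioned \<open>X\<close> dominates; \<open>s\<close> is arbitrary.
\<close>

lemma case_plus_infinity_sublinear: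
  assumes D: "filterlim D at_top sequentially" and \<alpha>q: "\<alpha> < mean_q 1"
  shows "S \<longlonglongrightarrow> 0"
proof -
  \<comment> \<open>Both summands of the threshold bound are a Hoeffding bound
    \<open>2 * exp (- 2 * (e / 4)\<^sup>2)\<close> divided by a conditioning probability of at least
    1/2; this gives 4 twice, hence the 8.\<close>
  have bound: "eventually (\<lambda>n. S n \<le> 8 * exp (- 2 * (s * \<kappa> I / 4)\<^sup>2)) sequentially" if s: "0 < s" for s
  proof -
    let ?t = "\<lambda>n. 1 / \<beta> * (1 + s / sqrt (real n))"
    let ?m = "\<lambda>A n. \<Sum>j\<in>blocks A n. tilt (?t n) (p (blk n j))"
    let ?b = "\<lambda>A n. \<Sum>j\<in>blocks A n. tilt (1 / \<beta>) (p (blk n j))"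
    define e where "e = s * \<kappa> I"
    have e: "0 < e" using s \<kappa>_I_pos by (simp add: e_def)
    have ev1: "eventually (\<lambda>n. 3 / 4 * e < (?m I n - ?b I n) / sqrt (real n)) sequentially"
      by (rule order_tendstoD(1)[OF mean_shift[OF I_subset s]]) (use e in \<open>simp add: e_def\<close>)
    have ev2: "eventually (\<lambda>n. (?m {1..M} n - ?b {1..M} n) / sqrt (real n) < s * \<kappa> {1..M} + 1) sequentially"
      by (rule order_tendstoD(2)[OF mean_shift[OF order_refl s]]) simp
    \<comment> \<open>The tilt raises the overall mean by less than
      \<open>s * \<kappa> {1..M} + 1\<close> units of the square root of \<open>n\<close>, so the
      threshold \<open>k n\<close> is left at least 2 units above it. That makes
      \<open>at_most\<close> have probability at least 1/2.\<close>
    have ev3: "eventually (\<lambda>n. s * \<kappa> {1..M} + 3 < D n) sequentially"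
      using D by (simp add: filterlim_at_top_dense)
    have "(\<lambda>n. Pr (pvec (\<lambda>i. tilt 1 (q i)) n) (at_least {1..n} (k n))) \<longlonglongrightarrow> 1"
      using \<alpha>q unfolding mean_q_def by (intro prob_at_least_tendsto_1 unit_tilt_q) auto
    hence ev4: "eventually (\<lambda>n. 1 / 2 < Pr (pvec (\<lambda>i. tilt 1 (q i)) n) (at_least {1..n} (k n))) sequentially"
      by (rule order_tendstoD) simp
    show ?thesis
      using ev1 ev2 ev3 ev4 eventually_ge_at_top[of 1]
    proof eventually_elim
      case (elim n)
      note n = elim(5)
      have sn: "0 < sqrt (real n)" using n by simp
      have t: "0 < ?t n" using \<beta>_pos s by (simp add: add_pos_nonneg)
      \<comment> \<open>Over \<open>I\<close> the mean of \<open>Y\<close> is \<open>?b I n\<close>,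
        and that of the tilted \<open>X\<close> is more than \<open>3 / 4 * e\<close> units higher.
        The cut at \<open>e / 2\<close> leaves at least \<open>e / 4\<close> on either side.\<close>
      define z where "z = ?b I n + e / 2 * sqrt (real n)"
      let ?X = "pvec (\<lambda>i. tilt (?t n) (p i)) n" and ?Y = "pvec (\<lambda>i. tilt 1 (q i)) n"
      have uX: "unit_probs {1..n} (\<lambda>j. tilt (?t n) (p (blk n j)))" by (intro unit_probs_pvec unit_tilt_p t)
      have uY: "unit_probs {1..n} (\<lambda>j. tilt 1 (q (blk n j)))" by (intro unit_probs_pvec unit_tilt_q) auto
      have P1: "Pr ?X {x. real (tot (blocks I n) x) \<le> z} \<le> 2 * exp (- 2 * (e / 4)\<^sup>2)"
        unfolding pvec_def
      proof (rule prob_tot_le[OF uX blocks_subset])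
        show "e / 4 * sqrt (real n) \<le> ?m I n - z"
          using elim(1) sn by (simp add: z_def pos_less_divide_eq)
      qed (use n e in auto)
      have "Pr ?X {x. real (k n) \<le> real (tot {1..n} x)} \<le> 2 * exp (- 2 * 2\<^sup>2)"
        unfolding pvec_def
      proof (rule prob_tot_ge[OF uX])
        have "real (k n) = ?b {1..M} n + D n * sqrt (real n)"
          using sn unfolding blocks_all by (simp add: D_def k_hat_eq)
        moreover have "(s * \<kappa> {1..M} + 3) * sqrt (real n) \<le> D n * sqrt (real n)"
          using elim(3) sn by simp
        moreover have "?m {1..M} n - ?b {1..M} n < (s * \<kappa> {1..M} + 1) * sqrt (real n)"
          using elim(2) sn by (simp add: pos_divide_less_eq)
        ultimately have "2 * sqrt (real n) \<le> real (k n) - ?m {1..M} n"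
          by (simp add: distrib_right)
        thus "2 * sqrt (real n) \<le> real (k n) - (\<Sum>j\<in>{1..n}. tilt (?t n) (p (blk n j)))"
          by (simp only: blocks_all)
      qed (use n in auto)
      moreover have "2 * exp (- 2 * 2\<^sup>2) \<le> (1 / 2 :: real)"
      proof -
        have "4 \<le> exp (8 :: real)" using exp_ge_add_one_self[of 8] by simp
        thus ?thesis by (simp add: exp_minus field_simps)
      qed
      ultimately have Q1: "1 / 2 \<le> Pr ?X (at_most {1..n} (k n))"
        using prob_at_most_ge[of ?X "k n" "{1..n}"] by linarith
      have P2: "Pr ?Y {x. z \<le> real (tot (blocks I n) x)} \<le> 2 * exp (- 2 * (e / 4)\<^sup>2)"
        unfolding pvec_def
      proof (rule prob_tot_ge[OF uY blocks_subset])
        have "?b I n = (\<Sum>j\<in>blocks I n. tilt 1 (q (blk n j)))"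
          by (intro sum.cong refl tilt_p_q_I) (auto simp: blocks_def)
        moreover have "e / 4 * sqrt (real n) \<le> e / 2 * sqrt (real n)" using e sn by simp
        ultimately show "e / 4 * sqrt (real n) \<le> z - (\<Sum>j\<in>blocks I n. tilt 1 (q (blk n j)))"
          by (simp add: z_def)
      qed (use n e in auto)
      have half: "x / y \<le> 2 * w" if "x \<le> w" "1 / 2 \<le> y" "0 \<le> x" for x y w :: real
      proof -
        have "w * 1 \<le> w * (2 * y)" using that by (intro mult_left_mono) auto
        thus ?thesis using that by (simp add: divide_le_eq mult_ac)
      qed
      have "Pr (X n) {x. real (tot (blocks I n) x) \<le> z} \<le> 2 * (2 * exp (- 2 * (e / 4)\<^sup>2))"
        by (rule order_trans[OF X_prob_le[OF t n] half[OF P1 Q1]]) simp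
      moreover have "Pr ?Y {x. z < real (tot (blocks I n) x)} /
          Pr ?Y (at_least {1..n} (k n)) \<le> 2 * (2 * exp (- 2 * (e / 4)\<^sup>2))"
      proof (rule half[OF order_trans[OF _ P2]])
        show "Pr ?Y {x. z < real (tot (blocks I n) x)} \<le> Pr ?Y {x. z \<le> real (tot (blocks I n) x)}"
          by (intro measure_pmf.finite_measure_mono) auto
      qed (use elim(4) in auto)
      ultimately show ?case
        using S_le_threshold[OF t order_refl n, where A = I and z = z] by (simp add: e_def)
    qed
  qed
  show ?thesis
  proof (rule order_tendstoI)
    fix y :: real assume y: "0 < y"
    have "((\<lambda>x::real. 8 * exp (- 2 * (x * c / 4)\<^sup>2)) \<longlongrightarrow> 0) at_top" if "0 < c" for c :: real
      using that by real_asymp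
    from this[OF \<kappa>_I_pos]
    have "((\<lambda>x. 8 * exp (- 2 * (x * \<kappa> I / 4)\<^sup>2)) \<longlongrightarrow> 0) at_top" .
    hence "eventually (\<lambda>x. 8 * exp (- 2 * (x * \<kappa> I / 4)\<^sup>2) < y) at_top"
      by (rule order_tendstoD) (rule y)
    hence "eventually (\<lambda>x. 8 * exp (- 2 * (x * \<kappa> I / 4)\<^sup>2) < y \<and> 0 < x) at_top"
      using eventually_gt_at_top by (rule eventually_conj)
    then obtain s where "8 * exp (- 2 * (s * \<kappa> I / 4)\<^sup>2) < y" "0 < s" by (auto dest!: eventually_happens)
    thus "eventually (\<lambda>n. S n < y) sequentially" using bound[of s] by (auto elim!: eventually_mono)
  next
    fix y :: real assume "y < 0"
    thus "eventually (\<lambda>n. y < S n) sequentially" using S_bounds(1) by (auto intro!: always_eventually intro: less_le_trans)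
  qed
qed

theorem case_plus_infinity:
  assumes "I \<noteq> {1..M}" "filterlim D at_top sequentially"
  shows "S \<longlonglongrightarrow> 0"
  using case_plus_infinity_linear[OF assms(1)] case_plus_infinity_sublinear[OF assms(2)]
  by (cases "mean_q 1 \<le> \<alpha>") auto

end

section \<open>The critical window\<close>

context bernoulli_setting begin

definition C :: "nat set" where "C = {1..M} - I"

definition L :: "nat set" where "L = {1..M}"

text \<open>The probabilities of the vector \<open>X'\<close> of the overview; \<open>X\<close> is
  recovered from it by the tilt \<beta>.\<close>

definition r :: "nat \<Rightarrow> real" where "r i = tilt (1 / \<beta>) (p i)"

lemma r01: "i \<in> {1..M} \<Longrightarrow> 0 < r i \<and> r i < 1"
  unfolding r_def using unit_tilt_p[of "1 / \<beta>" i] \<beta>_pos by simp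

lemma r_I: "i \<in> I \<Longrightarrow> r i = q i"
  unfolding r_def using tilt_p_q_I[of i 1] by simp

lemma p_eq_tilt_r: "i \<in> {1..M} \<Longrightarrow> p i = tilt \<beta> (r i)"
  unfolding r_def using p01[of i] \<beta>_pos by (simp add: tilt_tilt)

lemma var_term_eq: "i \<in> {1..M} \<Longrightarrow> var_term M \<alpha>s p q i = \<alpha>s i * (r i * (1 - r i))"
proof -
  assume i: "i \<in> {1..M}"
  note b = p01[OF i] \<beta>_pos
  have den: "1 - p i + 1 / \<beta> * p i = (p i + \<beta> * (1 - p i)) / \<beta>"
    using b by (simp add: field_simps)
  have "r i = p i / (p i + \<beta> * (1 - p i))"
    unfolding r_def tilt_def den using b by simp
  moreover have "1 - r i = \<beta> * (1 - p i) / (p i + \<beta> * (1 - p i))"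
    unfolding r_def using one_minus_tilt[of "1 / \<beta>" "p i"] b unfolding den by (simp add: mult.commute)
  ultimately show ?thesis
    by (simp add: var_term_def \<beta>_def[symmetric] power2_eq_square mult_ac)
qed

lemma blocks_Un: "blocks I n \<union> blocks C n = {1..n}" and blocks_Int: "blocks I n \<inter> blocks C n = {}"
proof -
  have "blocks I n \<union> blocks C n = blocks {1..M} n"
    using I_subset by (auto simp: blocks_def C_def)
  thus "blocks I n \<union> blocks C n = {1..n}" by (simp only: blocks_all)
qed (auto simp: blocks_def C_def)

lemma finite_blocks [simp]: "finite (blocks A n)"
  by (rule finite_subset[OF blocks_subset]) simp

lemma prob_pvec_tot:
  assumes "A = I \<or> A = C"
  shows "Pr (pvec f n) {x. P (tot (blocks A n) x)} =
    Pr (bvec (blocks A n) (\<lambda>j. f (blk n j))) {x. P (tot (blocks A n) x)}"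
proof -
  define B where "B = (if A = I then C else I)"
  have B: "blocks A n \<union> blocks B n = {1..n}" "blocks A n \<inter> blocks B n = {}"
    using assms blocks_Un[of n] blocks_Int[of n] by (auto simp: B_def)
  have "map_pmf (tot (blocks A n)) (pvec f n) = map_pmf (tot (blocks A n)) (bvec (blocks A n) (\<lambda>j. f (blk n j)))"
    unfolding pvec_def B(1)[symmetric] by (rule map_tot_bvec_Un) (use B in auto)
  hence "Pr (map_pmf (tot (blocks A n)) (pvec f n)) {u. P u} =
      Pr (map_pmf (tot (blocks A n)) (bvec (blocks A n) (\<lambda>j. f (blk n j)))) {u. P u}"
    by simp
  thus ?thesis by (simp add: vimage_def)
qed

text \<open>Off \<open>I\<close> there are finitely many ratios, all strictly below \<beta>, so
  their maximum \<open>m\<close> is too, and \<open>1 / m\<close> is a larger tilt than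
  \<open>1 / \<beta>\<close> that still keeps \<open>p\<close> below \<open>q\<close> there.\<close>

lemma ex_tilt_C:
  assumes ne: "I \<noteq> {1..M}"
  obtains t where "1 / \<beta> < t" "\<And>i. i \<in> C \<Longrightarrow> tilt t (p i) \<le> q i"
proof -
  have C: "finite C" "C \<noteq> {}" using ne I_subset by (auto simp: C_def)
  define m where "m = Max (odds_ratio p q ` C)"
  have "m \<in> odds_ratio p q ` C" unfolding m_def using C by (intro Max_in) auto
  then obtain i where "i \<in> C" "m = odds_ratio p q i" by auto
  hence m: "0 < m" "m < \<beta>"
    using odds_pos[of i] odds_le_\<beta>[of i] I_iff[of i] by (auto simp: C_def)
  show ?thesis
  proof (rule that[of "1 / m"])
    show "1 / \<beta> < 1 / m" using m by (simp add: frac_less2)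
    fix i assume i: "i \<in> C"
    hence iM: "i \<in> {1..M}" by (auto simp: C_def)
    have "odds_ratio p q i \<le> m" unfolding m_def using C i by (intro Max_ge) auto
    hence "tilt (1 / m) (p i) \<le> tilt (1 / odds_ratio p q i) (p i)"
      using m odds_pos[OF iM] p01[OF iM] by (intro tilt_le divide_left_mono) auto
    thus "tilt (1 / m) (p i) \<le> q i" by (simp only: q_eq_tilt[OF iM, symmetric])
  qed
qed

context
  fixes K :: real
  assumes ne: "I \<noteq> {1..M}" and D_lim: "D \<longlonglongrightarrow> K"
begin

interpretation BI: block_array I blk r \<alpha>s
  using I_subset finite_subset[OF I_subset] I_nonempty r01 \<alpha>s block_lim by unfold_locales auto

interpretation BC: block_array C blk r \<alpha>s
  using I_subset ne r01 \<alpha>s block_lim by unfold_locales (auto simp: C_def)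

interpretation BA: block_array L blk r \<alpha>s
  using M r01 \<alpha>s block_lim by unfold_locales (auto simp: L_def)

lemma idx_blocks: "BI.idx n = blocks I n" "BC.idx n = blocks C n" "BA.idx n = blocks I n \<union> blocks C n"
proof -
  show "BI.idx n = blocks I n" "BC.idx n = blocks C n" by (simp_all add: BI.idx_def BC.idx_def blocks_def)
  show "BA.idx n = blocks I n \<union> blocks C n"
  proof -
    have "L = I \<union> C" using I_subset by (auto simp: C_def L_def)
    thus ?thesis unfolding BA.idx_def blocks_def by auto
  qed
qed

lemma prb_r: "BI.prb n = (\<lambda>j. r (blk n j))" "BC.prb n = (\<lambda>j. r (blk n j))" "BA.prb n = (\<lambda>j. r (blk n j))"
  by (simp_all add: fun_eq_iff BI.prb_def BC.prb_def BA.prb_def)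

lemma mean_k_hat: "BA.mean n = k_hat M blk p q n"
  using BA.sum_prb[of n] unfolding idx_blocks blocks_Un prb_r k_hat_eq r_def by simp

lemma mean_split: "BI.mean n + BC.mean n = BA.mean n"
proof -
  have "L = I \<union> C" "I \<inter> C = {}" "finite I" "finite C"
    using I_subset finite_subset[OF I_subset] by (auto simp: C_def L_def)
  thus ?thesis unfolding BI.mean_def BC.mean_def BA.mean_def by (simp add: sum.union_disjoint)
qed

lemma sds: "BI.sd = coef_a M \<alpha>s p q" "BC.sd = coef_b M \<alpha>s p q" "BA.sd = coef_c M \<alpha>s p q"
proof -
  show a: "BI.sd = coef_a M \<alpha>s p q"
    unfolding BI.sd_def coef_a_def I_def[symmetric] using I_subset
    by (intro arg_cong[where f = sqrt] sum.cong refl) (auto simp: var_term_eq)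
  show b: "BC.sd = coef_b M \<alpha>s p q"
    unfolding BC.sd_def coef_b_def I_def[symmetric] C_def[symmetric]
    by (intro arg_cong[where f = sqrt] sum.cong refl) (auto simp: var_term_eq C_def)
  have "L = I \<union> C" "I \<inter> C = {}" "finite I" "finite C"
    using I_subset finite_subset[OF I_subset] by (auto simp: C_def L_def)
  hence "BA.sd\<^sup>2 = BI.sd\<^sup>2 + BC.sd\<^sup>2"
    unfolding BA.sd_square BI.sd_square BC.sd_square by (simp add: sum.union_disjoint)
  hence "sqrt (BA.sd\<^sup>2) = coef_c M \<alpha>s p q" by (simp add: coef_c_def a b)
  thus "BA.sd = coef_c M \<alpha>s p q" using BA.sd_pos by simp
qed

lemma k_split_lim:
  assumes "(\<lambda>n. (real_of_int (u n) - BI.mean n) / sqrt n) \<longlonglongrightarrow> v"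
  shows "(\<lambda>n. (real_of_int (int (k n) - u n) - BC.mean n) / sqrt n) \<longlonglongrightarrow> K - v"
proof -
  have "(real_of_int (int (k n) - u n) - BC.mean n) / sqrt n = D n - (real_of_int (u n) - BI.mean n) / sqrt n" for n
    unfolding D_def mean_k_hat[symmetric] mean_split[symmetric] by (simp add: diff_divide_distrib add_divide_distrib)
  thus ?thesis using tendsto_diff[OF D_lim assms] by simp
qed

lemma k_lim_BA: "(\<lambda>n. (real_of_int (int (k n)) - BA.mean n) / sqrt n) \<longlonglongrightarrow> K"
  using D_lim unfolding mean_k_hat D_def of_int_of_nat_eq .

text \<open>In the window \<open>k n\<close> differs from \<open>k_hat\<close> by order of the
  square root of \<open>n\<close>, so both have the same limit after division by
  \<open>n\<close>.\<close>

lemma \<alpha>_eq: "\<alpha> = mean_p (1 / \<beta>)"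
proof -
  have "(\<lambda>n. (\<Sum>j\<in>blocks {1..M} n. tilt (1 / \<beta>) (p (blk n j))) / real n) \<longlonglongrightarrow> mean_p (1 / \<beta>)"
    unfolding mean_p_def by (rule mean_lim) simp
  hence 1: "(\<lambda>n. k_hat M blk p q n / real n) \<longlonglongrightarrow> mean_p (1 / \<beta>)"
    by (simp only: blocks_all k_hat_eq)
  have "(\<lambda>n. 1 / sqrt (real n)) \<longlonglongrightarrow> 0" by real_asymp
  from tendsto_add[OF 1 tendsto_mult[OF D_lim this]]
  have "(\<lambda>n. k_hat M blk p q n / real n + D n * (1 / sqrt (real n))) \<longlonglongrightarrow> mean_p (1 / \<beta>)" by simp
  moreover have "k_hat M blk p q n / real n + D n * (1 / sqrt (real n)) = real (k n) / real n" for n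
    by (simp add: D_def diff_divide_distrib)
  ultimately have "(\<lambda>n. real (k n) / real n) \<longlonglongrightarrow> mean_p (1 / \<beta>)" by simp
  from LIMSEQ_unique[OF k_lim this] show ?thesis .
qed

lemma \<alpha>_less: "\<alpha> < mean_q 1"
  unfolding \<alpha>_eq by (rule mean_p_less_mean_q[OF ne]) simp

lemma X_eq: "n \<ge> 1 \<Longrightarrow> X n = cond_pmf (bvec (blocks I n \<union> blocks C n) (\<lambda>j. tilt \<beta> (r (blk n j))))
    (at_least (blocks I n \<union> blocks C n) (k n))"
proof -
  have "bvec {1..n} (\<lambda>j. p (blk n j)) = bvec {1..n} (\<lambda>j. tilt \<beta> (r (blk n j)))"
    unfolding bvec_def using p_eq_tilt_r[OF blk_in] by (intro Pi_pmf_cong) auto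
  thus ?thesis by (simp only: X_def pvec_def blocks_Un)
qed

lemma X_cdf:
  assumes "n \<ge> 1"
  shows "Pr (X n) {x. real (tot (blocks I n) x) \<le> z} =
    (\<Sum>u\<le>card (BI.idx n). sumw (BI.idx n) (BI.prb n) u *
        (if real u \<le> z then tailw (BC.idx n) (BC.prb n) \<beta> (int (k n) - int u) else 0)) /
      tailw (BA.idx n) (BA.prb n) \<beta> (int (k n))"
  unfolding X_eq[OF assms] idx_blocks prb_r
proof (rule prob_cond_tot_le)
  show "unit_probs (blocks I n \<union> blocks C n) (\<lambda>j. r (blk n j))"
    unfolding blocks_Un by (rule unit_probs_pvec) (rule r01)
  show "k n \<le> card (blocks I n \<union> blocks C n)" unfolding blocks_Un by (rule k_le_card[OF assms])
qed (use blocks_Int \<beta>_pos in auto)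

text \<open>\<open>c\<close> is the normalisation under which the tail weights converge, constant
  for \<beta> = 1 and the square root of \<open>n\<close> for \<beta> < 1; it cancels in the
  quotient. \<open>T y\<close> is the limit of the tail weight off \<open>I\<close> at a threshold
  \<open>y\<close> units above the mean.\<close>

lemma X_cdf_tendsto:
  fixes c :: "nat \<Rightarrow> real"
  assumes c: "eventually (\<lambda>n. c n \<noteq> 0) sequentially"
    and T: "\<And>d y. (\<lambda>n. (real_of_int (d n) - BC.mean n) / sqrt n) \<longlonglongrightarrow> y \<Longrightarrow>
        (\<lambda>n. c n * tailw (BC.idx n) (BC.prb n) \<beta> (d n)) \<longlonglongrightarrow> T y"
    and B: "eventually (\<lambda>n. \<forall>d. \<bar>c n * tailw (BC.idx n) (BC.prb n) \<beta> d\<bar> \<le> B) sequentially"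
    and Dd: "(\<lambda>n. c n * tailw (BA.idx n) (BA.prb n) \<beta> (int (k n))) \<longlonglongrightarrow> Dd" "Dd \<noteq> 0"
    and [measurable]: "T \<in> borel_measurable borel"
    and z: "(\<lambda>n. (zs n - BI.mean n) / sqrt n) \<longlonglongrightarrow> z"
  shows "(\<lambda>n. Pr (X n) {x. real (tot (blocks I n) x) \<le> zs n}) \<longlonglongrightarrow>
     scaled_cdf (\<lambda>x. T (K - BI.sd * x)) Dd (z / BI.sd)"
proof (rule Lim_transform_eventually)
  let ?g = "\<lambda>n u. c n * tailw (BC.idx n) (BC.prb n) \<beta> (int (k n) - u)"
  let ?N = "\<lambda>n. \<Sum>u\<le>card (BI.idx n). sumw (BI.idx n) (BI.prb n) u * (if real u \<le> zs n then ?g n (int u) else 0)"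
  let ?Dn = "\<lambda>n. c n * tailw (BA.idx n) (BA.prb n) \<beta> (int (k n))"
  have "?N \<longlonglongrightarrow> (LINT x|std_normal_distribution. (if x \<le> z / BI.sd then T (K - BI.sd * x) else 0))"
  proof (rule BI.weighted_clt[where G = "\<lambda>v. T (K - v)" and C = B])
    show "(\<lambda>n. ?g n (u n)) \<longlonglongrightarrow> T (K - v)"
      if "(\<lambda>n. (real_of_int (u n) - BI.mean n) / sqrt n) \<longlonglongrightarrow> v" for u v
      by (rule T[OF k_split_lim[OF that]])
    show "eventually (\<lambda>n. \<forall>u. \<bar>?g n u\<bar> \<le> B) sequentially"
      using B by eventually_elim blast
  qed (use z in auto)
  thus "(\<lambda>n. ?N n / ?Dn n) \<longlonglongrightarrow> scaled_cdf (\<lambda>x. T (K - BI.sd * x)) Dd (z / BI.sd)"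
    unfolding scaled_cdf_def by (intro tendsto_divide Dd)
  show "eventually (\<lambda>n. ?N n / ?Dn n = Pr (X n) {x. real (tot (blocks I n) x) \<le> zs n}) sequentially"
    using c eventually_ge_at_top[of 1]
  proof eventually_elim
    case (elim n)
    have "?N n = c n * (\<Sum>u\<le>card (BI.idx n). sumw (BI.idx n) (BI.prb n) u *
        (if real u \<le> zs n then tailw (BC.idx n) (BC.prb n) \<beta> (int (k n) - int u) else 0))"
      unfolding sum_distrib_left by (intro sum.cong) auto
    thus ?case using elim(1) by (simp add: X_cdf[OF elim(2)])
  qed
qed

lemma q_prb: "bvec (blocks I n) (\<lambda>j. q (blk n j)) = bvec (BI.idx n) (BI.prb n)"
  unfolding idx_blocks prb_r bvec_def by (intro Pi_pmf_cong) (auto simp: r_I blocks_def)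

lemma q_cdf_tendsto:
  assumes "(\<lambda>n. (zs n - BI.mean n) / sqrt n) \<longlonglongrightarrow> z"
  shows "(\<lambda>n. Pr (pvec q n) {x. real (tot (blocks I n) x) \<le> zs n}) \<longlonglongrightarrow> Phi (z / BI.sd)"
proof -
  have "Pr (pvec q n) {x. real (tot (blocks I n) x) \<le> zs n} =
      Pr (bvec (BI.idx n) (BI.prb n)) {x. real (tot (BI.idx n) x) \<le> zs n}" for n
    using prob_pvec_tot[of I q n "\<lambda>u. real u \<le> zs n"] by (simp add: q_prb idx_blocks)
  thus ?thesis using BI.prob_tot_tendsto[OF assms] by simp
qed

definition pos :: "nat \<Rightarrow> real \<Rightarrow> real" where
  "pos n w = BI.mean n + BI.sd * w * sqrt (real n)"

lemma pos_lim: "(\<lambda>n. (pos n w - BI.mean n) / sqrt (real n)) \<longlonglongrightarrow> BI.sd * w"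
proof (rule Lim_transform_eventually[OF tendsto_const])
  show "eventually (\<lambda>n. BI.sd * w = (pos n w - BI.mean n) / sqrt (real n)) sequentially"
    using eventually_gt_at_top[of "0 :: nat"] by eventually_elim (simp add: pos_def)
qed

lemma pos_mono: "v \<le> w \<Longrightarrow> pos n v \<le> pos n w"
  using BI.sd_pos by (simp add: pos_def mult_right_mono)

text \<open>The upper bound uses the threshold at the maximiser \<open>w'\<close>; there the
  conditioning of \<open>Y\<close> costs nothing because its event has probability tending to 1. The
  lower bound applies \<open>coup_split\<close> with an allowance just above the maximal gap and
  with a low cut-off for the total over \<open>I\<close>, so that the condition left off
  \<open>I\<close> is easily met.\<close>

lemma S_tendsto:
  assumes X: "\<And>w. (\<lambda>n. Pr (X n) {x. real (tot (blocks I n) x) \<le> pos n w}) \<longlonglongrightarrow> H w"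
    and H: "(H \<longlongrightarrow> 0) at_bot" and max: "\<And>w. Phi w - H w \<le> Phi w' - H w'" and d: "0 \<le> Phi w' - H w'"
  shows "S \<longlonglongrightarrow> 1 - (Phi w' - H w')"
proof (rule order_tendstoI)
  have q: "(\<lambda>n. Pr (pvec q n) {x. real (tot (blocks I n) x) \<le> pos n w}) \<longlonglongrightarrow> Phi w" for w
    using q_cdf_tendsto[OF pos_lim[of w]] BI.sd_pos by simp
  {
    fix y assume y: "1 - (Phi w' - H w') < y"
    let ?Q = "\<lambda>n. Pr (pvec (\<lambda>i. tilt 1 (q i)) n) (at_least {1..n} (k n))"
    have Q: "?Q \<longlonglongrightarrow> 1"
      using \<alpha>_less unfolding mean_q_def by (intro prob_at_least_tendsto_1 unit_tilt_q) auto
    let ?U = "\<lambda>n. Pr (X n) {x. real (tot (blocks I n) x) \<le> pos n w'} +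
      (1 - Pr (pvec q n) {x. real (tot (blocks I n) x) \<le> pos n w'}) / ?Q n"
    have "?U \<longlonglongrightarrow> H w' + (1 - Phi w') / 1"
      by (intro tendsto_intros X q Q) simp
    hence "eventually (\<lambda>n. ?U n < y) sequentially" by (rule order_tendstoD) (use y in simp)
    thus "eventually (\<lambda>n. S n < y) sequentially"
      using eventually_ge_at_top[of 1]
    proof eventually_elim
      case (elim n)
      have "S n \<le> ?U n"
        using S_le_threshold[OF zero_less_one order_refl elim(2), where A = I and z = "pos n w'"]
        by (simp add: prob_le_conv_gt)
      thus ?case using elim by simp
    qed
  }
  fix y assume y: "y < 1 - (Phi w' - H w')"
  define d where "d = Phi w' - H w'"
  \<comment> \<open>The loss budget \<open>1 - d - y\<close> is split in two: one \<epsilon> for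
    passing from limits to finite \<open>n\<close> in the gap, one for the cut-off at
    \<open>v\<close>. Strictness comes from \<open>H v < \<epsilon>\<close>.\<close>
  define \<epsilon> where "\<epsilon> = (1 - d - y) / 2"
  have \<epsilon>: "0 < \<epsilon>" using y by (simp add: \<epsilon>_def d_def)
  define d' where "d' = min 1 (d + \<epsilon>)"
  have d': "0 \<le> d'" "d' \<le> 1" "d' \<le> d + \<epsilon>" using d \<epsilon> by (auto simp: d'_def d_def)
  let ?F = "\<lambda>n w. Pr (pvec q n) {x. real (tot (blocks I n) x) \<le> pos n w}"
  let ?E = "\<lambda>n w. Pr (X n) {x. real (tot (blocks I n) x) \<le> pos n w}"
  have mono: "mono (\<lambda>w. Pr \<mu> {x. real (tot (blocks I n) x) \<le> pos n w})" for \<mu> n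
    by (intro monoI measure_pmf.finite_measure_mono) (auto intro: order_trans[OF _ pos_mono])
  have ev1: "eventually (\<lambda>n. \<forall>w. ?F n w \<le> ?E n w + d + \<epsilon>) sequentially"
    by (rule eventually_cdf_le[OF mono mono _ _ q X]) (use max d \<epsilon> in \<open>auto simp: d_def\<close>)
  have "eventually (\<lambda>w. H w < \<epsilon>) at_bot" using H by (rule order_tendstoD) (rule \<epsilon>)
  then obtain v where v: "H v < \<epsilon>" by (auto dest!: eventually_happens)
  obtain t where t: "1 / \<beta> < t" "\<And>i. i \<in> C \<Longrightarrow> tilt t (p i) \<le> q i" by (rule ex_tilt_C[OF ne]) blast
  have t1: "1 \<le> t" "0 < t"
  proof -
    have "1 \<le> 1 / \<beta>" using \<beta>_pos \<beta>_le_1 by simp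
    thus "1 \<le> t" "0 < t" using t(1) by linarith+
  qed
  let ?s = "\<lambda>n. 1 - Pr (pvec (\<lambda>i. tilt t (p i)) n) {x. real (tot (blocks C n) x) \<le> real (k n) - pos n v}"
  \<comment> \<open>To leading order \<open>k n - pos n v\<close> is the mean over \<open>C\<close>
    with probabilities \<open>r\<close>, while the tilt by \<open>t > 1 / \<beta>\<close> has a mean
    over \<open>C\<close> that is larger by a linear amount.\<close>
  have s: "?s \<longlonglongrightarrow> 1 - 0"
  proof (intro tendsto_diff tendsto_const prob_le_tendsto_0)
    show "C \<subseteq> {1..M}" by (auto simp: C_def)
    show "0 < tilt t (p i) \<and> tilt t (p i) < 1" if "i \<in> {1..M}" for i by (rule unit_tilt_p[OF t1(2) that])
    have "(\<lambda>n. (\<Sum>j\<in>blocks I n. r (blk n j)) / real n) \<longlonglongrightarrow> (\<Sum>i\<in>I. r i * \<alpha>s i)" by (rule mean_lim[OF I_subset])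
    hence 1: "(\<lambda>n. BI.mean n / real n) \<longlonglongrightarrow> (\<Sum>i\<in>I. r i * \<alpha>s i)"
      using BI.sum_prb by (simp add: idx_blocks prb_r)
    have 2: "(\<lambda>n. 1 / sqrt (real n)) \<longlonglongrightarrow> 0" by real_asymp
    have "(\<lambda>n. real (k n) / real n - (BI.mean n / real n + BI.sd * v * (1 / sqrt (real n)))) \<longlonglongrightarrow>
        \<alpha> - ((\<Sum>i\<in>I. r i * \<alpha>s i) + BI.sd * v * 0)"
      by (intro tendsto_intros k_lim 1 2)
    moreover have "real (k n) / real n - (BI.mean n / real n + BI.sd * v * (1 / sqrt (real n))) = (real (k n) - pos n v) / real n" for n
    proof -
      have "1 / sqrt (real n) = sqrt (real n) / real n" by (simp add: real_div_sqrt divide_simps)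
      thus ?thesis by (simp add: pos_def diff_divide_distrib add_divide_distrib)
    qed
    ultimately show "(\<lambda>n. (real (k n) - pos n v) / real n) \<longlonglongrightarrow> \<alpha> - (\<Sum>i\<in>I. r i * \<alpha>s i)" by simp
    have "{1..M} = I \<union> C" "I \<inter> C = {}" "finite I" "finite C"
      using I_subset finite_subset[OF I_subset] by (auto simp: C_def)
    hence "\<alpha> = (\<Sum>i\<in>I. r i * \<alpha>s i) + (\<Sum>i\<in>C. r i * \<alpha>s i)"
      unfolding \<alpha>_eq mean_p_def r_def[symmetric] by (simp add: sum.union_disjoint)
    moreover have "(\<Sum>i\<in>C. r i * \<alpha>s i) < (\<Sum>i\<in>C. tilt t (p i) * \<alpha>s i)"
    proof (rule sum_strict_mono)
      fix i assume "i \<in> C"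
      hence i: "i \<in> {1..M}" by (auto simp: C_def)
      show "r i * \<alpha>s i < tilt t (p i) * \<alpha>s i"
        unfolding r_def using t(1) \<beta>_pos p01[OF i] \<alpha>s[OF i] by (intro mult_strict_right_mono tilt_less) auto
    qed (use ne I_subset in \<open>auto simp: C_def\<close>)
    ultimately show "\<alpha> - (\<Sum>i\<in>I. r i * \<alpha>s i) < (\<Sum>i\<in>C. tilt t (p i) * \<alpha>s i)" by simp
  qed
  have "(\<lambda>n. ?s n * (1 - d' - ?E n v)) \<longlonglongrightarrow> (1 - 0) * (1 - d' - H v)"
    by (intro tendsto_intros s X)
  moreover have "y < (1 - 0) * (1 - d' - H v)"
  proof -
    have "2 * \<epsilon> = 1 - d - y" by (simp add: \<epsilon>_def)
    thus ?thesis using v d'(3) by simp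
  qed
  ultimately have ev2: "eventually (\<lambda>n. y < ?s n * (1 - d' - ?E n v)) sequentially"
    by (rule order_tendstoD)
  show "eventually (\<lambda>n. y < S n) sequentially"
    using ev1 ev2 eventually_ge_at_top[of 1]
  proof eventually_elim
    case (elim n)
    show ?case
    \<comment> \<open>Replacing both factors by larger ones needs a nonnegative second factor.
      Otherwise the product is nonpositive, and \<open>S n \<ge> 0\<close> already exceeds
      \<open>y\<close>.\<close>
    proof (cases "0 \<le> 1 - d' - ?E n v")
      case False
      have "0 \<le> ?s n" by simp
      hence "?s n * (1 - d' - ?E n v) \<le> 0" using False by (intro mult_nonneg_nonpos) auto
      thus ?thesis using elim(2) S_bounds(1)[of n] by linarith
    next
      case True
      \<comment> \<open>Rounding up serves both estimates: a natural number below \<open>m\<close>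
        is below \<open>pos n v\<close>, and \<open>pos n v \<le> m\<close> keeps the demand
        \<open>k n - m\<close> on \<open>C\<close> from growing.\<close>
      define m where "m = nat \<lceil>pos n v\<rceil>"
      let ?P = "Pr (X n) {x. tot (blocks I n) x < m}"
      let ?s' = "Pr (bvec (blocks C n) (\<lambda>j. tilt t (p (blk n j)))) (at_least (blocks C n) (k n - m))"
      have unit: "unit_probs {1..n} (\<lambda>j. p (blk n j))" "unit_probs {1..n} (\<lambda>j. q (blk n j))"
        by (intro unit_probs_pvec p01 q01; assumption)+
      have Xn: "X n = cond_pmf (bvec (blocks I n \<union> blocks C n) (\<lambda>j. p (blk n j))) (at_least (blocks I n \<union> blocks C n) (k n))"
        by (simp only: blocks_Un X_def pvec_def)
      have "coup (?s' * (1 - d' - ?P)) (X n) (bvec (blocks I n \<union> blocks C n) (\<lambda>j. q (blk n j)))"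
        unfolding Xn
      proof (rule coup_split[where \<beta> = \<beta> and t = t])
        show "p (blk n j) = tilt \<beta> (q (blk n j))" if "j \<in> blocks I n" for j
          using that p_eq_tilt_r[OF blk_in, of j n] r_I[of "blk n j"] by (auto simp: blocks_def)
        show "tilt t (p (blk n j)) \<le> q (blk n j)" if "j \<in> blocks C n" for j
          using that t(2) by (auto simp: blocks_def)
        show "k n \<le> card (blocks I n \<union> blocks C n)" unfolding blocks_Un by (rule k_le_card[OF elim(3)])
        fix z
        show "Pr (bvec (blocks I n) (\<lambda>j. q (blk n j))) {x. tot (blocks I n) x \<le> z} \<le>
          Pr (cond_pmf (bvec (blocks I n \<union> blocks C n) (\<lambda>j. p (blk n j))) (at_least (blocks I n \<union> blocks C n) (k n)))
            {x. tot (blocks I n) x \<le> z} + d'"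
        proof -
          \<comment> \<open>The standardised value of the integer \<open>z\<close>; uniformity over
            real \<open>w\<close> in \<open>eventually_cdf_le\<close> covers all these points, which
            move with \<open>n\<close>.\<close>
          define w where "w = (real z - BI.mean n) / (BI.sd * sqrt (real n))"
          have "?F n w \<le> ?E n w + (d + \<epsilon>)" using spec[OF elim(1), of w] by (simp add: add.assoc)
          moreover have "pos n w = real z" using BI.sd_pos elim(3) by (simp add: pos_def w_def)
          hence "?F n w = Pr (pvec q n) {x. tot (blocks I n) x \<le> z}"
            "?E n w = Pr (X n) {x. tot (blocks I n) x \<le> z}"
            by simp_all
          moreover have "?F n w \<le> 1" "0 \<le> ?E n w" by auto
          ultimately have "Pr (pvec q n) {x. tot (blocks I n) x \<le> z} \<le>
              Pr (X n) {x. tot (blocks I n) x \<le> z} + d'"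
            unfolding d'_def by linarith
          thus ?thesis using prob_pvec_tot[of I q n "\<lambda>u. u \<le> z"] by (simp only: Xn) simp
        qed
      qed (use unit blocks_Un blocks_Int \<beta>_pos t1 d' in \<open>auto simp only:\<close>)
      hence "?s' * (1 - d' - ?P) \<le> S n"
        unfolding blocks_Un using S_ge_coup[OF elim(3)] by (simp add: pvec_def)
      moreover have "?P \<le> ?E n v"
        by (intro measure_pmf.finite_measure_mono) (auto simp: m_def zless_nat_eq_int_zless less_ceiling_iff)
      moreover have "?s n \<le> ?s'"
      proof -
        have m: "pos n v \<le> real m" unfolding m_def by linarith
        have "1 - Pr (bvec (blocks C n) (\<lambda>j. tilt t (p (blk n j)))) {x. real (tot (blocks C n) x) \<le> real (k n) - pos n v}
            = Pr (bvec (blocks C n) (\<lambda>j. tilt t (p (blk n j)))) (UNIV - {x. real (tot (blocks C n) x) \<le> real (k n) - pos n v})"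
          by (subst measure_pmf.prob_compl[symmetric]) auto
        also have "\<dots> \<le> ?s'"
          using m by (intro measure_pmf.finite_measure_mono) (auto simp: at_least_def)
        finally show ?thesis using prob_pvec_tot[of C "\<lambda>i. tilt t (p i)" n "\<lambda>u. real u \<le> real (k n) - pos n v"] by simp
      qed
      ultimately have "?s n * (1 - d' - ?E n v) \<le> S n"
        using mult_mono[of "?s n" ?s' "1 - d' - ?E n v" "1 - d' - ?P"] True by force
      thus ?thesis using elim(2) by simp
    qed
  qed
qed

text \<open>The branches of \<open>limit_prob\<close> match \<beta> = 1 and \<beta> < 1: by
  \<open>\<alpha>_eq\<close>, \<alpha> is the limiting mean at tilt \<open>1 / \<beta>\<close>,
  which equals the mean of \<open>X\<close> before conditioning if \<beta> = 1 and is strictly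
  larger otherwise.\<close>

theorem case_finite: "S \<longlonglongrightarrow> limit_prob M \<alpha> \<alpha>s p q K"
proof -
  let ?a = "BI.sd" and ?b = "BC.sd" and ?c = "BA.sd"
  note pos = BI.sd_pos BC.sd_pos BA.sd_pos
  have c2: "?c\<^sup>2 = ?a\<^sup>2 + ?b\<^sup>2" unfolding sds by (simp add: coef_c_def)
  have posw: "((BI.sd * w) / BI.sd) = w" for w using pos by simp
  show ?thesis
  proof (cases "\<beta> = 1")
    case True
    define G where "G = (\<lambda>x. 1 - Phi ((K - ?a * x) / ?b))"
    define Dd where "Dd = 1 - Phi (K / ?c)"
    define w' where "w' = (?c - ?b) / (?a * ?c) * K"
    note mx = conditioned_tail_maximiser[OF pos, where K = K, folded G_def Dd_def w'_def]
    have [measurable]: "G \<in> borel_measurable borel" unfolding G_def by measurable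
    have Dd: "Dd \<noteq> 0" using Phi_less_1[of "K / ?c"] by (simp add: Dd_def)
    have X: "(\<lambda>n. Pr (X n) {x. real (tot (blocks I n) x) \<le> pos n w}) \<longlonglongrightarrow> scaled_cdf G Dd w" for w
      unfolding G_def
    proof (subst (2) posw[of w, symmetric], rule X_cdf_tendsto[where c = "\<lambda>_. 1" and T = "\<lambda>y. 1 - Phi (y / ?b)" and B = 1])
      show "(\<lambda>n. 1 * tailw (BC.idx n) (BC.prb n) \<beta> (d n)) \<longlonglongrightarrow> 1 - Phi (y / ?b)"
        if "(\<lambda>n. (real_of_int (d n) - BC.mean n) / sqrt n) \<longlonglongrightarrow> y" for d y
        using BC.tailw_1_tendsto[OF that] by (simp add: True)
      show "(\<lambda>n. 1 * tailw (BA.idx n) (BA.prb n) \<beta> (int (k n))) \<longlonglongrightarrow> Dd"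
        using BA.tailw_1_tendsto[OF k_lim_BA] by (simp add: True Dd_def)
    qed (use Dd pos_lim BC.tailw_1_bound in \<open>auto simp: True\<close>)
    have Gb: "\<bar>G x\<bar> \<le> 1" for x
      using Phi_less_1[of "(K - ?a * x) / ?b"] Phi_pos[of "(K - ?a * x) / ?b"] by (simp add: G_def)
    have "S \<longlonglongrightarrow> 1 - (Phi w' - scaled_cdf G Dd w')"
      by (rule S_tendsto[OF X scaled_cdf_tendsto_at_bot[OF _ Gb] mx(1,2)]) simp
    moreover have "\<alpha> = (\<Sum>i = 1..M. p i * \<alpha>s i)" using \<alpha>_eq by (simp add: True mean_p_def)
    ultimately show ?thesis
      unfolding mx(3) by (simp add: limit_prob_def Let_def sds w'_def Dd_def)
  next
    case False
    hence \<beta>1: "\<beta> < 1" using \<beta>_le_1 by simp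
    \<comment> \<open>The factor \<open>1 / (1 - \<beta>)\<close> is the sum of the geometric
      weights in the limit of \<open>tailw\<close>; it occurs in both \<open>G\<close> and
      \<open>Dd\<close> and cancels in the limiting distribution function.\<close>
    define G where "G = (\<lambda>x. normal_density 0 ?b (K - ?a * x) / (1 - \<beta>))"
    define Dd where "Dd = normal_density 0 ?c K / (1 - \<beta>)"
    define R where "R = sqrt (K\<^sup>2 + ?c\<^sup>2 * ln (?c\<^sup>2 / ?b\<^sup>2))"
    define w' where "w' = K / ?a - ?b / (?a * ?c) * R"
    have \<kappa>: "0 < 1 - \<beta>" using \<beta>1 by simp
    note mx = conditioned_local_maximiser[OF pos c2 \<kappa>, where K = K, folded G_def Dd_def R_def, folded w'_def]
    have [measurable]: "G \<in> borel_measurable borel" unfolding G_def by measurable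
    have Dd: "Dd \<noteq> 0" using normal_density_pos[OF pos(3), of 0 K] \<beta>1 by (simp add: Dd_def)
    obtain B where B: "eventually (\<lambda>n. \<forall>d. \<bar>sqrt n * tailw (BC.idx n) (BC.prb n) \<beta> d\<bar> \<le> B) sequentially"
      by (rule BC.tailw_less_1_bound[OF \<beta>_pos \<beta>1])
    have X: "(\<lambda>n. Pr (X n) {x. real (tot (blocks I n) x) \<le> pos n w}) \<longlonglongrightarrow> scaled_cdf G Dd w" for w
      unfolding G_def
    proof (subst (2) posw[of w, symmetric], rule X_cdf_tendsto[where c = "\<lambda>n. sqrt (real n)" and T = "\<lambda>y. normal_density 0 ?b y / (1 - \<beta>)"])
      show "(\<lambda>n. sqrt (real n) * tailw (BC.idx n) (BC.prb n) \<beta> (d n)) \<longlonglongrightarrow> normal_density 0 ?b y / (1 - \<beta>)"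
        if "(\<lambda>n. (real_of_int (d n) - BC.mean n) / sqrt n) \<longlonglongrightarrow> y" for d y
        by (rule BC.tailw_less_1_tendsto[OF \<beta>_pos \<beta>1 that])
      show "(\<lambda>n. sqrt (real n) * tailw (BA.idx n) (BA.prb n) \<beta> (int (k n))) \<longlonglongrightarrow> Dd"
        unfolding Dd_def by (rule BA.tailw_less_1_tendsto[OF \<beta>_pos \<beta>1 k_lim_BA])
      show "eventually (\<lambda>n. sqrt (real n) \<noteq> 0) sequentially"
        using eventually_gt_at_top[of "0 :: nat"] by eventually_elim simp
    qed (use Dd pos_lim B in auto)
    have Gb: "\<bar>G x\<bar> \<le> normal_density 0 ?b 0 / (1 - \<beta>)" for x
      using \<beta>1 pos by (auto simp: G_def normal_density_def intro!: divide_right_mono)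
    have "S \<longlonglongrightarrow> 1 - (Phi w' - scaled_cdf G Dd w')"
      by (rule S_tendsto[OF X scaled_cdf_tendsto_at_bot[OF _ Gb] mx(1,2)]) simp
    moreover have "\<alpha> \<noteq> (\<Sum>i = 1..M. p i * \<alpha>s i)"
    proof -
      have "(\<Sum>i = 1..M. tilt 1 (p i) * \<alpha>s i) < mean_p (1 / \<beta>)"
        unfolding mean_p_def using M p01 \<alpha>s \<beta>_pos \<beta>1
        by (intro sum_strict_mono mult_strict_right_mono tilt_less) auto
      thus ?thesis using \<alpha>_eq by simp
    qed
    ultimately show ?thesis
      unfolding mx(3) by (simp add: limit_prob_def Let_def sds R_def)
  qed
qed

end

end

theorem theorem1p8:
  fixes M :: nat
    and \<alpha>s :: "nat \<Rightarrow> real"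
    and \<alpha> :: real
    and p q :: "nat \<Rightarrow> real"
    and blk :: "nat \<Rightarrow> nat \<Rightarrow> nat"
    and k :: "nat \<Rightarrow> nat"
  defines "S \<equiv> \<lambda>n. sup_prob_le (cond_bernoulli_vec blk p (k n) n) (cond_bernoulli_vec blk q (k n) n)"
    and "D \<equiv> \<lambda>n. (real (k n) - k_hat M blk p q n) / sqrt (real n)"
    and "all_equal \<equiv> \<forall>i\<in>{1..M}. \<forall>j\<in>{1..M}. odds_ratio p q i = odds_ratio p q j"
  assumes "M \<ge> 1"
    and "\<And>i. i \<in> {1..M} \<Longrightarrow> 0 < \<alpha>s i \<and> \<alpha>s i \<le> 1"
    and "(\<Sum>i = 1..M. \<alpha>s i) = 1"
    and "0 < \<alpha>" "\<alpha> < 1"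
    and "\<And>i. i \<in> {1..M} \<Longrightarrow> 0 < p i \<and> p i \<le> q i \<and> q i < 1"
    and "\<And>n j. n \<ge> 1 \<Longrightarrow> j \<in> {1..n} \<Longrightarrow> blk n j \<in> {1..M}"
    and "\<And>i. i \<in> {1..M} \<Longrightarrow> (\<lambda>n. real (block_size blk i n) / real n) \<longlonglongrightarrow> \<alpha>s i"
    and "\<And>n. n \<ge> 1 \<Longrightarrow> k n \<le> n"
    and "(\<lambda>n. real (k n) / real n) \<longlonglongrightarrow> \<alpha>"
  shows "(all_equal \<longrightarrow> (\<forall>n\<ge>1. S n = 1)) \<and>
         (\<not> all_equal \<longrightarrow>
            (filterlim D at_bot sequentially \<longrightarrow> S \<longlonglongrightarrow> 1) \<and>
            (\<forall>K. D \<longlonglongrightarrow> K \<longrightarrow> S \<longlonglongrightarrow> limit_prob M \<alpha> \<alpha>s p q K) \<and>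
            (filterlim D at_top sequentially \<longrightarrow> S \<longlonglongrightarrow> 0))"
proof -
  interpret B: bernoulli_setting M \<alpha>s \<alpha> p q blk k
    using assms(4-) by unfold_locales auto
  have S: "S = B.S"
    by (simp add: fun_eq_iff S_def B.S_def B.X_def B.Y_def B.pvec_def cond_bernoulli_vec_eq)
  have D: "D = B.D" by (simp add: fun_eq_iff D_def B.D_def)
  have ne: "B.I \<noteq> {1..M}" if "\<not> all_equal"
  proof
    assume "B.I = {1..M}"
    hence "odds_ratio p q i = B.\<beta>" if "i \<in> {1..M}" for i using that B.I_iff by blast
    with \<open>\<not> all_equal\<close> show False by (simp add: all_equal_def)
  qed
  show ?thesis
    unfolding S D
  proof (intro conjI impI allI)
    show "B.S n = 1" if "all_equal" "1 \<le> n" for n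
      by (rule B.all_equal_case[OF that[unfolded all_equal_def]])
    show "B.S \<longlonglongrightarrow> 1" if "filterlim B.D at_bot sequentially"
      by (rule B.case_minus_infinity[OF that])
    show "B.S \<longlonglongrightarrow> limit_prob M \<alpha> \<alpha>s p q K" if "\<not> all_equal" "B.D \<longlonglongrightarrow> K" for K
      by (rule B.case_finite[OF ne[OF that(1)] that(2)])
    show "B.S \<longlonglongrightarrow> 0" if "\<not> all_equal" "filterlim B.D at_top sequentially"
      by (rule B.case_plus_infinity[OF ne[OF that(1)] that(2)])
  qed
qed

end
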